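(* Fix $0 < \alpha \leqslant 2$ and constants $0 < m \leqslant M$. Then there is a constant $C > 0$, depending on $m$, $M$ and $\alpha$ and independent of the dimension $d$, such that for every $0 < a \leqslant 1$, every $d \geqslant 1$ and every potential $V : \mathbb{R}^d \to [0,\infty)$ of the form $V(x) = V_1(x) + \dots + V_d(x)$, where each $V_i$ is measurable, depends only on the $i$-th coordinate $x_i$ of $x$, and satisfies $$m |x_i|^\alpha \leqslant V_i(x) \leqslant M |x_i|^\alpha, \qquad x \in \mathbb{R}^d,\ i = 1,\dots,d,$$ the Riesz transform $$R_V^a f(x) = \frac{V(x)^a}{\Gamma(a)} \int_0^\infty e^{-tL} f(x)\, t^{a-1}\, dt, \qquad L = -\tfrac12 \Delta + V,$$ satisfies $$\| R_V^a f \|_{L^1(\mathbb{R}^d)} \leqslant C \| f \|_{L^1(\mathbb{R}^d)}, \qquad f \in L^1(\mathbb{R}^d).$$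
   Context: The semigroup $e^{-tL}$, $t>0$, generated by the Schrödinger operator $L = -\frac12\Delta + V$ on $\mathbb{R}^d$ is given by the Feynman--Kac formula $$e^{-tL} f(x) = \mathbb{E}_x\left[ e^{-\int_0^t V(X_s)\, ds} f(X_t) \right],$$ where $\mathbb{E}_x$ is the expectation with respect to the Wiener measure of the standard $d$-dimensional Brownian motion $\{X_s\}_{s>0}$ starting at $x \in \mathbb{R}^d$ (so that with $V=0$ the generator is $\frac12\Delta$). The formula is used for $f \in L^1(\mathbb{R}^d)$, for which the right-hand side is well defined for every $t>0$; the integral over $t$ defining $R_V^a f(x)$ is understood for almost every $x$, its absolute convergence for almost every $x$ being part of the assertion. *)

theory Defs
  imports "HOL-Probability.Probability"
begin

text \<open>
  The dimension \<open>d\<close> is bound inside the theorem (the constant must not depend on it), so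
  \<open>\<real>\<^sup>d\<close> is the product of \<open>d\<close> copies of the Lebesgue measure on
  the reals. Its points are the extensional functions on \<open>{..<d}\<close>. The underlying
  sigma-algebra is the Borel one.
\<close>

definition Rd :: "nat \<Rightarrow> (nat \<Rightarrow> real) measure" where
  "Rd d = (\<Pi>\<^sub>M i\<in>{..<d}. lborel)"

text \<open>
  The space of continuous paths from \<open>[0,\<infinity>)\<close> to \<open>\<real>\<^sup>d\<close> with the
  sigma-algebra generated by the coordinate maps. Only the measurable structure is relevant.
\<close>

definition path_space :: "nat \<Rightarrow> (real \<Rightarrow> nat \<Rightarrow> real) measure" where
  "path_space d = restrict_space (\<Pi>\<^sub>M s\<in>{0..}. Rd d)
     {\<omega>. \<forall>i<d. continuous_on {0..} (\<lambda>s. \<omega> s i)}"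

definition increment :: "nat \<Rightarrow> real \<Rightarrow> real \<Rightarrow> (real \<Rightarrow> nat \<Rightarrow> real) \<Rightarrow> nat \<Rightarrow> real" where
  "increment d s t \<omega> = (\<lambda>i\<in>{..<d}. \<omega> t i - \<omega> s i)"

text \<open>
  \<open>W\<close> is the law on path space of the standard \<open>d\<close>-dimensional Brownian motion
  started at \<open>x\<close>; the Brownian motion itself is the coordinate process
  \<open>\<omega> \<mapsto> \<omega> s\<close>. Its increment over \<open>[s,t]\<close> is normal with
  covariance matrix \<open>(t - s) I\<close>; note that \<open>normal_density\<close> takes the standard
  deviation.
\<close>

definition wiener_measure ::
  "nat \<Rightarrow> (nat \<Rightarrow> real) \<Rightarrow> (real \<Rightarrow> nat \<Rightarrow> real) measure \<Rightarrow> bool" where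
  "wiener_measure d x W \<longleftrightarrow>
     prob_space W \<and> sets W = sets (path_space d) \<and>
     (AE \<omega> in W. \<omega> 0 = x) \<and>
     (\<forall>s t. 0 \<le> s \<and> s < t \<longrightarrow>
        distr W (Rd d) (increment d s t) =
          (\<Pi>\<^sub>M i\<in>{..<d}. density lborel (normal_density 0 (sqrt (t - s))))) \<and>
     (\<forall>n. \<forall>ts :: nat \<Rightarrow> real. 0 \<le> ts 0 \<and> (\<forall>k<n. ts k < ts (Suc k)) \<longrightarrow>
        prob_space.indep_vars W (\<lambda>_. Rd d) (\<lambda>k. increment d (ts k) (ts (Suc k))) {..<n})"

text \<open>
  The Feynman--Kac formula for \<open>exp (- t L) f x\<close> with \<open>L = - \<Delta> / 2 + V\<close>,
  where \<open>W x\<close> is the Wiener measure started at \<open>x\<close>.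
\<close>

definition feynman_kac ::
  "((nat \<Rightarrow> real) \<Rightarrow> (real \<Rightarrow> nat \<Rightarrow> real) measure) \<Rightarrow> ((nat \<Rightarrow> real) \<Rightarrow> real) \<Rightarrow> real \<Rightarrow>
     ((nat \<Rightarrow> real) \<Rightarrow> complex) \<Rightarrow> (nat \<Rightarrow> real) \<Rightarrow> complex" where
  "feynman_kac W V t f x = (LINT \<omega>|W x. exp (- (LINT s:{0..t}|lborel. V (\<omega> s))) *\<^sub>R f (\<omega> t))"

definition riesz_integrand ::
  "((nat \<Rightarrow> real) \<Rightarrow> (real \<Rightarrow> nat \<Rightarrow> real) measure) \<Rightarrow> ((nat \<Rightarrow> real) \<Rightarrow> real) \<Rightarrow> real \<Rightarrow>
     ((nat \<Rightarrow> real) \<Rightarrow> complex) \<Rightarrow> (nat \<Rightarrow> real) \<Rightarrow> real \<Rightarrow> complex" where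
  "riesz_integrand W V a f x t = (t powr (a - 1)) *\<^sub>R feynman_kac W V t f x"

definition riesz_transform ::
  "((nat \<Rightarrow> real) \<Rightarrow> (real \<Rightarrow> nat \<Rightarrow> real) measure) \<Rightarrow> ((nat \<Rightarrow> real) \<Rightarrow> real) \<Rightarrow> real \<Rightarrow>
     ((nat \<Rightarrow> real) \<Rightarrow> complex) \<Rightarrow> (nat \<Rightarrow> real) \<Rightarrow> complex" where
  "riesz_transform W V a f x =
     (V x powr a / Gamma a) *\<^sub>R (LINT t:{0<..}|lborel. riesz_integrand W V a f x t)"

definition separable_potential ::
  "nat \<Rightarrow> real \<Rightarrow> real \<Rightarrow> real \<Rightarrow> ((nat \<Rightarrow> real) \<Rightarrow> real) \<Rightarrow> bool" where
  "separable_potential d \<alpha> m M V \<longleftrightarrow>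
     (\<exists>Vi :: nat \<Rightarrow> (nat \<Rightarrow> real) \<Rightarrow> real.
        (\<forall>x\<in>space (Rd d). V x = (\<Sum>i<d. Vi i x)) \<and>
        (\<forall>i<d. Vi i \<in> borel_measurable (Rd d) \<and>
           (\<forall>x\<in>space (Rd d). \<forall>y\<in>space (Rd d). x i = y i \<longrightarrow> Vi i x = Vi i y) \<and>
           (\<forall>x\<in>space (Rd d). m * \<bar>x i\<bar> powr \<alpha> \<le> Vi i x \<and> Vi i x \<le> M * \<bar>x i\<bar> powr \<alpha>)))"

end

theory Submission
  imports Defs
begin

text \<open>
  By time reversal of Brownian motion the semigroup is symmetric, so the claim reduces to bounding
  \<open>\<integral> t\<^sup>a\<^sup>-\<^sup>1 E\<^sub>y (exp (- A\<^sub>t) V(X\<^sub>t)\<^sup>a) dt / \<Gamma>(a)\<close>, where \<open>A\<^sub>t = \<integral> V(X\<^sub>s) ds\<close> over \<open>[0,t]\<close>,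
  uniformly in the starting point \<open>y\<close>. Split \<open>V\<^sup>a \<le> \<lambda>\<^sup>a + \<lambda>\<^sup>a\<^sup>-\<^sup>1 V\<close> with a weight \<open>\<lambda>\<close> depending on \<open>t\<close>. The terms
  with a factor \<open>V\<close> are controlled by the pathwise bound \<open>\<integral> exp (- A\<^sub>t) V(X\<^sub>t) dt \<le> 1\<close>. For \<open>t \<le> 1\<close>
  take \<open>\<lambda> = Q(t) = \<Sum> \<bar>y\<^sub>i\<bar> powr \<alpha> + d t powr (\<alpha>/2)\<close>: Jensen's inequality and the independence of the
  coordinates give \<open>E\<^sub>y exp (- A\<^sub>t) \<le> exp (- c t Q(t))\<close> with \<open>c\<close> independent of \<open>d\<close>, moreover
  \<open>E\<^sub>y V(X\<^sub>t) \<le> 8 M Q(t)\<close>, and \<open>t Q(t)\<close> serves as a new time variable. For \<open>t \<ge> 1\<close> take \<open>\<lambda> = 1 / t\<close>,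
  for which the decay \<open>E\<^sub>y exp (- A\<^sub>t) \<le> C t powr (-1/4)\<close>, seen in a single coordinate, is enough.
\<close>

section \<open>Laws of processes with Gaussian increments\<close>

text \<open>The laws \<open>W x\<close> form an arbitrary family, so nothing is known about their
  dependence on \<open>x\<close>. Start and independent Gaussian increments determine a law; hence
  every \<open>W x\<close> is a translate of one law \<open>P\<close> at the origin, and Fubini's
  theorem applies to \<open>Rd d\<close> and \<open>P\<close>. The obstacle is the dimension:
  \<open>V\<close> is of size \<open>d\<close>, and a constant factor lost in one coordinate would
  be lost \<open>d\<close> times. The one-dimensional exponential bound therefore has no factor in
  front, and short times enter only through u = t Q(t): the integral of t^(a-1) Q^a / (1 + u)^2 over
  (0,1] is at most 1/a whatever the size of the coefficients of Q. The exponential bound needs a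
  small parameter, hence short times. For long times the weight 1/t leaves E exp(-A) / t, so any
  negative power of t as decay makes it integrable. The factor 1/a, unbounded as a tends to 0, is
  absorbed by the Gamma function: a Gamma(a) = Gamma(1 + a) is bounded below on (0,1].\<close>

lemma distr_PiM_invariant:
  assumes "product_sigma_finite M" "finite I"
    and [measurable]: "\<And>i. i \<in> I \<Longrightarrow> f i \<in> measurable (M i) (M i)"
    and inv: "\<And>i. i \<in> I \<Longrightarrow> distr (M i) (M i) (f i) = M i"
  shows "distr (PiM I M) (PiM I M) (\<lambda>x. \<lambda>i\<in>I. f i (x i)) = PiM I M"
proof -
  interpret product_sigma_finite M by fact
  show ?thesis
  proof (rule PiM_eqI)
    fix A assume A: "\<And>i. i \<in> I \<Longrightarrow> A i \<in> sets (M i)"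
    have vi: "f i -` A i \<inter> space (M i) \<in> sets (M i)" if "i \<in> I" for i
      using A that by measurable
    have "emeasure (distr (PiM I M) (PiM I M) (\<lambda>x. \<lambda>i\<in>I. f i (x i))) (Pi\<^sub>E I A)
        = emeasure (PiM I M) ((\<lambda>x. \<lambda>i\<in>I. f i (x i)) -` Pi\<^sub>E I A \<inter> space (PiM I M))"
      using A \<open>finite I\<close> by (subst emeasure_distr) (auto intro!: sets_PiM_I_finite measurable_restrict)
    also have "(\<lambda>x. \<lambda>i\<in>I. f i (x i)) -` Pi\<^sub>E I A \<inter> space (PiM I M) = (\<Pi>\<^sub>E i\<in>I. f i -` A i \<inter> space (M i))"
      by (auto simp: space_PiM PiE_iff Pi_iff restrict_def extensional_def)
    also have "emeasure (PiM I M) \<dots> = (\<Prod>i\<in>I. emeasure (M i) (f i -` A i \<inter> space (M i)))"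
      using vi by (intro emeasure_PiM \<open>finite I\<close>) auto
    also have "\<dots> = (\<Prod>i\<in>I. emeasure (M i) (A i))"
    proof (rule prod.cong[OF refl])
      fix i assume i: "i \<in> I"
      have "emeasure (M i) (f i -` A i \<inter> space (M i)) = emeasure (distr (M i) (M i) (f i)) (A i)"
        using i A by (subst emeasure_distr) auto
      then show "emeasure (M i) (f i -` A i \<inter> space (M i)) = emeasure (M i) (A i)"
        using inv[OF i] by simp
    qed
    finally show "emeasure (distr (PiM I M) (PiM I M) (\<lambda>x. \<lambda>i\<in>I. f i (x i))) (Pi\<^sub>E I A)
      = (\<Prod>i\<in>I. emeasure (M i) (A i))" .
  qed (use \<open>finite I\<close> in auto)
qed

text \<open>Points of \<open>Rd d\<close> are extensional, so the pointwise sum is restricted to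
  \<open>{..<d}\<close> in order to remain a point of the space.\<close>

definition vplus :: "nat \<Rightarrow> (nat \<Rightarrow> real) \<Rightarrow> (nat \<Rightarrow> real) \<Rightarrow> nat \<Rightarrow> real" where
  "vplus d x y = (\<lambda>i\<in>{..<d}. x i + y i)"

definition vminus :: "nat \<Rightarrow> (nat \<Rightarrow> real) \<Rightarrow> (nat \<Rightarrow> real) \<Rightarrow> nat \<Rightarrow> real" where
  "vminus d x y = (\<lambda>i\<in>{..<d}. x i - y i)"

lemma space_Rd: "space (Rd d) = extensional {..<d}"
  by (auto simp: Rd_def space_PiM PiE_def)

lemma measurable_Rd_component: "i < d \<Longrightarrow> (\<lambda>x. x i) \<in> borel_measurable (Rd d)"
  unfolding Rd_def by measurable

lemma measurable_into_Rd:
  assumes "\<And>i. i < d \<Longrightarrow> (\<lambda>w. f w i) \<in> borel_measurable M"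
    and "\<And>w. w \<in> space M \<Longrightarrow> f w \<in> extensional {..<d}"
  shows "f \<in> measurable M (Rd d)"
  unfolding Rd_def
  by (rule measurable_PiM_single') (use assms in \<open>auto simp: measurable_lborel1 PiE_iff\<close>)

lemma measurable_vplus [measurable (raw)]:
  assumes "f \<in> measurable M (Rd d)" "g \<in> measurable M (Rd d)"
  shows "(\<lambda>w. vplus d (f w) (g w)) \<in> measurable M (Rd d)"
proof (rule measurable_into_Rd)
  fix i assume [measurable]: "i < d"
  note [measurable] = measurable_compose[OF assms(1) measurable_Rd_component[of i d]]
    measurable_compose[OF assms(2) measurable_Rd_component[of i d]]
  show "(\<lambda>w. vplus d (f w) (g w) i) \<in> borel_measurable M"
    using \<open>i < d\<close> by (simp add: vplus_def)
qed (simp add: vplus_def)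

lemma measurable_vminus [measurable (raw)]:
  assumes "f \<in> measurable M (Rd d)" "g \<in> measurable M (Rd d)"
  shows "(\<lambda>w. vminus d (f w) (g w)) \<in> measurable M (Rd d)"
proof (rule measurable_into_Rd)
  fix i assume [measurable]: "i < d"
  note [measurable] = measurable_compose[OF assms(1) measurable_Rd_component[of i d]]
    measurable_compose[OF assms(2) measurable_Rd_component[of i d]]
  show "(\<lambda>w. vminus d (f w) (g w) i) \<in> borel_measurable M"
    using \<open>i < d\<close> by (simp add: vminus_def)
qed (simp add: vminus_def)

lemma vplus_in_space [simp]: "vplus d x y \<in> space (Rd d)" "vminus d x y \<in> space (Rd d)"
  by (auto simp: space_Rd vplus_def vminus_def)

lemma distr_Rd_vplus:
  assumes "v \<in> space (Rd d)"
  shows "distr (Rd d) (Rd d) (\<lambda>x. vplus d x v) = Rd d"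
proof -
  have "distr (PiM {..<d} (\<lambda>_. lborel)) (PiM {..<d} (\<lambda>_. lborel)) (\<lambda>x. \<lambda>i\<in>{..<d}. (\<lambda>r. v i + r) (x i))
      = PiM {..<d} (\<lambda>_. lborel)"
    by (rule distr_PiM_invariant)
      (auto simp: lborel_distr_plus product_sigma_finite_def lborel.sigma_finite_measure_axioms cong: distr_cong)
  then show ?thesis
    by (simp add: Rd_def vplus_def add.commute)
qed

section \<open>Centred Gaussian laws and processes with independent Gaussian increments\<close>

definition gauss :: "nat \<Rightarrow> real \<Rightarrow> (nat \<Rightarrow> real) measure" where
  "gauss d s = (\<Pi>\<^sub>M i\<in>{..<d}. density lborel (normal_density 0 s))"

lemma sets_gauss [simp, measurable_cong]: "sets (gauss d s) = sets (Rd d)"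
  unfolding gauss_def Rd_def by (intro sets_PiM_cong) auto

lemma distr_normal_uminus:
  assumes "s > 0"
  shows "distr (density lborel (normal_density 0 s)) (density lborel (normal_density 0 s)) uminus
    = density lborel (normal_density 0 s)"
proof -
  interpret prob_space "density lborel (normal_density 0 s)"
    using assms by (rule prob_space_normal_density)
  have "distributed (density lborel (normal_density 0 s)) lborel (\<lambda>x. x) (normal_density 0 s)"
    unfolding distributed_def by (auto intro!: measure_eqI simp: emeasure_distr cong: distr_cong)
  from normal_density_affine[OF this assms, of "-1" 0]
  have "distributed (density lborel (normal_density 0 s)) lborel uminus (normal_density 0 s)"
    by simp
  then have "distr (density lborel (normal_density 0 s)) lborel uminus = density lborel (normal_density 0 s)"
    by (rule distributed_distr_eq_density)
  then show ?thesis
    by (metis (no_types, lifting) distr_cong sets_density)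
qed

lemma distr_gauss_uminus:
  assumes "s > 0"
  shows "distr (gauss d s) (Rd d) (\<lambda>x. \<lambda>i\<in>{..<d}. - x i) = gauss d s"
proof -
  have "distr (gauss d s) (gauss d s) (\<lambda>x. \<lambda>i\<in>{..<d}. - x i) = gauss d s"
    unfolding gauss_def
    by (rule distr_PiM_invariant)
      (use assms in \<open>auto simp: distr_normal_uminus product_sigma_finite_def prob_space_normal_density
         intro!: prob_space_imp_sigma_finite\<close>)
  then show ?thesis
    by (metis (no_types, lifting) distr_cong sets_gauss)
qed

text \<open>
  The index set \<open>I\<close> is \<open>{0..}\<close> for translated and \<open>{0..T}\<close> for time-reversed paths.
\<close>

definition gaussian_increments ::
  "nat \<Rightarrow> real set \<Rightarrow> (nat \<Rightarrow> real) \<Rightarrow> 'a measure \<Rightarrow> ('a \<Rightarrow> real \<Rightarrow> nat \<Rightarrow> real) \<Rightarrow> bool" where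
  "gaussian_increments d I x M Y \<longleftrightarrow>
     prob_space M \<and> (\<forall>s\<in>I. (\<lambda>w. Y w s) \<in> measurable M (Rd d)) \<and> (AE w in M. Y w 0 = x) \<and>
     (\<forall>s\<in>I. \<forall>t\<in>I. s < t \<longrightarrow> distr M (Rd d) (\<lambda>w. increment d s t (Y w)) = gauss d (sqrt (t - s))) \<and>
     (\<forall>n. \<forall>ts::nat \<Rightarrow> real. (\<forall>k\<le>n. ts k \<in> I) \<and> (\<forall>k<n. ts k < ts (Suc k)) \<longrightarrow>
        prob_space.indep_vars M (\<lambda>_. Rd d) (\<lambda>k w. increment d (ts k) (ts (Suc k)) (Y w)) {..<n})"

lemma increment_eq_vminus: "increment d s t p = vminus d (p t) (p s)"
  by (simp add: increment_def vminus_def)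

lemma strict_chain_less:
  fixes ts :: "nat \<Rightarrow> real"
  assumes "\<forall>k<n. ts k < ts (Suc k)" "i < j" "j \<le> n"
  shows "ts i < ts j"
  using assms(2,3)
proof (induction j)
  case (Suc j)
  then have "ts j < ts (Suc j)" using assms(1) by auto
  with Suc show ?case by (cases "i = j") auto
qed simp

text \<open>The right-hand side mentions neither \<open>N\<close> nor \<open>Z\<close>: it builds
  the positions at the times in \<open>J\<close> from independent Gaussian steps \<open>v k\<close>.
  It is the law on the left because \<open>Z w\<close> at a grid time is the starting point plus the
  increments up to that time. Selecting the steps by \<open>ts (Suc k) \<le> s\<close> instead of by
  an index lets the formula depend on the time \<open>s\<close> itself.\<close>

lemma gaussian_increments_fdd:
  assumes Z: "gaussian_increments d I x N Z" and x: "x \<in> space (Rd d)"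
    and ts: "\<forall>k\<le>n. ts k \<in> I" "\<forall>k<n. ts k < ts (Suc k)" "ts 0 = 0" and n: "n > 0"
    and J: "J \<subseteq> ts ` {..n}"
  shows "distr N (PiM J (\<lambda>_. Rd d)) (\<lambda>w. \<lambda>s\<in>J. Z w s) =
        distr (\<Pi>\<^sub>M k\<in>{..<n}. gauss d (sqrt (ts (Suc k) - ts k))) (PiM J (\<lambda>_. Rd d))
          (\<lambda>v. \<lambda>s\<in>J. \<lambda>i\<in>{..<d}. x i + (\<Sum>k | k < n \<and> ts (Suc k) \<le> s. v k i))"
    (is "_ = distr ?G _ ?\<Phi>")
proof -
  interpret prob_space N using Z by (simp add: gaussian_increments_def)
  define X where "X = (\<lambda>k w. increment d (ts k) (ts (Suc k)) (Z w))"
  have Zm: "(\<lambda>w. Z w s) \<in> measurable N (Rd d)" if "s \<in> I" for s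
    using Z that by (simp add: gaussian_increments_def)
  have Xm [measurable]: "X k \<in> measurable N (Rd d)" if "k < n" for k
    unfolding X_def increment_eq_vminus using ts(1) that by (intro measurable_vminus Zm) auto
  have "indep_vars (\<lambda>_. Rd d) X {..<n}"
    using Z ts unfolding gaussian_increments_def X_def by blast
  then have "distr N (\<Pi>\<^sub>M k\<in>{..<n}. Rd d) (\<lambda>w. \<lambda>k\<in>{..<n}. X k w) = (\<Pi>\<^sub>M k\<in>{..<n}. distr N (Rd d) (X k))"
    using n by (subst (asm) indep_vars_iff_distr_eq_PiM') auto
  also have "\<dots> = ?G"
  proof (rule PiM_cong[OF refl])
    fix k assume k: "k \<in> {..<n}"
    have "ts k \<in> I" "ts (Suc k) \<in> I" "ts k < ts (Suc k)" using ts k by auto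
    with Z show "distr N (Rd d) (X k) = gauss d (sqrt (ts (Suc k) - ts k))"
      unfolding X_def gaussian_increments_def by blast
  qed
  finally have law: "distr N (\<Pi>\<^sub>M k\<in>{..<n}. Rd d) (\<lambda>w. \<lambda>k\<in>{..<n}. X k w) = ?G" .
  have \<Phi>m: "?\<Phi> \<in> measurable (\<Pi>\<^sub>M k\<in>{..<n}. Rd d) (PiM J (\<lambda>_. Rd d))"
  proof (intro measurable_restrict measurable_into_Rd)
    fix s i assume s: "s \<in> J" and i: "i < d"
    have "(\<lambda>v. v k i) \<in> borel_measurable (\<Pi>\<^sub>M k\<in>{..<n}. Rd d)" if "k < n" for k
      by (rule measurable_compose[where f = "\<lambda>v. v k" and N = "Rd d"]) (use i that in \<open>auto intro!: measurable_component_singleton measurable_Rd_component\<close>)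
    then show "(\<lambda>v. (\<lambda>i\<in>{..<d}. x i + (\<Sum>k | k < n \<and> ts (Suc k) \<le> s. v k i)) i)
        \<in> borel_measurable (\<Pi>\<^sub>M k\<in>{..<n}. Rd d)"
      using i by (auto intro!: borel_measurable_add borel_measurable_sum)
  qed auto
  have "AE w in N. Z w 0 = x" using Z by (simp add: gaussian_increments_def)
  with AE_space have ae: "AE w in N. (\<lambda>s\<in>J. Z w s) = ?\<Phi> (\<lambda>k\<in>{..<n}. X k w)"
  proof eventually_elim
    case (elim w)
    have tele: "x i + (\<Sum>k<j. X k w i) = Z w (ts j) i" if "i < d" "j \<le> n" for i j
      using that(2)
    proof (induction j)
      case 0 then show ?case using elim ts(3) by simp
    next
      case (Suc j)
      then show ?case using \<open>i < d\<close> by (simp add: X_def increment_def)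
    qed
    show ?case
    proof (rule restrict_ext)
      fix s assume "s \<in> J"
      then obtain j where j: "j \<le> n" "s = ts j" using J by auto
      \<comment> \<open>Strict monotonicity of the grid: exactly the first \<open>j\<close> steps
        end at or before \<open>ts j\<close>.\<close>
      have "{k. k < n \<and> ts (Suc k) \<le> s} = {..<j}"
      proof (rule set_eqI)
        fix k show "k \<in> {k. k < n \<and> ts (Suc k) \<le> s} \<longleftrightarrow> k \<in> {..<j}"
        proof (cases "k < j")
          case True
          then have "ts (Suc k) \<le> ts j"
            using strict_chain_less[OF ts(2), of "Suc k" j] j by (cases "Suc k = j") auto
          then show ?thesis using True j by auto
        next
          case False
          then have "ts j < ts (Suc k)" if "k < n"
            using strict_chain_less[OF ts(2), of j "Suc k"] that by auto
          then show ?thesis using False j by force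
        qed
      qed
      then have eq: "(\<Sum>k | k < n \<and> ts (Suc k) \<le> s. (\<lambda>k\<in>{..<n}. X k w) k i) = (\<Sum>k<j. X k w i)" for i
        using j by (intro sum.cong) auto
      have "s \<in> I" using j ts by auto
      have "Z w s i = (\<lambda>i\<in>{..<d}. x i + (\<Sum>k<j. X k w i)) i" if "i < d" for i
        using tele[OF that] j that by auto
      moreover have "Z w s \<in> extensional {..<d}"
        using measurable_space[OF Zm[OF \<open>s \<in> I\<close>]] elim by (auto simp: space_Rd)
      ultimately show "Z w s = (\<lambda>i\<in>{..<d}. x i + (\<Sum>k | k < n \<and> ts (Suc k) \<le> s. (\<lambda>k\<in>{..<n}. X k w) k i))"
        unfolding eq by (intro extensionalityI[of _ "{..<d}"]) auto
    qed
  qed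
  have "distr N (PiM J (\<lambda>_. Rd d)) (\<lambda>w. \<lambda>s\<in>J. Z w s)
      = distr N (PiM J (\<lambda>_. Rd d)) (\<lambda>w. ?\<Phi> (\<lambda>k\<in>{..<n}. X k w))"
  proof (rule distr_cong_AE[OF refl refl ae])
    show "(\<lambda>w. \<lambda>s\<in>J. Z w s) \<in> measurable N (PiM J (\<lambda>_. Rd d))"
      using J ts(1) by (intro measurable_restrict Zm) auto
    show "(\<lambda>w. ?\<Phi> (\<lambda>k\<in>{..<n}. X k w)) \<in> measurable N (PiM J (\<lambda>_. Rd d))"
      by (rule measurable_compose[OF _ \<Phi>m]) (intro measurable_restrict Xm, simp)
  qed
  also have "\<dots> = distr (distr N (\<Pi>\<^sub>M k\<in>{..<n}. Rd d) (\<lambda>w. \<lambda>k\<in>{..<n}. X k w)) (PiM J (\<lambda>_. Rd d)) ?\<Phi>"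
    by (subst distr_distr[OF \<Phi>m]) (auto intro!: measurable_restrict Xm simp: comp_def)
  finally show ?thesis unfolding law .
qed

text \<open>Cylinder sets over finite \<open>J\<close> determine a finite measure on the product,
  and on each of them both laws are the same explicit Gaussian image.\<close>

lemma gaussian_increments_law_unique:
  fixes Y :: "'a \<Rightarrow> real \<Rightarrow> nat \<Rightarrow> real" and Z :: "'b \<Rightarrow> real \<Rightarrow> nat \<Rightarrow> real"
  assumes Y: "gaussian_increments d I x M Y" and Z: "gaussian_increments d I x N Z"
    and x: "x \<in> space (Rd d)" and I: "0 \<in> I" "r \<in> I" "r > 0" "I \<subseteq> {0..}"
  shows "distr M (PiM I (\<lambda>_. Rd d)) (\<lambda>w. \<lambda>s\<in>I. Y w s) = distr N (PiM I (\<lambda>_. Rd d)) (\<lambda>w. \<lambda>s\<in>I. Z w s)"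
proof (rule measure_eqI_PiM_infinite)
  interpret M: prob_space M using Y by (simp add: gaussian_increments_def)
  have Ym: "(\<lambda>w. Y w s) \<in> measurable M (Rd d)" if "s \<in> I" for s
    using Y that by (simp add: gaussian_increments_def)
  have Zm: "(\<lambda>w. Z w s) \<in> measurable N (Rd d)" if "s \<in> I" for s
    using Z that by (simp add: gaussian_increments_def)
  show "finite_measure (distr M (PiM I (\<lambda>_. Rd d)) (\<lambda>w. \<lambda>s\<in>I. Y w s))"
    by (intro M.finite_measure_distr measurable_restrict Ym)
  fix A J assume J: "finite J" "J \<subseteq> I" and A: "\<And>i. i \<in> J \<Longrightarrow> A i \<in> sets (Rd d)"
  \<comment> \<open>The time 0 is added because the position is prescribed there, and
    \<open>r > 0\<close> so that the grid has at least one step even if \<open>J\<close> is empty or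
    \<open>{0}\<close>.\<close>
  define J' where "J' = insert 0 (insert r J)"
  define xs where "xs = sorted_list_of_set J'"
  have finJ': "finite J'" using J by (simp add: J'_def)
  have set_xs: "set xs = J'" and sorted: "sorted_wrt (<) xs" and len: "length xs = card J'"
    using finJ' by (simp_all add: xs_def)
  have "card {0, r} \<le> card J'" using finJ' by (intro card_mono) (auto simp: J'_def)
  then have card: "card J' \<ge> 2" using I by simp
  define n where "n = card J' - 1"
  define ts where "ts = (\<lambda>k. xs ! k)"
  have "J' \<subseteq> I" using J I by (auto simp: J'_def)
  have img: "ts ` {..n} = J'"
    unfolding set_xs[symmetric] ts_def set_conv_nth using card len n_def by (auto simp: less_Suc_eq_le)
  have 1: "\<forall>k\<le>n. ts k \<in> I" using img \<open>J' \<subseteq> I\<close> by blast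
  have 2: "\<forall>k<n. ts k < ts (Suc k)"
    using sorted card len n_def by (auto simp: ts_def sorted_wrt_iff_nth_less)
  have 3: "ts 0 = 0"
  proof -
    have "0 \<in> ts ` {..n}" unfolding img by (simp add: J'_def)
    then obtain j where "j \<le> n" "ts j = 0" by auto
    moreover have "ts 0 \<ge> 0" using 1 I by auto
    ultimately show ?thesis using strict_chain_less[OF 2, of 0 j] by (cases "j = 0") auto
  qed
  have J'': "J \<subseteq> ts ` {..n}" unfolding img by (auto simp: J'_def)
  have n: "n > 0" using card n_def by simp
  have law: "distr M (PiM J (\<lambda>_. Rd d)) (\<lambda>w. \<lambda>s\<in>J. Y w s) = distr N (PiM J (\<lambda>_. Rd d)) (\<lambda>w. \<lambda>s\<in>J. Z w s)"
    unfolding gaussian_increments_fdd[OF Y x 1 2 3 n J''] gaussian_increments_fdd[OF Z x 1 2 3 n J''] ..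
  have Pi: "Pi\<^sub>E J A \<in> sets (PiM J (\<lambda>_. Rd d))" using J A by (intro sets_PiM_I_finite) auto
  have emb: "prod_emb I (\<lambda>_. Rd d) J (Pi\<^sub>E J A) \<in> sets (PiM I (\<lambda>_. Rd d))"
    using J A by (intro sets_PiM_I) auto
  have *: "emeasure (distr L (PiM I (\<lambda>_. Rd d)) (\<lambda>w. \<lambda>s\<in>I. U w s)) (prod_emb I (\<lambda>_. Rd d) J (Pi\<^sub>E J A))
      = emeasure (distr L (PiM J (\<lambda>_. Rd d)) (\<lambda>w. \<lambda>s\<in>J. U w s)) (Pi\<^sub>E J A)"
    if "\<And>s. s \<in> I \<Longrightarrow> (\<lambda>w. U w s) \<in> measurable L (Rd d)" for L and U :: "'c \<Rightarrow> real \<Rightarrow> nat \<Rightarrow> real"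
  proof -
    have "(\<lambda>w. \<lambda>s\<in>I. U w s) \<in> measurable L (PiM I (\<lambda>_. Rd d))" by (intro measurable_restrict that)
    moreover have "(\<lambda>w. \<lambda>s\<in>J. U w s) \<in> measurable L (PiM J (\<lambda>_. Rd d))"
      using J by (intro measurable_restrict that) auto
    moreover have "(\<lambda>w. \<lambda>s\<in>I. U w s) -` prod_emb I (\<lambda>_. Rd d) J (Pi\<^sub>E J A) \<inter> space L
        = (\<lambda>w. \<lambda>s\<in>J. U w s) -` Pi\<^sub>E J A \<inter> space L"
      using J that[THEN measurable_space] by (auto simp: prod_emb_def PiE_iff Pi_iff subset_eq)
    ultimately show ?thesis using emb Pi by (simp add: emeasure_distr)
  qed
  show "emeasure (distr M (PiM I (\<lambda>_. Rd d)) (\<lambda>w. \<lambda>s\<in>I. Y w s)) (prod_emb I (\<lambda>_. Rd d) J (Pi\<^sub>E J A))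
      = emeasure (distr N (PiM I (\<lambda>_. Rd d)) (\<lambda>w. \<lambda>s\<in>I. Z w s)) (prod_emb I (\<lambda>_. Rd d) J (Pi\<^sub>E J A))"
    using *[of Y M, OF Ym] *[of Z N, OF Zm] law by simp
qed auto

section \<open>Translation and time reversal of Brownian motion\<close>

lemma space_path_space:
  "space (path_space d) = {p \<in> extensional {0..}. (\<forall>s\<ge>0. p s \<in> space (Rd d)) \<and> (\<forall>i<d. continuous_on {0..} (\<lambda>s. p s i))}"
  by (auto simp: path_space_def space_restrict_space space_PiM PiE_iff extensional_def)

lemma measurable_into_path_space:
  assumes "\<And>s. 0 \<le> s \<Longrightarrow> (\<lambda>w. f w s) \<in> measurable M (Rd d)"
    and "\<And>w. w \<in> space M \<Longrightarrow> f w \<in> extensional {0..}"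
    and "\<And>w i. w \<in> space M \<Longrightarrow> i < d \<Longrightarrow> continuous_on {0..} (\<lambda>s. f w s i)"
  shows "f \<in> measurable M (path_space d)"
  unfolding path_space_def
proof (rule measurable_restrict_space2)
  show "f \<in> measurable M (PiM {0..} (\<lambda>_. Rd d))"
    by (rule measurable_PiM_single') (use assms in \<open>auto simp: PiE_iff extensional_def dest: measurable_space\<close>)
qed (use assms in auto)

lemma measurable_path_space_PiM: "(\<lambda>p. p) \<in> measurable (path_space d) (PiM {0..} (\<lambda>_. Rd d))"
  unfolding path_space_def by (rule measurable_restrict_space1) simp

lemma measurable_path_at: "0 \<le> s \<Longrightarrow> (\<lambda>p. p s) \<in> measurable (path_space d) (Rd d)"
  by (rule measurable_compose[OF measurable_path_space_PiM]) (rule measurable_component_singleton, simp)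

text \<open>The continuous paths need not form a measurable set of the product space. But every
  measurable set of \<open>path_space d\<close> is the trace \<open>B\<close> of a
  product-measurable \<open>A\<close>, and \<open>f\<close> takes only continuous values, so
  \<open>A\<close> and \<open>B\<close> have the same preimage.\<close>

lemma emeasure_distr_path_space:
  assumes f: "f \<in> measurable M (path_space d)" and A: "A \<in> sets (PiM {0..} (\<lambda>_. Rd d))"
  defines "B \<equiv> {\<omega>. \<forall>i<d. continuous_on {0..} (\<lambda>s. \<omega> s i)} \<inter> A"
  shows "emeasure (distr M (path_space d) f) B = emeasure (distr M (PiM {0..} (\<lambda>_. Rd d)) f) A"
proof -
  have "B \<in> sets (path_space d)"
    using A unfolding B_def path_space_def sets_restrict_space by blast
  moreover have "f \<in> measurable M (PiM {0..} (\<lambda>_. Rd d))"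
    using measurable_compose[OF f measurable_path_space_PiM] by simp
  moreover have "f -` B \<inter> space M = f -` A \<inter> space M"
    using measurable_space[OF f] by (auto simp: B_def space_path_space)
  ultimately show ?thesis using f A by (simp add: emeasure_distr)
qed

lemma distr_path_space_eqI:
  assumes f: "f \<in> measurable M (path_space d)" and g: "g \<in> measurable N (path_space d)"
    and eq: "distr M (PiM {0..} (\<lambda>_. Rd d)) f = distr N (PiM {0..} (\<lambda>_. Rd d)) g"
  shows "distr M (path_space d) f = distr N (path_space d) g"
proof (rule measure_eqI)
  fix B assume "B \<in> sets (distr M (path_space d) f)"
  then obtain A where A: "A \<in> sets (PiM {0..} (\<lambda>_. Rd d))"
    and B: "B = {\<omega>. \<forall>i<d. continuous_on {0..} (\<lambda>s. \<omega> s i)} \<inter> A"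
    unfolding path_space_def by (auto simp: sets_restrict_space)
  show "emeasure (distr M (path_space d) f) B = emeasure (distr N (path_space d) g) B"
    unfolding B emeasure_distr_path_space[OF f A] emeasure_distr_path_space[OF g A] eq ..
qed simp

lemma wiener_measure_prob: "wiener_measure d x W \<Longrightarrow> prob_space W"
  and wiener_measure_sets: "wiener_measure d x W \<Longrightarrow> sets W = sets (path_space d)"
  and wiener_measure_start: "wiener_measure d x W \<Longrightarrow> AE p in W. p 0 = x"
  by (simp_all add: wiener_measure_def)

lemma wiener_measure_gaussian_increments:
  assumes "wiener_measure d x W" "0 \<in> I" "I \<subseteq> {0..}"
  shows "gaussian_increments d I x W (\<lambda>p. p)"
  unfolding gaussian_increments_def
proof (intro conjI ballI impI allI)
  have sets: "sets W = sets (path_space d)" using assms(1) by (rule wiener_measure_sets)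
  show "(\<lambda>p. p s) \<in> measurable W (Rd d)" if "s \<in> I" for s
    using measurable_path_at[of s d] that assms(3) measurable_cong_sets[OF sets refl] by auto
  show "distr W (Rd d) (increment d s t) = gauss d (sqrt (t - s))" if "s \<in> I" "t \<in> I" "s < t" for s t
    using assms that unfolding wiener_measure_def gauss_def by auto
  show "prob_space.indep_vars W (\<lambda>_. Rd d) (\<lambda>k. increment d (ts k) (ts (Suc k))) {..<n}"
    if "(\<forall>k\<le>n. ts k \<in> I) \<and> (\<forall>k<n. ts k < ts (Suc k))" for n and ts :: "nat \<Rightarrow> real"
    using assms that unfolding wiener_measure_def by auto
qed (use assms in \<open>auto simp: wiener_measure_def\<close>)

definition path_shift :: "nat \<Rightarrow> (nat \<Rightarrow> real) \<Rightarrow> (real \<Rightarrow> nat \<Rightarrow> real) \<Rightarrow> real \<Rightarrow> nat \<Rightarrow> real" where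
  "path_shift d x p = (\<lambda>s\<in>{0..}. vplus d x (p s))"

text \<open>Only the part of a path up to time \<open>T\<close> can be reversed. Freezing the path
  afterwards gives an element of the full path space that carries just this part.\<close>

definition path_stop :: "real \<Rightarrow> (real \<Rightarrow> nat \<Rightarrow> real) \<Rightarrow> real \<Rightarrow> nat \<Rightarrow> real" where
  "path_stop T p = (\<lambda>s\<in>{0..}. p (min s T))"

text \<open>Subtracting \<open>p T\<close> lets the reversed path start at the origin, so that it
  can be compared with \<open>P\<close> itself.\<close>

definition path_reverse :: "nat \<Rightarrow> real \<Rightarrow> (real \<Rightarrow> nat \<Rightarrow> real) \<Rightarrow> real \<Rightarrow> nat \<Rightarrow> real" where
  "path_reverse d T p = (\<lambda>s\<in>{0..}. vminus d (p (T - min s T)) (p T))"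

lemma measurable_path_shift: "x \<in> space (Rd d) \<Longrightarrow> path_shift d x \<in> measurable (path_space d) (path_space d)"
proof (rule measurable_into_path_space)
  fix p i assume p: "p \<in> space (path_space d)" and i: "i < d"
  have "continuous_on {0..} (\<lambda>s. p s i)" using p i by (simp add: space_path_space)
  then have "continuous_on {0..} (\<lambda>s. x i + p s i)" by (intro continuous_on_add continuous_on_const)
  then show "continuous_on {0..} (\<lambda>s. path_shift d x p s i)"
    by (rule continuous_on_eq) (simp add: path_shift_def vplus_def i)
next
  fix s :: real assume "0 \<le> s" "x \<in> space (Rd d)"
  then show "(\<lambda>p. path_shift d x p s) \<in> measurable (path_space d) (Rd d)"
    by (simp add: path_shift_def measurable_vplus measurable_path_at)
qed (simp add: path_shift_def)

lemma measurable_path_stop: "T \<ge> 0 \<Longrightarrow> path_stop T \<in> measurable (path_space d) (path_space d)"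
proof (rule measurable_into_path_space)
  fix p i assume p: "p \<in> space (path_space d)" and i: "i < d" and T: "T \<ge> 0"
  have "continuous_on {0..} (\<lambda>s. p s i)" using p i by (simp add: space_path_space)
  then have "continuous_on {0..} (\<lambda>s. p (min s T) i)"
    by (rule continuous_on_compose2[where g = "\<lambda>s. p s i"]) (use T in \<open>auto intro!: continuous_intros\<close>)
  then show "continuous_on {0..} (\<lambda>s. path_stop T p s i)"
    by (rule continuous_on_eq) (simp add: path_stop_def)
next
  fix s :: real assume "0 \<le> s" "0 \<le> T"
  then show "(\<lambda>p. path_stop T p s) \<in> measurable (path_space d) (Rd d)"
    by (simp add: path_stop_def measurable_path_at)
qed (simp add: path_stop_def)

lemma measurable_path_reverse: "T \<ge> 0 \<Longrightarrow> path_reverse d T \<in> measurable (path_space d) (path_space d)"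
proof (rule measurable_into_path_space)
  fix p i assume p: "p \<in> space (path_space d)" and i: "i < d" and T: "T \<ge> 0"
  have "continuous_on {0..} (\<lambda>s. p s i)" using p i by (simp add: space_path_space)
  then have "continuous_on {0..} (\<lambda>s. p (T - min s T) i)"
    by (rule continuous_on_compose2[where g = "\<lambda>s. p s i"]) (use T in \<open>auto intro!: continuous_intros\<close>)
  then have "continuous_on {0..} (\<lambda>s. p (T - min s T) i - p T i)"
    by (intro continuous_on_diff continuous_on_const)
  then show "continuous_on {0..} (\<lambda>s. path_reverse d T p s i)"
    by (rule continuous_on_eq) (simp add: path_reverse_def vminus_def i)
next
  fix s :: real assume "0 \<le> s" "0 \<le> T"
  then show "(\<lambda>p. path_reverse d T p s) \<in> measurable (path_space d) (Rd d)"
    by (simp add: path_reverse_def measurable_vminus measurable_path_at)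
qed (simp add: path_reverse_def)

text \<open>A translation leaves all increments unchanged, so the shifted process has the starting
  point and the increments of \<open>W\<close>, and these determine the law.\<close>

lemma wiener_measure_shift:
  assumes W0: "wiener_measure d (\<lambda>i\<in>{..<d}. 0) P" and Wx: "wiener_measure d x W"
    and x: "x \<in> space (Rd d)"
  shows "W = distr P (path_space d) (path_shift d x)"
proof -
  have sP: "sets P = sets (path_space d)" and sW: "sets W = sets (path_space d)"
    using W0 Wx wiener_measure_sets by auto
  have gi: "gaussian_increments d {0..} (\<lambda>i\<in>{..<d}. 0) P (\<lambda>p. p)"
    by (rule wiener_measure_gaussian_increments[OF W0]) auto
  have sm: "path_shift d x \<in> measurable P (path_space d)"
    unfolding measurable_cong_sets[OF sP refl] by (rule measurable_path_shift[OF x])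
  have inc: "increment d s t (path_shift d x p) = increment d s t p" if "s \<ge> 0" "t \<ge> 0" for s t p
    using that by (intro ext) (auto simp: increment_def path_shift_def vplus_def)
  have "gaussian_increments d {0..} x P (path_shift d x)"
    unfolding gaussian_increments_def
  proof (intro conjI ballI impI allI)
    show "prob_space P" using W0 by (rule wiener_measure_prob)
    show "(\<lambda>p. path_shift d x p s) \<in> measurable P (Rd d)" if "s \<in> {0..}" for s
      by (rule measurable_compose[OF sm measurable_path_at]) (use that in auto)
    have "AE p in P. p 0 = (\<lambda>i\<in>{..<d}. 0)" using W0 by (rule wiener_measure_start)
    then show "AE p in P. path_shift d x p 0 = x"
      by eventually_elim
        (use x in \<open>auto simp: path_shift_def vplus_def space_Rd intro!: extensionalityI[of _ "{..<d}"]\<close>)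
    show "distr P (Rd d) (\<lambda>p. increment d s t (path_shift d x p)) = gauss d (sqrt (t - s))"
      if "s \<in> {0..}" "t \<in> {0..}" "s < t" for s t
      using gi that unfolding gaussian_increments_def by (simp add: inc)
    show "prob_space.indep_vars P (\<lambda>_. Rd d) (\<lambda>k p. increment d (ts k) (ts (Suc k)) (path_shift d x p)) {..<n}"
      if ts: "(\<forall>k\<le>n. ts k \<in> {0..}) \<and> (\<forall>k<n. ts k < ts (Suc k))" for n and ts :: "nat \<Rightarrow> real"
    proof -
      have "prob_space.indep_vars P (\<lambda>_. Rd d) (\<lambda>k p. increment d (ts k) (ts (Suc k)) p) {..<n}"
        using gi ts unfolding gaussian_increments_def by blast
      then show ?thesis
        by (subst prob_space.indep_vars_cong[OF wiener_measure_prob[OF W0], OF refl _ refl]) (use ts inc in auto)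
    qed
  qed
  from gaussian_increments_law_unique[OF wiener_measure_gaussian_increments[OF Wx] this x, of 1]
  have "distr W (PiM {0..} (\<lambda>_. Rd d)) (\<lambda>w. \<lambda>s\<in>{0..}. w s)
      = distr P (PiM {0..} (\<lambda>_. Rd d)) (\<lambda>w. \<lambda>s\<in>{0..}. path_shift d x w s)"
    by auto
  moreover have "distr W (PiM {0..} (\<lambda>_. Rd d)) (\<lambda>w. \<lambda>s\<in>{0..}. w s) = distr W (PiM {0..} (\<lambda>_. Rd d)) (\<lambda>w. w)"
    by (rule distr_cong) (auto simp: sets_eq_imp_space_eq[OF sW] space_path_space extensional_restrict)
  moreover have "(\<lambda>s\<in>{0..}. path_shift d x w s) = path_shift d x w" for w
    by (simp add: path_shift_def fun_eq_iff)
  ultimately have "distr W (path_space d) (\<lambda>w. w) = distr P (path_space d) (path_shift d x)"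
    by (intro distr_path_space_eqI sm) (auto simp: measurable_cong_sets[OF sW refl])
  moreover have "distr W (path_space d) (\<lambda>w. w) = W"
    by (simp add: distr_id2 sW)
  ultimately show ?thesis by simp
qed

text \<open>Time reversal lists the increments in the opposite order; independence is carried along
  this relabelling.\<close>

lemma (in prob_space) indep_vars_reindex:
  assumes inj: "inj_on f I" and indep: "indep_vars M' X (f ` I)"
  shows "indep_vars (\<lambda>i. M' (f i)) (\<lambda>i. X (f i)) I"
  unfolding indep_vars_def2
proof (intro conjI ballI indep_setsI)
  show "X (f i) \<in> measurable M (M' (f i))" if "i \<in> I" for i
    using indep that by (auto simp: indep_vars_def2)
  then show "{X (f i) -` A \<inter> space M | A. A \<in> sets (M' (f i))} \<subseteq> events" if "i \<in> I" for i
    using that by auto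
  fix A J assume J: "J \<noteq> {}" "J \<subseteq> I" "finite J"
    and A: "\<forall>j\<in>J. A j \<in> {X (f j) -` A \<inter> space M | A. A \<in> sets (M' (f j))}"
  define g where "g = the_inv_into J f"
  have inj': "inj_on f J" using inj J(2) by (rule inj_on_subset)
  have gf: "g (f j) = j" if "j \<in> J" for j
    using inj' that by (simp add: g_def the_inv_into_f_f)
  have "prob (\<Inter>k\<in>f ` J. A (g k)) = (\<Prod>k\<in>f ` J. prob (A (g k)))"
    using indep J A gf unfolding indep_vars_def2
    by (intro indep_setsD[where I = "f ` I"]) auto
  then show "prob (\<Inter>j\<in>J. A j) = (\<Prod>j\<in>J. prob (A j))"
    using gf by (simp add: prod.reindex[OF inj'] cong: INF_cong_simp)
qed

text \<open>The increment of the reversed path over \<open>[s,t]\<close> is minus the increment of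
  the original over \<open>[T-t,T-s]\<close>. Centred normal laws are symmetric and reflection keeps
  consecutive intervals disjoint, so on \<open>{0..T}\<close> both paths have increments of the same
  law.\<close>

lemma wiener_measure_reverse:
  assumes W0: "wiener_measure d (\<lambda>i\<in>{..<d}. 0) P" and T: "T > 0"
  shows "distr P (path_space d) (path_reverse d T) = distr P (path_space d) (path_stop T)"
proof -
  have sP: "sets P = sets (path_space d)" using W0 wiener_measure_sets by auto
  interpret prob_space P using W0 by (rule wiener_measure_prob)
  define z :: "nat \<Rightarrow> real" where "z = (\<lambda>i\<in>{..<d}. 0)"
  have z: "z \<in> space (Rd d)" by (simp add: z_def space_Rd)
  have gi: "gaussian_increments d {0..T} z P (\<lambda>p. p)"
    using T by (intro wiener_measure_gaussian_increments[OF W0[folded z_def]]) auto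
  have rm: "path_reverse d T \<in> measurable P (path_space d)"
    unfolding measurable_cong_sets[OF sP refl] by (rule measurable_path_reverse) (use T in simp)
  have stm: "path_stop T \<in> measurable P (path_space d)"
    unfolding measurable_cong_sets[OF sP refl] by (rule measurable_path_stop) (use T in simp)
  have inc: "increment d s t (path_reverse d T p) = (\<lambda>i\<in>{..<d}. - increment d (T - t) (T - s) p i)"
    if "s \<in> {0..T}" "t \<in> {0..T}" for s t p
    using that by (intro ext) (simp add: increment_def path_reverse_def vminus_def min_absorb1)
  have nm: "(\<lambda>x. \<lambda>i\<in>{..<d}. - x i) \<in> measurable (Rd d) (Rd d)"
    by (rule measurable_into_Rd) (auto intro!: borel_measurable_uminus measurable_Rd_component)
  have gr: "gaussian_increments d {0..T} z P (path_reverse d T)"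
    unfolding gaussian_increments_def
  proof (intro conjI ballI impI allI)
    show "prob_space P" by (rule prob_space_axioms)
    show "(\<lambda>p. path_reverse d T p s) \<in> measurable P (Rd d)" if "s \<in> {0..T}" for s
      by (rule measurable_compose[OF rm measurable_path_at]) (use that in auto)
    show "AE p in P. path_reverse d T p 0 = z"
      using T by (auto simp: path_reverse_def vminus_def z_def)
    show "distr P (Rd d) (\<lambda>p. increment d s t (path_reverse d T p)) = gauss d (sqrt (t - s))"
      if st: "s \<in> {0..T}" "t \<in> {0..T}" "s < t" for s t
    proof -
      have g: "distr P (Rd d) (\<lambda>p. increment d (T - t) (T - s) p) = gauss d (sqrt ((T - s) - (T - t)))"
        using gi st unfolding gaussian_increments_def by auto
      have im: "(\<lambda>p. increment d (T - t) (T - s) p) \<in> measurable P (Rd d)"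
        unfolding increment_eq_vminus measurable_cong_sets[OF sP refl]
        by (intro measurable_vminus measurable_path_at) (use st in auto)
      have "distr P (Rd d) (\<lambda>p. increment d s t (path_reverse d T p))
          = distr (distr P (Rd d) (\<lambda>p. increment d (T - t) (T - s) p)) (Rd d) (\<lambda>x. \<lambda>i\<in>{..<d}. - x i)"
        unfolding inc[OF st(1,2)] by (simp add: distr_distr[OF nm im] comp_def)
      also have "\<dots> = gauss d (sqrt (t - s))"
        unfolding g using st by (simp add: distr_gauss_uminus)
      finally show ?thesis .
    qed
    show "indep_vars (\<lambda>_. Rd d) (\<lambda>k p. increment d (ts k) (ts (Suc k)) (path_reverse d T p)) {..<n}"
      if ts: "(\<forall>k\<le>n. ts k \<in> {0..T}) \<and> (\<forall>k<n. ts k < ts (Suc k))" for n and ts :: "nat \<Rightarrow> real"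
    proof -
      \<comment> \<open>\<open>us\<close> is the grid \<open>ts\<close> reflected in
        \<open>[0,T]\<close>; the reversed step \<open>k\<close> of \<open>ts\<close> is step
        \<open>r k\<close> of \<open>us\<close>, whence the index \<open>n - Suc k\<close>.\<close>
      define us where "us = (\<lambda>k. T - ts (n - k))"
      define r where "r = (\<lambda>k. n - Suc k)"
      have us: "(\<forall>k\<le>n. us k \<in> {0..T}) \<and> (\<forall>k<n. us k < us (Suc k))"
      proof (intro conjI allI impI)
        fix k assume "k < n"
        then have "n - k = Suc (n - Suc k)" "n - Suc k < n" by auto
        then show "us k < us (Suc k)" using ts by (auto simp: us_def)
      qed (use ts in \<open>auto simp: us_def\<close>)
      have "indep_vars (\<lambda>_. Rd d) (\<lambda>k p. increment d (us k) (us (Suc k)) p) {..<n}"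
        using gi us unfolding gaussian_increments_def by blast
      moreover have r: "inj_on r {..<n}" "r ` {..<n} = {..<n}"
      proof -
        show "inj_on r {..<n}" by (auto simp: r_def inj_on_def)
        then show "r ` {..<n} = {..<n}" by (intro endo_inj_surj) (auto simp: r_def)
      qed
      ultimately have "indep_vars (\<lambda>_. Rd d) (\<lambda>k p. increment d (us (r k)) (us (Suc (r k))) p) {..<n}"
        using indep_vars_reindex[OF r(1), of "\<lambda>_. Rd d" "\<lambda>k p. increment d (us k) (us (Suc k)) p"]
        unfolding r(2) by blast
      then have "indep_vars (\<lambda>_. Rd d) (\<lambda>k p. \<lambda>i\<in>{..<d}. - increment d (us (r k)) (us (Suc (r k))) p i) {..<n}"
        by (rule indep_vars_compose2[where Y = "\<lambda>_ x. \<lambda>i\<in>{..<d}. - x i"]) (rule nm)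
      moreover have "us (r k) = T - ts (Suc k)" "us (Suc (r k)) = T - ts k" if "k < n" for k
      proof -
        have "n - r k = Suc k" "n - Suc (r k) = k" using that by (auto simp: r_def)
        then show "us (r k) = T - ts (Suc k)" "us (Suc (r k)) = T - ts k" by (simp_all add: us_def)
      qed
      ultimately show ?thesis
        by (subst indep_vars_cong[OF refl _ refl]) (use ts inc in auto)
    qed
  qed
  from gaussian_increments_law_unique[OF gr gi z, of T]
  have law: "distr P (PiM {0..T} (\<lambda>_. Rd d)) (\<lambda>p. \<lambda>s\<in>{0..T}. path_reverse d T p s)
      = distr P (PiM {0..T} (\<lambda>_. Rd d)) (\<lambda>p. \<lambda>s\<in>{0..T}. p s)"
    using T by auto
  \<comment> \<open>Both frozen paths are images under \<open>ext\<close> of their restrictions to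
    \<open>{0..T}\<close>, so the equality of laws passes to the whole half-line.\<close>
  define ext :: "(real \<Rightarrow> nat \<Rightarrow> real) \<Rightarrow> real \<Rightarrow> nat \<Rightarrow> real"
    where "ext = (\<lambda>v. \<lambda>s\<in>{0..}. v (min s T))"
  have em: "ext \<in> measurable (PiM {0..T} (\<lambda>_. Rd d)) (PiM {0..} (\<lambda>_. Rd d))"
    unfolding ext_def by (intro measurable_restrict measurable_component_singleton) (use T in auto)
  have m1: "(\<lambda>p. \<lambda>s\<in>{0..T}. path_reverse d T p s) \<in> measurable P (PiM {0..T} (\<lambda>_. Rd d))"
    by (intro measurable_restrict measurable_compose[OF rm measurable_path_at]) auto
  have m2: "(\<lambda>p. \<lambda>s\<in>{0..T}. p s) \<in> measurable P (PiM {0..T} (\<lambda>_. Rd d))"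
    unfolding measurable_cong_sets[OF sP refl] by (intro measurable_restrict measurable_path_at) auto
  have "ext (\<lambda>s\<in>{0..T}. path_reverse d T p s) = path_reverse d T p" for p
    using T by (intro HOL.ext) (auto simp: ext_def path_reverse_def min_def)
  moreover have "ext (\<lambda>s\<in>{0..T}. p s) = path_stop T p" for p
    using T by (intro HOL.ext) (auto simp: ext_def path_stop_def min_def)
  ultimately have "distr P (PiM {0..} (\<lambda>_. Rd d)) (path_reverse d T) = distr P (PiM {0..} (\<lambda>_. Rd d)) (path_stop T)"
    using arg_cong[OF law, of "\<lambda>M. distr M (PiM {0..} (\<lambda>_. Rd d)) ext"]
    by (simp add: distr_distr[OF em m1] distr_distr[OF em m2] comp_def)
  then show ?thesis by (intro distr_path_space_eqI rm stm)
qed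

text \<open>Joint measurability comes from the continuity of the paths: the value at
  \<open>s\<close> is the limit of the values at the times \<open>r n s\<close>, and for fixed
  \<open>n\<close> these times take countably many values. Paths carry information only on
  \<open>{0..}\<close>, hence \<open>max 0\<close>.\<close>

lemma measurable_path_eval:
  "(\<lambda>q. fst q (max 0 (snd q))) \<in> measurable (path_space d \<Otimes>\<^sub>M borel) (Rd d)"
proof (rule measurable_into_Rd)
  fix i assume i: "i < d"
  define r :: "nat \<Rightarrow> real \<Rightarrow> real" where "r = (\<lambda>n s. real_of_int \<lfloor>real n * max 0 s\<rfloor> / real n)"
  have "(\<lambda>q. fst q (max 0 (real_of_int k / real n)) i) \<in> borel_measurable (path_space d \<Otimes>\<^sub>M (borel::real measure))"
    for k :: int and n
    by (rule measurable_compose[OF measurable_fst])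
      (rule measurable_compose[OF measurable_path_at measurable_Rd_component[OF i]], simp)
  note * = this
  have "(\<lambda>q. (\<lambda>k q. fst q (max 0 (real_of_int k / real n)) i) \<lfloor>real n * max 0 (snd q)\<rfloor> q)
      \<in> borel_measurable (path_space d \<Otimes>\<^sub>M (borel::real measure))" for n
  proof (rule measurable_compose_countable[where f = "\<lambda>k q. fst q (max 0 (real_of_int k / real n)) i", OF *])
    show "(\<lambda>q. \<lfloor>real n * max 0 (snd q)\<rfloor>) \<in> measurable (path_space d \<Otimes>\<^sub>M borel) (count_space UNIV)"
      by measurable
  qed
  moreover have "r n s \<ge> 0" for n s by (auto simp: r_def)
  ultimately have m: "(\<lambda>q. fst q (r n (snd q)) i) \<in> borel_measurable (path_space d \<Otimes>\<^sub>M (borel::real measure))" for n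
    by (simp add: r_def max_def)
  have lim: "(\<lambda>n. r n s) \<longlonglongrightarrow> max 0 s" for s
  proof (rule tendsto_sandwich[of "\<lambda>n. max 0 s - 1 / real n" _ _ "\<lambda>n. max 0 s"])
    have fl: "real n * max 0 s - 1 \<le> real_of_int \<lfloor>real n * max 0 s\<rfloor>"
      "real_of_int \<lfloor>real n * max 0 s\<rfloor> \<le> real n * max 0 s" for n
      by linarith+
    have lo: "max 0 s - 1 / real n \<le> r n s" if "n > 0" for n
    proof -
      have "max 0 s - 1 / real n = (real n * max 0 s - 1) / real n"
        using that by (simp add: diff_divide_distrib)
      also have "\<dots> \<le> r n s" unfolding r_def by (rule divide_right_mono[OF fl(1)]) simp
      finally show ?thesis .
    qed
    show "\<forall>\<^sub>F n in sequentially. max 0 s - 1 / real n \<le> r n s"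
      using eventually_gt_at_top[of 0] by eventually_elim (rule lo)
    have hi: "r n s \<le> max 0 s" if "n > 0" for n
    proof -
      have "r n s \<le> (real n * max 0 s) / real n"
        unfolding r_def by (rule divide_right_mono[OF fl(2)]) simp
      then show ?thesis using that by simp
    qed
    show "\<forall>\<^sub>F n in sequentially. r n s \<le> max 0 s"
      using eventually_gt_at_top[of 0] by eventually_elim (rule hi)
    show "(\<lambda>n. max 0 s - 1 / real n) \<longlonglongrightarrow> max 0 s"
      using tendsto_diff[OF tendsto_const[of "max 0 s"] lim_1_over_n[where 'a = real]] by simp
  qed simp
  show "(\<lambda>q. fst q (max 0 (snd q)) i) \<in> borel_measurable (path_space d \<Otimes>\<^sub>M (borel::real measure))"
  proof (rule borel_measurable_LIMSEQ_real[OF _ m])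
    fix q :: "(real \<Rightarrow> nat \<Rightarrow> real) \<times> real" assume "q \<in> space (path_space d \<Otimes>\<^sub>M borel)"
    then have "continuous_on {0..} (\<lambda>s. fst q s i)" using i by (auto simp: space_pair_measure space_path_space)
    then show "(\<lambda>n. fst q (r n (snd q)) i) \<longlonglongrightarrow> fst q (max 0 (snd q)) i"
      by (rule continuous_on_tendsto_compose[OF _ lim]) (auto simp: r_def)
  qed
qed (auto simp: space_pair_measure space_path_space space_Rd)

section \<open>Symmetry of the Feynman--Kac semigroup\<close>

text \<open>The starting point enters by translating a path of \<open>P\<close>, so the weight is
  jointly measurable in time, starting point and path.\<close>

definition fk_weight ::
  "nat \<Rightarrow> ((nat \<Rightarrow> real) \<Rightarrow> real) \<Rightarrow> real \<Rightarrow> (nat \<Rightarrow> real) \<Rightarrow> (real \<Rightarrow> nat \<Rightarrow> real) \<Rightarrow> real" where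
  "fk_weight d V t x p = exp (- (LINT s:{0..t}|lborel. V (vplus d x (p s))))"

lemma sigma_finite_Rd: "sigma_finite_measure (Rd d)"
  unfolding Rd_def by (intro product_sigma_finite.sigma_finite) (auto simp: product_sigma_finite_def lborel.sigma_finite_measure_axioms)

lemma measurable_path_eval' [measurable (raw)]:
  assumes [measurable]: "f \<in> measurable M (path_space d)" "g \<in> borel_measurable M"
  shows "(\<lambda>w. f w (max 0 (g w))) \<in> measurable M (Rd d)"
  using measurable_compose[of "\<lambda>w. (f w, g w)" M _ _ _, OF _ measurable_path_eval[of d]] by simp

lemma measurable_fk_weight [measurable (raw)]:
  assumes V: "V \<in> borel_measurable (Rd d)"
    and [measurable]: "t \<in> borel_measurable M" "x \<in> measurable M (Rd d)" "p \<in> measurable M (path_space d)"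
  shows "(\<lambda>w. fk_weight d V (t w) (x w) (p w)) \<in> borel_measurable M"
proof -
  note [measurable] = V
  have eq: "(\<lambda>w. LINT s:{0..t w}|lborel. V (vplus d (x w) (p w s)))
      = (\<lambda>w. LINT s|lborel. (if 0 \<le> s \<and> s \<le> t w then V (vplus d (x w) (p w (max 0 s))) else 0))"
    unfolding set_lebesgue_integral_def
    by (intro ext Bochner_Integration.integral_cong) (auto simp: indicator_def)
  have "(\<lambda>w. LINT s:{0..t w}|lborel. V (vplus d (x w) (p w s))) \<in> borel_measurable M"
    unfolding eq by measurable
  then show ?thesis unfolding fk_weight_def by measurable
qed

lemma fk_weight_nonneg [simp]: "fk_weight d V t x p \<ge> 0" "fk_weight d V t x p > 0"
  by (simp_all add: fk_weight_def)

lemma nn_integral_Rd_translate: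
  assumes F: "F \<in> borel_measurable (Rd d)" and v: "v \<in> space (Rd d)"
  shows "(\<integral>\<^sup>+y. F y \<partial>Rd d) = (\<integral>\<^sup>+x. F (vplus d x v) \<partial>Rd d)"
proof -
  have "(\<integral>\<^sup>+y. F y \<partial>Rd d) = (\<integral>\<^sup>+y. F y \<partial>distr (Rd d) (Rd d) (\<lambda>x. vplus d x v))"
    by (simp add: distr_Rd_vplus[OF v])
  also have "\<dots> = (\<integral>\<^sup>+x. F (vplus d x v) \<partial>Rd d)"
    using F v by (intro nn_integral_distr measurable_vplus) auto
  finally show ?thesis .
qed

lemma set_integral_reflect_interval:
  fixes f :: "real \<Rightarrow> real"
  shows "(LINT s:{0..t}|lborel. f (t - s)) = (LINT s:{0..t}|lborel. f s)"
proof -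
  have "(LINT s:{0..t}|lborel. f s) = (LINT s|lborel. indicator {0..t} (t + -1 * s) *\<^sub>R f (t + -1 * s))"
    unfolding set_lebesgue_integral_def
    by (subst lborel_integral_real_affine[of "-1" _ t]) auto
  also have "\<dots> = (LINT s:{0..t}|lborel. f (t - s))"
    unfolding set_lebesgue_integral_def
    by (intro Bochner_Integration.integral_cong) (auto simp: indicator_def)
  finally show ?thesis by simp
qed

lemma fk_weight_path_stop:
  assumes "t \<ge> 0" shows "fk_weight d V t x (path_stop t p) = fk_weight d V t x p"
proof -
  have "(LINT s:{0..t}|lborel. V (vplus d x (path_stop t p s))) = (LINT s:{0..t}|lborel. V (vplus d x (p s)))"
    by (rule set_lebesgue_integral_cong) (auto simp: path_stop_def)
  then show ?thesis by (simp add: fk_weight_def)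
qed

text \<open>Started at the endpoint \<open>x + p t\<close>, the reversed path visits the same points
  in the opposite order, and the integral over \<open>[0,t]\<close> is invariant under replacing
  \<open>s\<close> by \<open>t - s\<close>.\<close>

lemma fk_weight_path_reverse:
  assumes "t \<ge> 0"
  shows "fk_weight d V t (vplus d x (p t)) (path_reverse d t p) = fk_weight d V t x p"
proof -
  have "(LINT s:{0..t}|lborel. V (vplus d (vplus d x (p t)) (path_reverse d t p s)))
      = (LINT s:{0..t}|lborel. V (vplus d x (p (t - s))))"
    by (rule set_lebesgue_integral_cong)
      (auto simp: path_reverse_def vplus_def vminus_def cong: restrict_cong)
  also have "\<dots> = (LINT s:{0..t}|lborel. V (vplus d x (p s)))"
    by (rule set_integral_reflect_interval)
  finally show ?thesis by (simp add: fk_weight_def)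
qed

locale wiener =
  fixes d :: nat and P :: "(real \<Rightarrow> nat \<Rightarrow> real) measure"
  assumes W0: "wiener_measure d (\<lambda>i\<in>{..<d}. 0) P"
begin

sublocale prob_space P using W0 by (rule wiener_measure_prob)

sublocale Rd: sigma_finite_measure "Rd d" by (rule sigma_finite_Rd)

sublocale RP: pair_sigma_finite "Rd d" P ..

sublocale PR: pair_sigma_finite P "Rd d" ..

lemma sets_P [measurable_cong]: "sets P = sets (path_space d)"
  using W0 by (rule wiener_measure_sets)

lemma space_P: "space P = space (path_space d)"
  by (rule sets_eq_imp_space_eq[OF sets_P])

lemma measurable_P_at: "0 \<le> s \<Longrightarrow> (\<lambda>p. p s) \<in> measurable P (Rd d)"
  unfolding measurable_cong_sets[OF sets_P refl] by (rule measurable_path_at)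

text \<open>\<open>g\<close> weighs the starting point and \<open>h\<close> the endpoint, and the
  two exchange roles. For a fixed path, Lebesgue measure is invariant under translation by
  \<open>p t\<close>; this makes the endpoint the new starting point and turns the path into its
  reversal, whose law is that of the path frozen at time \<open>t\<close>.\<close>

lemma feynman_kac_symmetric:
  assumes V [measurable]: "V \<in> borel_measurable (Rd d)" and t: "t > 0"
    and [measurable]: "g \<in> borel_measurable (Rd d)" "h \<in> borel_measurable (Rd d)"
  shows "(\<integral>\<^sup>+x. \<integral>\<^sup>+p. g x * (ennreal (fk_weight d V t x p) * h (vplus d x (p t))) \<partial>P \<partial>Rd d)
       = (\<integral>\<^sup>+y. \<integral>\<^sup>+p. h y * (ennreal (fk_weight d V t y p) * g (vplus d y (p t))) \<partial>P \<partial>Rd d)"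
proof -
  define \<Psi> :: "((nat \<Rightarrow> real) \<Rightarrow> ennreal) \<Rightarrow> ((nat \<Rightarrow> real) \<Rightarrow> ennreal) \<Rightarrow> (real \<Rightarrow> nat \<Rightarrow> real) \<Rightarrow> ennreal"
    where "\<Psi> = (\<lambda>g h p. \<integral>\<^sup>+x. g x * (ennreal (fk_weight d V t x p) * h (vplus d x (p t))) \<partial>Rd d)"
  have pt [measurable]: "(\<lambda>q. snd q t) \<in> measurable (Rd d \<Otimes>\<^sub>M P) (Rd d)"
    "(\<lambda>q. fst q t) \<in> measurable (path_space d \<Otimes>\<^sub>M Rd d) (Rd d)"
    using t by (auto intro: measurable_compose[OF measurable_snd measurable_P_at]
        measurable_compose[OF measurable_fst measurable_path_at])
  have fub: "(\<integral>\<^sup>+x. \<integral>\<^sup>+p. g x * (ennreal (fk_weight d V t x p) * h (vplus d x (p t))) \<partial>P \<partial>Rd d) = (\<integral>\<^sup>+p. \<Psi> g h p \<partial>P)"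
    if [measurable]: "g \<in> borel_measurable (Rd d)" "h \<in> borel_measurable (Rd d)" for g h
    unfolding \<Psi>_def
    by (rule RP.Fubini'[symmetric])
       measurable
  have \<Psi>_meas: "\<Psi> h g \<in> borel_measurable (path_space d)"
    unfolding \<Psi>_def
    by (rule Rd.borel_measurable_nn_integral[where f = "\<lambda>p x. h x * (ennreal (fk_weight d V t x p) * g (vplus d x (p t)))"]) measurable
  \<comment> \<open>The reversed path leads back to \<open>x\<close> only if \<open>p\<close> starts
    at the origin, which holds almost surely.\<close>
  have rev: "\<Psi> h g (path_reverse d t p) = \<Psi> g h p" if p: "p \<in> space P" and p0: "p 0 = (\<lambda>i\<in>{..<d}. 0)" for p
  proof -
    have pm: "path_reverse d t p \<in> space (path_space d)"
      using measurable_space[OF measurable_path_reverse, of t p d] p t by (simp add: space_P)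
    have ptR: "p t \<in> space (Rd d)" "path_reverse d t p t \<in> space (Rd d)"
      using p pm t by (auto simp: space_P space_path_space)
    have [measurable]: "(\<lambda>x. fk_weight d V t x (path_reverse d t p)) \<in> borel_measurable (Rd d)"
      using pm by (intro measurable_fk_weight) auto
    have "\<Psi> h g (path_reverse d t p) = (\<integral>\<^sup>+x. h (vplus d x (p t)) *
        (ennreal (fk_weight d V t (vplus d x (p t)) (path_reverse d t p)) *
          g (vplus d (vplus d x (p t)) (path_reverse d t p t))) \<partial>Rd d)"
      unfolding \<Psi>_def by (rule nn_integral_Rd_translate) (use ptR in measurable)
    also have "\<dots> = \<Psi> g h p"
      unfolding \<Psi>_def
    proof (rule nn_integral_cong)
      fix x assume x: "x \<in> space (Rd d)"
      have "vplus d (vplus d x (p t)) (path_reverse d t p t) = x"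
        using x t p0 by (auto simp: vplus_def path_reverse_def vminus_def space_Rd intro!: extensionalityI[of _ "{..<d}"])
      then show "h (vplus d x (p t)) * (ennreal (fk_weight d V t (vplus d x (p t)) (path_reverse d t p)) *
          g (vplus d (vplus d x (p t)) (path_reverse d t p t)))
        = g x * (ennreal (fk_weight d V t x p) * h (vplus d x (p t)))"
        using t by (simp add: fk_weight_path_reverse mult_ac)
    qed
    finally show ?thesis .
  qed
  \<comment> \<open>\<open>\<Psi>\<close> sees the path only up to time \<open>t\<close>, so
    freezing does not change it.\<close>
  have stop: "\<Psi> h g (path_stop t p) = \<Psi> h g p" for p
    using t by (simp add: \<Psi>_def fk_weight_path_stop) (simp add: path_stop_def)
  have m: "path_reverse d t \<in> measurable P (path_space d)" "path_stop t \<in> measurable P (path_space d)"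
    unfolding measurable_cong_sets[OF sets_P refl] using t by (auto intro: measurable_path_reverse measurable_path_stop)
  have "(\<integral>\<^sup>+p. \<Psi> g h p \<partial>P) = (\<integral>\<^sup>+p. \<Psi> h g (path_reverse d t p) \<partial>P)"
  proof (rule nn_integral_cong_AE)
    show "AE p in P. \<Psi> g h p = \<Psi> h g (path_reverse d t p)"
      using wiener_measure_start[OF W0] AE_space by eventually_elim (simp add: rev)
  qed
  also have "\<dots> = (\<integral>\<^sup>+p. \<Psi> h g p \<partial>distr P (path_space d) (path_reverse d t))"
    by (rule nn_integral_distr[OF m(1), symmetric]) (use \<Psi>_meas in simp)
  also have "\<dots> = (\<integral>\<^sup>+p. \<Psi> h g p \<partial>distr P (path_space d) (path_stop t))"
    by (simp add: wiener_measure_reverse[OF W0 t])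
  also have "\<dots> = (\<integral>\<^sup>+p. \<Psi> h g p \<partial>P)"
    by (subst nn_integral_distr[OF m(2)]) (use \<Psi>_meas stop in simp_all)
  finally show ?thesis
    by (simp add: fub)
qed

text \<open>Replaces the law \<open>W x\<close> by a translate of \<open>P\<close>, so that
  measurability in \<open>x\<close> becomes available.\<close>

lemma feynman_kac_eq:
  fixes f :: "(nat \<Rightarrow> real) \<Rightarrow> complex"
  assumes V [measurable]: "V \<in> borel_measurable (Rd d)" and t: "t \<ge> 0"
    and [measurable]: "f \<in> borel_measurable (Rd d)"
    and x: "x \<in> space (Rd d)" and Wx: "wiener_measure d x (W x)"
  shows "feynman_kac W V t f x = (LINT p|P. fk_weight d V t x p *\<^sub>R f (vplus d x (p t)))"
proof -
  define z :: "nat \<Rightarrow> real" where "z = (\<lambda>i\<in>{..<d}. 0)"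
  have [simp, measurable]: "z \<in> space (Rd d)" by (simp add: z_def space_Rd)
  have zp: "vplus d z y = y" if "y \<in> space (Rd d)" for y
    using that by (auto simp: z_def vplus_def space_Rd intro!: extensionalityI[of _ "{..<d}"])
  have [measurable]: "(\<lambda>p. p t) \<in> measurable (path_space d) (Rd d)" using t by (rule measurable_path_at)
  \<comment> \<open>Measurability of the integrand is read off from \<open>fk_weight\<close> at the
    origin \<open>z\<close>, with which it agrees on path space.\<close>
  have "(\<lambda>p. exp (- (LINT s:{0..t}|lborel. V (p s))) *\<^sub>R f (p t)) \<in> borel_measurable (path_space d)
     \<longleftrightarrow> (\<lambda>p. fk_weight d V t z p *\<^sub>R f (p t)) \<in> borel_measurable (path_space d)"
  proof (rule measurable_cong)
    fix p assume p: "p \<in> space (path_space d)"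
    have "(LINT s:{0..t}|lborel. V (p s)) = (LINT s:{0..t}|lborel. V (vplus d z (p s)))"
      by (rule set_lebesgue_integral_cong) (use p in \<open>auto simp: space_path_space zp\<close>)
    then show "exp (- (LINT s:{0..t}|lborel. V (p s))) *\<^sub>R f (p t) = fk_weight d V t z p *\<^sub>R f (p t)"
      by (simp add: fk_weight_def)
  qed
  then have meas: "(\<lambda>p. exp (- (LINT s:{0..t}|lborel. V (p s))) *\<^sub>R f (p t)) \<in> borel_measurable (path_space d)"
    by simp
  have sm: "path_shift d x \<in> measurable P (path_space d)"
    unfolding measurable_cong_sets[OF sets_P refl] by (rule measurable_path_shift[OF x])
  have "feynman_kac W V t f x = (LINT p|distr P (path_space d) (path_shift d x). exp (- (LINT s:{0..t}|lborel. V (p s))) *\<^sub>R f (p t))"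
    unfolding feynman_kac_def using wiener_measure_shift[OF W0 Wx x] by simp
  also have "\<dots> = (LINT p|P. exp (- (LINT s:{0..t}|lborel. V (path_shift d x p s))) *\<^sub>R f (path_shift d x p t))"
    by (rule integral_distr[OF sm meas])
  also have "\<dots> = (LINT p|P. fk_weight d V t x p *\<^sub>R f (vplus d x (p t)))"
  proof (rule Bochner_Integration.integral_cong[OF refl])
    fix p
    have "(LINT s:{0..t}|lborel. V (path_shift d x p s)) = (LINT s:{0..t}|lborel. V (vplus d x (p s)))"
      by (rule set_lebesgue_integral_cong) (auto simp: path_shift_def)
    then show "exp (- (LINT s:{0..t}|lborel. V (path_shift d x p s))) *\<^sub>R f (path_shift d x p t)
        = fk_weight d V t x p *\<^sub>R f (vplus d x (p t))"
      using t by (simp add: fk_weight_def path_shift_def)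
  qed
  finally show ?thesis .
qed

end

section \<open>Exponentials of primitives\<close>

lemma nn_integral_eq_set_integral:
  fixes f :: "'a \<Rightarrow> real"
  assumes "set_integrable M A f" "\<And>x. 0 \<le> f x"
  shows "(\<integral>\<^sup>+x. ennreal (f x) * indicator A x \<partial>M) = ennreal (LINT x:A|M. f x)"
proof -
  have "(\<integral>\<^sup>+x. ennreal (f x) * indicator A x \<partial>M) = (\<integral>\<^sup>+x. ennreal (indicator A x *\<^sub>R f x) \<partial>M)"
    by (intro nn_integral_cong) (auto simp: indicator_def)
  also have "\<dots> = ennreal (LINT x:A|M. f x)"
    using assms unfolding set_lebesgue_integral_def set_integrable_def
    by (intro nn_integral_eq_integral) auto
  finally show ?thesis .
qed

lemma borel_measurable_primitive [measurable]:
  fixes v :: "real \<Rightarrow> real"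
  assumes [measurable]: "v \<in> borel_measurable borel"
  shows "(\<lambda>t. LINT s:{0..t}|lborel. v s) \<in> borel_measurable borel"
proof -
  have "(\<lambda>t. LINT s:{0..t}|lborel. v s) = (\<lambda>t. LINT s|lborel. (if 0 \<le> s \<and> s \<le> t then v s else 0))"
    unfolding set_lebesgue_integral_def
    by (intro ext Bochner_Integration.integral_cong) (auto simp: indicator_def)
  also have "\<dots> \<in> borel_measurable borel" by measurable
  finally show ?thesis .
qed

context
  fixes v :: "real \<Rightarrow> real"
  assumes v_meas [measurable]: "v \<in> borel_measurable borel" and v_nonneg: "\<And>s. 0 \<le> v s"
    and v_bounded: "\<And>T. \<exists>B. \<forall>s\<in>{0..T}. v s \<le> B"
begin

lemma set_integrable_locally_bounded: "0 \<le> a \<Longrightarrow> set_integrable lborel {a..b} v"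
proof -
  assume a: "0 \<le> a"
  obtain B where "\<forall>s\<in>{0..b}. v s \<le> B" using v_bounded by blast
  then show ?thesis
    unfolding set_integrable_def using a v_nonneg
    by (intro integrableI_bounded_set_indicator[where B = B]) (auto simp: emeasure_lborel_Icc_eq)
qed

lemma nn_integral_locally_bounded:
  "(\<integral>\<^sup>+s. ennreal (v s) * indicator {0..t} s \<partial>lborel) = ennreal (LINT s:{0..t}|lborel. v s)"
  by (rule nn_integral_eq_set_integral) (auto intro: set_integrable_locally_bounded v_nonneg)

lemma nn_integral_locally_bounded_Ioc:
  assumes "0 \<le> s" "s \<le> t"
  shows "(\<integral>\<^sup>+u. ennreal (v u) * indicator {s<..t} u \<partial>lborel)
    = ennreal ((LINT u:{0..t}|lborel. v u) - (LINT u:{0..s}|lborel. v u))"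
proof -
  have "ennreal (LINT u:{0..t}|lborel. v u)
      = (\<integral>\<^sup>+u. ennreal (v u) * indicator {0..s} u + ennreal (v u) * indicator {s<..t} u \<partial>lborel)"
    unfolding nn_integral_locally_bounded[symmetric] using assms
    by (intro nn_integral_cong) (auto simp: indicator_def)
  also have "\<dots> = ennreal (LINT u:{0..s}|lborel. v u) + (\<integral>\<^sup>+u. ennreal (v u) * indicator {s<..t} u \<partial>lborel)"
    by (subst nn_integral_add) (auto simp: nn_integral_locally_bounded)
  finally have "ennreal (LINT u:{0..t}|lborel. v u) = \<dots>" .
  moreover have "0 \<le> (LINT u:{0..s}|lborel. v u)"
    unfolding set_lebesgue_integral_def using v_nonneg by (intro integral_nonneg_AE) auto
  ultimately show ?thesis
    by (metis ennreal_add_diff_cancel_left ennreal_minus ennreal_neq_top)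
qed

lemma integral_mono_upper:
  assumes "0 \<le> s" "s \<le> t"
  shows "(LINT u:{0..s}|lborel. v u) \<le> (LINT u:{0..t}|lborel. v u)"
  unfolding set_lebesgue_integral_def
  using set_integrable_locally_bounded[of 0 s] set_integrable_locally_bounded[of 0 t] assms v_nonneg
  by (intro integral_mono) (auto simp: set_integrable_def indicator_def)

text \<open>
  The exact value is \<open>1 - exp (- \<integral> v)\<close>. As \<open>v\<close> is merely measurable, the bound is read
  off partitions of mesh \<open>T / n\<close>, on which it holds up to the factor \<open>exp (B T / n)\<close>.
\<close>

lemma nn_integral_exp_primitive_le_1_Ioc:
  assumes T: "T > 0"
  shows "(\<integral>\<^sup>+t. ennreal (exp (- (LINT s:{0..t}|lborel. v s)) * v t) * indicator {0<..T} t \<partial>lborel) \<le> 1"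
proof -
  define A where "A = (\<lambda>t. LINT s:{0..t}|lborel. v s)"
  define J where "J = (\<lambda>r. \<integral>\<^sup>+t. ennreal (exp (- A t) * v t) * indicator {0<..r} t \<partial>lborel)"
  obtain B where B: "\<forall>s\<in>{0..T}. v s \<le> B" using v_bounded by blast
  have "v 0 \<le> B" using B T by auto
  then have B0: "B \<ge> 0" using v_nonneg[of 0] by linarith
  have A_mono: "A s \<le> A t" if "0 \<le> s" "s \<le> t" for s t
    unfolding A_def using that by (rule integral_mono_upper)
  have A0: "A 0 \<ge> 0" by (simp add: A_def set_lebesgue_integral_def) (use v_nonneg in \<open>auto intro!: integral_nonneg_AE\<close>)
  have [measurable]: "A \<in> borel_measurable borel"
  unfolding A_def by measurable
  have step: "J t \<le> J s + ennreal (exp (B * (t - s)) * (exp (- A s) - exp (- A t)))"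
    if st: "0 \<le> s" "s \<le> t" "t \<le> T" for s t
  proof -
    have inc: "A t - A s \<le> B * (t - s)"
    proof -
      have "ennreal (A t - A s) = (\<integral>\<^sup>+u. ennreal (v u) * indicator {s<..t} u \<partial>lborel)"
        unfolding A_def using st by (simp add: nn_integral_locally_bounded_Ioc)
      also have "\<dots> \<le> (\<integral>\<^sup>+u. ennreal B * indicator {s<..t} u \<partial>lborel)"
        using B st by (intro nn_integral_mono) (auto simp: indicator_def intro!: ennreal_leI)
      also have "\<dots> = ennreal (B * (t - s))"
        using st B0 by (simp add: nn_integral_cmult ennreal_mult)
      finally show ?thesis using st B0 by (simp add: ennreal_le_iff)
    qed
    \<comment> \<open>\<open>x \<le> exp x - 1\<close> turns the increment of \<open>A\<close> into
      a difference of exponentials, up to the factor \<open>exp (A t - A s)\<close>, which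
      \<open>inc\<close> controls.\<close>
    have "exp (- A s) * (A t - A s) \<le> exp (- A s) * (exp (A t - A s) - 1)"
      by (intro mult_left_mono) (use exp_ge_add_one_self[of "A t - A s"] in linarith, simp)
    also have "\<dots> = exp (A t - A s) * (exp (- A s) - exp (- A t))"
      by (simp add: algebra_simps exp_diff exp_minus field_simps)
    also have "\<dots> \<le> exp (B * (t - s)) * (exp (- A s) - exp (- A t))"
      using inc A_mono[of s t] st by (intro mult_right_mono) auto
    finally have le: "exp (- A s) * (A t - A s) \<le> exp (B * (t - s)) * (exp (- A s) - exp (- A t))" .
    have "J t = (\<integral>\<^sup>+u. ennreal (exp (- A u) * v u) * indicator {0<..s} u
        + ennreal (exp (- A u) * v u) * indicator {s<..t} u \<partial>lborel)"
      unfolding J_def using st by (intro nn_integral_cong) (auto simp: indicator_def)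
    also have "\<dots> = J s + (\<integral>\<^sup>+u. ennreal (exp (- A u) * v u) * indicator {s<..t} u \<partial>lborel)"
      unfolding J_def by (rule nn_integral_add) measurable
    also have "(\<integral>\<^sup>+u. ennreal (exp (- A u) * v u) * indicator {s<..t} u \<partial>lborel)
        \<le> (\<integral>\<^sup>+u. ennreal (exp (- A s)) * (ennreal (v u) * indicator {s<..t} u) \<partial>lborel)"
      using st v_nonneg A_mono
      by (intro nn_integral_mono) (auto simp: indicator_def ennreal_mult[symmetric] intro!: ennreal_leI mult_right_mono)
    also have "\<dots> = ennreal (exp (- A s)) * ennreal (A t - A s)"
      unfolding A_def using st by (simp add: nn_integral_cmult nn_integral_locally_bounded_Ioc)
    also have "\<dots> = ennreal (exp (- A s) * (A t - A s))"
      by (simp add: ennreal_mult')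
    also have "\<dots> \<le> ennreal (exp (B * (t - s)) * (exp (- A s) - exp (- A t)))"
      using le by (rule ennreal_leI)
    finally show ?thesis by (simp add: add_left_mono)
  qed
  have bound: "J T \<le> ennreal (exp (B * T / real (Suc n)))" for n
  proof -
    define h where "h = T / real (Suc n)"
    have h: "h > 0" using T by (simp add: h_def)
    \<comment> \<open>With the common factor \<open>exp (B * h)\<close> the differences of
      exponentials telescope, starting from \<open>J 0 = 0\<close>.\<close>
    have "J (real k * h) \<le> ennreal (exp (B * h) * (1 - exp (- A (real k * h))))" if "k \<le> Suc n" for k
      using that
    proof (induction k)
      case 0
      show ?case by (simp add: J_def)
    next
      case (Suc k)
      have "real (Suc k) * h \<le> real (Suc n) * h" using Suc.prems h by (intro mult_right_mono) auto
      also have "real (Suc n) * h = T" by (simp add: h_def)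
      finally have kT: "real (Suc k) * h \<le> T" .
      have "J (real (Suc k) * h) \<le> J (real k * h)
          + ennreal (exp (B * (real (Suc k) * h - real k * h)) * (exp (- A (real k * h)) - exp (- A (real (Suc k) * h))))"
        using h kT by (intro step) (auto simp: algebra_simps)
      also have "\<dots> \<le> ennreal (exp (B * h) * (1 - exp (- A (real k * h))))
          + ennreal (exp (B * h) * (exp (- A (real k * h)) - exp (- A (real (Suc k) * h))))"
        using Suc by (intro add_mono) (auto simp: algebra_simps)
      also have "\<dots> = ennreal (exp (B * h) * (1 - exp (- A (real (Suc k) * h))))"
        using A_mono[of 0 "real k * h"] A_mono[of "real k * h" "real (Suc k) * h"] A0 h
        by (subst ennreal_plus[symmetric]) (auto simp: algebra_simps)
      finally show ?case .
    qed
    from this[of "Suc n"] have "J T \<le> ennreal (exp (B * h) * (1 - exp (- A T)))"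
      using T by (simp add: h_def)
    also have "\<dots> \<le> ennreal (exp (B * h))" by (intro ennreal_leI) auto
    finally show ?thesis by (simp add: h_def)
  qed
  have "(\<lambda>n. ennreal (exp (B * T / real (Suc n)))) \<longlonglongrightarrow> ennreal (exp 0)"
    by (intro tendsto_ennrealI tendsto_exp LIMSEQ_Suc[OF lim_const_over_n])
  then have "J T \<le> ennreal (exp 0)"
    by (rule LIMSEQ_le_const) (use bound in auto)
  then show ?thesis by (simp add: J_def A_def)
qed

text \<open>The integrand is the density of the lifetime of a particle killed at rate
  \<open>v\<close>, so its total mass is at most 1. The bound on bounded intervals extends by
  monotone convergence.\<close>

lemma nn_integral_exp_primitive_le_1:
  "(\<integral>\<^sup>+t. ennreal (exp (- (LINT s:{0..t}|lborel. v s)) * v t) * indicator {0<..} t \<partial>lborel) \<le> 1"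
proof -
  define F where "F = (\<lambda>t. ennreal (exp (- (LINT s:{0..t}|lborel. v s)) * v t))"
  have [measurable]: "F \<in> borel_measurable borel" unfolding F_def by measurable
  have "(\<integral>\<^sup>+t. F t * indicator {0<..} t \<partial>lborel) = (\<integral>\<^sup>+t. (SUP n. F t * indicator {0<..real (Suc n)} t) \<partial>lborel)"
  proof (intro nn_integral_cong antisym)
    fix t
    obtain n where n: "t \<le> real n" using real_arch_simple by blast
    have "F t * indicator {0<..} t \<le> F t * indicator {0<..real (Suc n)} t"
      using n by (auto simp: indicator_def)
    also have "\<dots> \<le> (SUP n. F t * indicator {0<..real (Suc n)} t)" by (rule SUP_upper) simp
    finally show "F t * indicator {0<..} t \<le> (SUP n. F t * indicator {0<..real (Suc n)} t)" .
    show "(SUP n. F t * indicator {0<..real (Suc n)} t) \<le> F t * indicator {0<..} t"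
      by (intro SUP_least) (auto simp: indicator_def)
  qed
  also have "\<dots> = (SUP n. \<integral>\<^sup>+t. F t * indicator {0<..real (Suc n)} t \<partial>lborel)"
    by (intro nn_integral_monotone_convergence_SUP)
      (auto simp: incseq_def le_fun_def indicator_def)
  also have "\<dots> \<le> 1"
    unfolding F_def by (intro SUP_least nn_integral_exp_primitive_le_1_Ioc) simp
  finally show ?thesis by (simp add: F_def)
qed

text \<open>Jensen's inequality for the uniform distribution on the second half of \<open>[0, t]\<close>.\<close>

lemma exp_primitive_le_average:
  assumes t: "t > 0"
  shows "ennreal (exp (- (LINT s:{0..t}|lborel. v s)))
    \<le> (\<integral>\<^sup>+s. ennreal (2 / t * exp (- (t / 2 * v s))) * indicator {t/2..t} s \<partial>lborel)"
proof -
  define I where "I = (LINT s:{t/2..t}|lborel. v s)"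
  have int: "set_integrable lborel {t/2..t} v" using t by (intro set_integrable_locally_bounded) simp
  have bnd: "set_integrable lborel {t/2..t} (\<lambda>s. 2 / t * exp (- (t / 2 * v s)))"
    unfolding set_integrable_def using v_nonneg t
    by (intro integrableI_bounded_set_indicator[where B = "2/t"]) (auto simp: emeasure_lborel_Icc_eq field_simps)
  have const: "set_integrable lborel {t/2..t} (\<lambda>s. c)" for c :: real
    unfolding set_integrable_def
    by (intro integrableI_bounded_set_indicator[where B = "\<bar>c\<bar>"]) (auto simp: emeasure_lborel_Icc_eq)
  \<comment> \<open>The first half is discarded because the Gaussian spread, needed later as a lower
    bound, degenerates near time 0.\<close>
  have "I \<le> (LINT s:{0..t}|lborel. v s)"
    unfolding I_def set_lebesgue_integral_def
    using int set_integrable_locally_bounded[of 0 t] t v_nonneg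
    by (intro integral_mono) (auto simp: set_integrable_def indicator_def)
  then have "exp (- (LINT s:{0..t}|lborel. v s)) \<le> exp (- I)" by simp
  \<comment> \<open>The integrand is \<open>2 / t\<close> times the tangent of \<open>exp\<close> at
    \<open>- I\<close>, evaluated at \<open>- (t / 2 * v s)\<close>. As \<open>I\<close> is the mean
    of \<open>t / 2 * v\<close> over the interval, the linear term cancels and
    \<open>exp (- I)\<close> remains.\<close>
  also have "\<dots> = (LINT s:{t/2..t}|lborel. 2 / t * exp (- I) * (1 + I) - exp (- I) * v s)"
  proof -
    have "(LINT s:{t/2..t}|lborel. 2 / t * exp (- I) * (1 + I) - exp (- I) * v s)
        = (LINT s:{t/2..t}|lborel. 2 / t * exp (- I) * (1 + I)) - exp (- I) * I"
      unfolding I_def using int const by (subst set_integral_diff) auto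
    also have "(LINT s:{t/2..t}|lborel. 2 / t * exp (- I) * (1 + I)) = exp (- I) * (1 + I)"
      using t by (simp add: set_lebesgue_integral_def)
    finally show ?thesis by (simp add: algebra_simps)
  qed
  also have "\<dots> \<le> (LINT s:{t/2..t}|lborel. 2 / t * exp (- (t / 2 * v s)))"
  proof (rule set_integral_mono[OF _ bnd])
    show "set_integrable lborel {t/2..t} (\<lambda>s. 2 / t * exp (- I) * (1 + I) - exp (- I) * v s)"
      using int const by (intro set_integral_diff) auto
    fix s
    have "exp (- I) * (1 + (I - t / 2 * v s)) \<le> exp (- I) * exp (I - t / 2 * v s)"
      by (intro mult_left_mono exp_ge_add_one_self) auto
    also have "\<dots> = exp (- (t / 2 * v s))" by (simp add: exp_add[symmetric])
    finally have "2 / t * (exp (- I) * (1 + (I - t / 2 * v s))) \<le> 2 / t * exp (- (t / 2 * v s))"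
      using t by (intro mult_left_mono) auto
    then show "2 / t * exp (- I) * (1 + I) - exp (- I) * v s \<le> 2 / t * exp (- (t / 2 * v s))"
      using t by (simp add: field_simps)
  qed
  finally have "exp (- (LINT s:{0..t}|lborel. v s)) \<le> (LINT s:{t/2..t}|lborel. 2 / t * exp (- (t / 2 * v s)))" .
  then have "ennreal (exp (- (LINT s:{0..t}|lborel. v s))) \<le> ennreal (LINT s:{t/2..t}|lborel. 2 / t * exp (- (t / 2 * v s)))"
    by (rule ennreal_leI)
  also have "\<dots> = (\<integral>\<^sup>+s. ennreal (2 / t * exp (- (t / 2 * v s))) * indicator {t/2..t} s \<partial>lborel)"
    by (rule nn_integral_eq_set_integral[symmetric, OF bnd]) (use t in auto)
  finally show ?thesis .
qed

end

section \<open>Gaussian integrals of powers\<close>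

abbreviation normal_measure :: "real \<Rightarrow> real measure" where
  "normal_measure s \<equiv> density lborel (normal_density 0 s)"

lemma nn_integral_normal_scale:
  assumes s: "s > 0" and F: "F \<in> borel_measurable borel"
  shows "(\<integral>\<^sup>+b. F b \<partial>normal_measure s) = (\<integral>\<^sup>+z. F (s * z) \<partial>normal_measure 1)"
proof -
  interpret prob_space "normal_measure 1" by (rule prob_space_normal_density) simp
  have "distributed (normal_measure 1) lborel (\<lambda>x. x) (normal_density 0 1)"
    unfolding distributed_def by (auto intro!: measure_eqI simp: emeasure_distr cong: distr_cong)
  from normal_density_affine[OF this, of s 0] s
  have "distributed (normal_measure 1) lborel (\<lambda>x. s * x) (normal_density 0 s)" by simp
  then have "distr (normal_measure 1) lborel (\<lambda>x. s * x) = normal_measure s"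
    by (rule distributed_distr_eq_density)
  then have "(\<integral>\<^sup>+b. F b \<partial>normal_measure s) = (\<integral>\<^sup>+b. F b \<partial>distr (normal_measure 1) lborel (\<lambda>x. s * x))"
    by simp
  also have "\<dots> = (\<integral>\<^sup>+z. F (s * z) \<partial>normal_measure 1)"
    using F by (subst nn_integral_distr) auto
  finally show ?thesis .
qed

text \<open>The 4 is \<open>2 powr 2\<close>, the largest value of \<open>2 powr \<alpha>\<close>,
  so the constant is independent of \<open>\<alpha>\<close>.\<close>

lemma powr_abs_add_le:
  fixes a b :: real
  assumes "0 < \<alpha>" "\<alpha> \<le> 2"
  shows "\<bar>a + b\<bar> powr \<alpha> \<le> 4 * (\<bar>a\<bar> powr \<alpha> + \<bar>b\<bar> powr \<alpha>)"
proof -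
  have "\<bar>a + b\<bar> powr \<alpha> \<le> (2 * max \<bar>a\<bar> \<bar>b\<bar>) powr \<alpha>"
    using assms by (intro powr_mono2) auto
  also have "\<dots> = 2 powr \<alpha> * max \<bar>a\<bar> \<bar>b\<bar> powr \<alpha>" by (simp add: powr_mult)
  also have "\<dots> \<le> 2 powr 2 * max \<bar>a\<bar> \<bar>b\<bar> powr \<alpha>"
    using assms by (intro mult_right_mono powr_mono) auto
  also have "max \<bar>a\<bar> \<bar>b\<bar> powr \<alpha> \<le> \<bar>a\<bar> powr \<alpha> + \<bar>b\<bar> powr \<alpha>"
    by (auto simp: max_def)
  finally show ?thesis by simp
qed

lemma powr_abs_le_square:
  fixes z :: real
  assumes "0 < \<alpha>" "\<alpha> \<le> 2"
  shows "\<bar>z\<bar> powr \<alpha> \<le> 1 + z\<^sup>2"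
proof (cases "\<bar>z\<bar> \<le> 1")
  case True
  then have "\<bar>z\<bar> powr \<alpha> \<le> 1 powr \<alpha>" using assms by (intro powr_mono2) auto
  then show ?thesis by (simp add: add_increasing2)
next
  case False
  then have "\<bar>z\<bar> powr \<alpha> \<le> \<bar>z\<bar> powr 2" using assms by (intro powr_mono) auto
  also have "\<dots> = z\<^sup>2" using False by (subst powr_numeral) auto
  finally show ?thesis by simp
qed

text \<open>Multiplying the standard density by \<open>exp (\<kappa> * z\<^sup>2)\<close> gives
  \<open>\<sigma>\<close> times the centred normal density of standard deviation
  \<open>\<sigma> = 1 / sqrt (1 - 2 * \<kappa>)\<close>. For \<open>\<kappa> \<le> 1/4\<close> one
  has \<open>1 \<le> (1 + 4 * \<kappa>) * (1 - 2 * \<kappa>)\<close>, whence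
  \<open>\<sigma> \<le> exp (2 * \<kappa>)\<close>.\<close>

lemma nn_integral_normal_exp_square:
  assumes "0 \<le> \<kappa>" "\<kappa> \<le> 1/4"
  shows "(\<integral>\<^sup>+z. ennreal (exp (\<kappa> * z\<^sup>2)) \<partial>normal_measure 1) \<le> ennreal (exp (2 * \<kappa>))"
proof -
  define \<sigma> where "\<sigma> = 1 / sqrt (1 - 2 * \<kappa>)"
  have pos: "1 - 2 * \<kappa> > 0" using assms by simp
  have \<sigma>: "\<sigma> > 0" "\<sigma>\<^sup>2 = 1 / (1 - 2 * \<kappa>)" using pos by (auto simp: \<sigma>_def power_divide)
  have "\<sigma>\<^sup>2 \<le> (exp (2 * \<kappa>))\<^sup>2"
  proof -
    have "1 \<le> (1 + 4 * \<kappa>) * (1 - 2 * \<kappa>)"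
    proof -
      have "0 \<le> 2 * \<kappa> * (1 - 4 * \<kappa>)" using assms by (intro mult_nonneg_nonneg) auto
      then show ?thesis by (simp add: algebra_simps)
    qed
    also have "\<dots> \<le> exp (4 * \<kappa>) * (1 - 2 * \<kappa>)"
      using pos exp_ge_add_one_self[of "4 * \<kappa>"] by (intro mult_right_mono) auto
    also have "exp (4 * \<kappa>) = (exp (2 * \<kappa>))\<^sup>2" by (simp add: power2_eq_square flip: exp_add)
    finally show ?thesis using pos by (simp add: \<sigma> field_simps)
  qed
  then have \<sigma>_le: "\<sigma> \<le> exp (2 * \<kappa>)" by (rule power2_le_imp_le) simp
  have eq: "std_normal_density z * exp (\<kappa> * z\<^sup>2) = \<sigma> * normal_density 0 \<sigma> z" for z
  proof -
    have "sqrt (2 * pi * \<sigma>\<^sup>2) = sqrt (2 * pi) * \<sigma>" using \<sigma>(1) by (simp only: real_sqrt_mult real_sqrt_abs abs_of_pos)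
    moreover have "- (z\<^sup>2) / (2 * \<sigma>\<^sup>2) = - z\<^sup>2 / 2 + \<kappa> * z\<^sup>2"
      using pos by (simp add: \<sigma> field_simps)
    ultimately show ?thesis
      using \<sigma> by (simp add: normal_density_def flip: exp_add)
  qed
  have "(\<integral>\<^sup>+z. ennreal (exp (\<kappa> * z\<^sup>2)) \<partial>normal_measure 1)
      = (\<integral>\<^sup>+z. ennreal (std_normal_density z) * ennreal (exp (\<kappa> * z\<^sup>2)) \<partial>lborel)"
    by (subst nn_integral_density) auto
  also have "\<dots> = (\<integral>\<^sup>+z. ennreal \<sigma> * ennreal (normal_density 0 \<sigma> z) \<partial>lborel)"
    using \<sigma> by (intro nn_integral_cong) (auto simp: ennreal_mult[symmetric] eq)
  also have "\<dots> = ennreal \<sigma> * (\<integral>\<^sup>+z. ennreal (normal_density 0 \<sigma> z) \<partial>lborel)"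
    by (rule nn_integral_cmult) auto
  also have "(\<integral>\<^sup>+z. ennreal (normal_density 0 \<sigma> z) \<partial>lborel) = 1"
    using \<sigma> by (subst nn_integral_eq_integral) auto
  finally show ?thesis using \<sigma>_le by (simp add: ennreal_leI)
qed

lemma nn_integral_normal_square: "(\<integral>\<^sup>+z. ennreal (1 + z\<^sup>2) \<partial>normal_measure 1) = 2"
proof -
  have b: "has_bochner_integral lborel (\<lambda>z. std_normal_density z * z ^ 2) 1"
    using std_normal_moment_even[of 1] by (simp add: fact_numeral)
  have a: "has_bochner_integral lborel std_normal_density 1"
    using std_normal_moment_even[of 0] by simp
  have ab: "has_bochner_integral lborel (\<lambda>z. std_normal_density z * (1 + z ^ 2)) 2"
    using has_bochner_integral_add[OF a b] by (simp add: algebra_simps)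
  have "(\<integral>\<^sup>+z. ennreal (1 + z\<^sup>2) \<partial>normal_measure 1) = (\<integral>\<^sup>+z. ennreal (std_normal_density z * (1 + z\<^sup>2)) \<partial>lborel)"
    by (subst nn_integral_density) (auto simp: ennreal_mult)
  also have "\<dots> = ennreal 2"
    using ab by (subst nn_integral_eq_integral) (auto simp: has_bochner_integral_iff)
  finally show ?thesis by simp
qed

text \<open>If \<open>z\<close> lies on the same side of 0 as \<open>w\<close>, at a distance
  between 1 and 2 from 0, then \<open>\<bar>w + z\<bar> \<ge> 1\<close>, however large
  \<open>w\<close> is. These \<open>z\<close> form an interval of length 1 on which the density is
  at least its value at 2.\<close>

lemma emeasure_normal_outside_unit:
  "ennreal (std_normal_density 2) \<le> emeasure (normal_measure 1) {z. 1 \<le> \<bar>w + z\<bar>}"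
proof -
  define I where "I = (if w \<ge> 0 then {1..2} else {-2..-1::real})"
  have le: "std_normal_density 2 \<le> std_normal_density z" if "z \<in> I" for z
  proof -
    have "\<bar>z\<bar> \<le> 2" using that by (auto simp: I_def split: if_splits)
    then have "z\<^sup>2 \<le> 2\<^sup>2" by (metis abs_ge_zero power2_abs power_mono)
    then show ?thesis unfolding std_normal_density_def by (intro mult_left_mono) auto
  qed
  have "ennreal (std_normal_density 2) = (\<integral>\<^sup>+z. ennreal (std_normal_density 2) * indicator I z \<partial>lborel)"
    by (auto simp: nn_integral_cmult I_def)
  also have "\<dots> \<le> (\<integral>\<^sup>+z. ennreal (std_normal_density z) * indicator I z \<partial>lborel)"
    using le by (intro nn_integral_mono) (auto simp: indicator_def intro!: ennreal_leI)
  also have "\<dots> = emeasure (normal_measure 1) I"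
    by (subst emeasure_density) (auto simp: I_def)
  also have "\<dots> \<le> emeasure (normal_measure 1) {z. 1 \<le> \<bar>w + z\<bar>}"
    by (intro emeasure_mono) (auto simp: I_def split: if_splits)
  finally show ?thesis .
qed

definition gauss_rate :: real where "gauss_rate = std_normal_density 2 / 34"

lemma gauss_rate_pos: "gauss_rate > 0"
  by (simp add: gauss_rate_def normal_density_pos)

lemma gauss_rate_le: "gauss_rate \<le> 1 / 34"
proof -
  have "sqrt (2 * pi) \<ge> 1" using pi_gt3 by simp
  then have "1 / sqrt (2 * pi) \<le> 1" by simp
  moreover have "exp (- 2 :: real) \<le> 1" by simp
  ultimately have "1 / sqrt (2 * pi) * exp (-2) \<le> 1 * 1" by (intro mult_mono) auto
  then have "std_normal_density 2 \<le> 1" by (simp add: std_normal_density_def)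
  then show ?thesis by (simp add: gauss_rate_def)
qed

text \<open>
  The factor \<open>34\<close> in \<open>gauss_rate\<close> is \<open>2 (1 + 16)\<close>.
  For \<open>\<bar>w\<bar> powr \<alpha> \<le> 16\<close> the mass of \<open>1 \<le> \<bar>w + z\<bar>\<close> gives the decay, and otherwise
  \<open>\<bar>w\<bar> powr \<alpha> / 4 - \<bar>z\<bar> powr \<alpha> \<le> \<bar>w + z\<bar> powr \<alpha>\<close>.
\<close>

lemma nn_integral_normal_exp_powr:
  assumes \<alpha>: "0 < \<alpha>" "\<alpha> \<le> 2" and \<kappa>: "0 \<le> \<kappa>" "\<kappa> \<le> 1/4"
  shows "(\<integral>\<^sup>+z. ennreal (exp (- (\<kappa> * \<bar>w + z\<bar> powr \<alpha>))) \<partial>normal_measure 1)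
    \<le> ennreal (exp (- (gauss_rate * \<kappa> * (1 + \<bar>w\<bar> powr \<alpha>))))"
proof (cases "\<bar>w\<bar> powr \<alpha> \<le> 16")
  case True
  define p where "p = std_normal_density 2"
  have p: "p > 0" by (simp add: p_def normal_density_pos)
  define E where "E = {z::real. 1 \<le> \<bar>w + z\<bar>}"
  have [measurable]: "E \<in> sets borel" unfolding E_def by measurable
  interpret prob_space "normal_measure 1" by (rule prob_space_normal_density) simp
  \<comment> \<open>A linear bound, valid for \<open>\<kappa> \<le> 1\<close>, so that the gain on
    \<open>E\<close> is proportional to \<open>\<kappa>\<close>.\<close>
  have "exp (- \<kappa>) \<le> 1 - \<kappa> / 2"
  proof -
    have "0 \<le> \<kappa> * (1 - \<kappa>)" using \<kappa> by (intro mult_nonneg_nonneg) auto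
    then have "1 \<le> (1 - \<kappa> / 2) * (1 + \<kappa>)" by (simp add: algebra_simps)
    also have "\<dots> \<le> (1 - \<kappa> / 2) * exp \<kappa>"
      using \<kappa> by (intro mult_left_mono exp_ge_add_one_self) auto
    finally show ?thesis by (simp add: exp_minus field_simps)
  qed
  then have pw: "exp (- (\<kappa> * \<bar>w + z\<bar> powr \<alpha>)) \<le> (if z \<in> E then 1 - \<kappa> / 2 else 1)" for z
  proof (cases "z \<in> E")
    case True
    then have "1 powr \<alpha> \<le> \<bar>w + z\<bar> powr \<alpha>" using \<alpha> by (intro powr_mono2) (auto simp: E_def)
    then have "\<kappa> * 1 \<le> \<kappa> * \<bar>w + z\<bar> powr \<alpha>" using \<kappa> by (intro mult_left_mono) auto
    then have "exp (- (\<kappa> * \<bar>w + z\<bar> powr \<alpha>)) \<le> exp (- \<kappa>)" by simp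
    also note \<open>exp (- \<kappa>) \<le> 1 - \<kappa> / 2\<close>
    finally show ?thesis using True by simp
  qed (use \<kappa> in simp)
  have "(\<integral>\<^sup>+z. ennreal (exp (- (\<kappa> * \<bar>w + z\<bar> powr \<alpha>))) \<partial>normal_measure 1)
      \<le> (\<integral>\<^sup>+z. ennreal (1 - \<kappa> / 2 * indicator E z) \<partial>normal_measure 1)"
  proof (intro nn_integral_mono ennreal_leI)
    fix z
    have "1 - \<kappa> / 2 * indicator E z = (if z \<in> E then 1 - \<kappa> / 2 else 1)" by simp
    then show "exp (- (\<kappa> * \<bar>w + z\<bar> powr \<alpha>)) \<le> 1 - \<kappa> / 2 * indicator E z" using pw by metis
  qed
  also have "\<dots> = ennreal (LINT z|normal_measure 1. 1 - \<kappa> / 2 * indicator E z)"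
    using \<kappa> by (intro nn_integral_eq_integral integrable_const_bound[where B = 1]) (auto simp: indicator_def)
  also have "(LINT z|normal_measure 1. 1 - \<kappa> / 2 * indicator E z) = 1 - \<kappa> / 2 * prob E"
    by (subst Bochner_Integration.integral_diff)
      (auto simp: emeasure_eq_measure prob_space[simplified])
  also have "\<dots> \<le> 1 - \<kappa> / 2 * p"
  proof -
    have "ennreal p \<le> ennreal (prob E)"
      using emeasure_normal_outside_unit[of w] by (simp add: E_def p_def emeasure_eq_measure)
    then have "p \<le> prob E" by (simp add: ennreal_le_iff)
    then show ?thesis using \<kappa> by (simp add: mult_left_mono)
  qed
  also have "\<dots> \<le> exp (- (\<kappa> / 2 * p))" using exp_ge_add_one_self[of "- (\<kappa> / 2 * p)"] by simp
  also have "\<dots> \<le> exp (- (gauss_rate * \<kappa> * (1 + \<bar>w\<bar> powr \<alpha>)))"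
  proof -
    have "gauss_rate * \<kappa> * (1 + \<bar>w\<bar> powr \<alpha>) \<le> gauss_rate * \<kappa> * 17"
      using True \<kappa> gauss_rate_pos by (intro mult_left_mono) auto
    then show ?thesis by (simp add: gauss_rate_def p_def)
  qed
  finally show ?thesis by (simp add: ennreal_leI)
next
  case False
  define u where "u = \<bar>w\<bar> powr \<alpha>"
  have u: "u > 16" using False by (simp add: u_def)
  have pw: "exp (- (\<kappa> * \<bar>w + z\<bar> powr \<alpha>)) \<le> exp (\<kappa> - \<kappa> * u / 4) * exp (\<kappa> * z\<^sup>2)" for z
  proof -
    have "u \<le> 4 * (\<bar>w + z\<bar> powr \<alpha> + \<bar>- z\<bar> powr \<alpha>)"
      using powr_abs_add_le[OF \<alpha>, of "w + z" "- z"] by (simp add: u_def)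
    then have "u / 4 \<le> \<bar>w + z\<bar> powr \<alpha> + (1 + z\<^sup>2)"
      using powr_abs_le_square[OF \<alpha>, of z] by simp
    then have "\<kappa> * (u / 4) \<le> \<kappa> * (\<bar>w + z\<bar> powr \<alpha> + (1 + z\<^sup>2))" using \<kappa> by (intro mult_left_mono) auto
    then show ?thesis by (simp add: algebra_simps flip: exp_add)
  qed
  have "(\<integral>\<^sup>+z. ennreal (exp (- (\<kappa> * \<bar>w + z\<bar> powr \<alpha>))) \<partial>normal_measure 1)
      \<le> (\<integral>\<^sup>+z. ennreal (exp (\<kappa> - \<kappa> * u / 4)) * ennreal (exp (\<kappa> * z\<^sup>2)) \<partial>normal_measure 1)"
    using pw by (intro nn_integral_mono) (auto simp: ennreal_mult[symmetric] intro!: ennreal_leI)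
  also have "\<dots> = ennreal (exp (\<kappa> - \<kappa> * u / 4)) * (\<integral>\<^sup>+z. ennreal (exp (\<kappa> * z\<^sup>2)) \<partial>normal_measure 1)"
    by (rule nn_integral_cmult) auto
  also have "\<dots> \<le> ennreal (exp (\<kappa> - \<kappa> * u / 4)) * ennreal (exp (2 * \<kappa>))"
    using \<kappa> by (intro mult_left_mono nn_integral_normal_exp_square) auto
  also have "\<dots> = ennreal (exp (3 * \<kappa> - \<kappa> * u / 4))"
    by (simp add: ennreal_mult[symmetric] flip: exp_add)
  \<comment> \<open>In \<open>3 * \<kappa>\<close>, one \<open>\<kappa>\<close> comes from
    \<open>\<bar>z\<bar> powr \<alpha> \<le> 1 + z\<^sup>2\<close> and two come from the Gaussian
    moment. At \<open>u = 16\<close> the inequality \<open>(1 + u) / 34 \<le> u / 4 - 3\<close>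
    reads \<open>1/2 \<le> 1\<close>, and its right side grows faster.\<close>
  also have "\<dots> \<le> ennreal (exp (- (gauss_rate * \<kappa> * (1 + u))))"
  proof -
    have "gauss_rate * (1 + u) \<le> 1 / 34 * (1 + u)"
      using gauss_rate_le u by (intro mult_right_mono) auto
    also have "\<dots> \<le> u / 4 - 3" using u by simp
    finally have "\<kappa> * (gauss_rate * (1 + u)) \<le> \<kappa> * (u / 4 - 3)" using \<kappa> by (intro mult_left_mono) auto
    then show ?thesis by (intro ennreal_leI) (simp add: algebra_simps)
  qed
  finally show ?thesis by (simp add: u_def)
qed

lemma powr_abs_scale:
  fixes y z :: real
  assumes "s > 0" shows "\<bar>y + s * z\<bar> powr \<alpha> = s powr \<alpha> * \<bar>y / s + z\<bar> powr \<alpha>"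
proof -
  have "y + s * z = s * (y / s + z)" using assms by (simp add: field_simps)
  then show ?thesis using assms by (simp add: abs_mult powr_mult)
qed

lemma nn_integral_normal_exp_powr_scaled:
  assumes \<alpha>: "0 < \<alpha>" "\<alpha> \<le> 2" and s: "s > 0" and \<tau>: "0 \<le> \<tau>" "\<tau> * s powr \<alpha> \<le> 1/4"
  shows "(\<integral>\<^sup>+b. ennreal (exp (- (\<tau> * \<bar>y + b\<bar> powr \<alpha>))) \<partial>normal_measure s)
    \<le> ennreal (exp (- (gauss_rate * \<tau> * (s powr \<alpha> + \<bar>y\<bar> powr \<alpha>))))"
proof -
  have "(\<integral>\<^sup>+b. ennreal (exp (- (\<tau> * \<bar>y + b\<bar> powr \<alpha>))) \<partial>normal_measure s)
      = (\<integral>\<^sup>+z. ennreal (exp (- ((\<tau> * s powr \<alpha>) * \<bar>y / s + z\<bar> powr \<alpha>))) \<partial>normal_measure 1)"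
    using s by (subst nn_integral_normal_scale) (auto simp: powr_abs_scale mult.assoc)
  also have "\<dots> \<le> ennreal (exp (- (gauss_rate * (\<tau> * s powr \<alpha>) * (1 + \<bar>y / s\<bar> powr \<alpha>))))"
    using \<tau> by (intro nn_integral_normal_exp_powr \<alpha>) auto
  also have "gauss_rate * (\<tau> * s powr \<alpha>) * (1 + \<bar>y / s\<bar> powr \<alpha>) = gauss_rate * \<tau> * (s powr \<alpha> + \<bar>y\<bar> powr \<alpha>)"
    using powr_abs_scale[OF s, of y 0 \<alpha>] by (simp add: algebra_simps)
  finally show ?thesis .
qed

text \<open>The 8 is the 4 of \<open>powr_abs_add_le\<close> times the Gaussian mean 2 of
  \<open>1 + z\<^sup>2\<close>.\<close>

lemma nn_integral_normal_powr:
  assumes \<alpha>: "0 < \<alpha>" "\<alpha> \<le> 2" and s: "s > 0"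
  shows "(\<integral>\<^sup>+b. ennreal (\<bar>y + b\<bar> powr \<alpha>) \<partial>normal_measure s) \<le> ennreal (8 * (s powr \<alpha> + \<bar>y\<bar> powr \<alpha>))"
proof -
  interpret prob_space "normal_measure 1" by (rule prob_space_normal_density) simp
  have pw: "\<bar>y + s * z\<bar> powr \<alpha> \<le> 4 * \<bar>y\<bar> powr \<alpha> + 4 * s powr \<alpha> * (1 + z\<^sup>2)" for z
  proof -
    have "\<bar>y + s * z\<bar> powr \<alpha> \<le> 4 * (\<bar>y\<bar> powr \<alpha> + \<bar>s * z\<bar> powr \<alpha>)" by (rule powr_abs_add_le[OF \<alpha>])
    also have "\<bar>s * z\<bar> powr \<alpha> = s powr \<alpha> * \<bar>z\<bar> powr \<alpha>" using s by (simp add: abs_mult powr_mult)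
    also have "\<dots> \<le> s powr \<alpha> * (1 + z\<^sup>2)" using powr_abs_le_square[OF \<alpha>] by (intro mult_left_mono) auto
    finally show ?thesis by simp
  qed
  have "(\<integral>\<^sup>+b. ennreal (\<bar>y + b\<bar> powr \<alpha>) \<partial>normal_measure s) = (\<integral>\<^sup>+z. ennreal (\<bar>y + s * z\<bar> powr \<alpha>) \<partial>normal_measure 1)"
    using s by (subst nn_integral_normal_scale) auto
  also have "\<dots> \<le> (\<integral>\<^sup>+z. ennreal (4 * \<bar>y\<bar> powr \<alpha>) + ennreal (4 * s powr \<alpha>) * ennreal (1 + z\<^sup>2) \<partial>normal_measure 1)"
    using pw by (intro nn_integral_mono)
      (auto simp: ennreal_mult[symmetric] ennreal_plus[symmetric] simp del: ennreal_plus intro!: ennreal_leI)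
  also have "\<dots> = ennreal (4 * \<bar>y\<bar> powr \<alpha>) + ennreal (4 * s powr \<alpha>) * 2"
    using nn_integral_normal_square
    by (subst nn_integral_add) (auto simp del: ennreal_plus simp: nn_integral_cmult emeasure_space_1[simplified])
  also have "\<dots> = ennreal (4 * \<bar>y\<bar> powr \<alpha> + 8 * s powr \<alpha>)"
  proof -
    have "ennreal (4 * s powr \<alpha>) * 2 = ennreal (4 * s powr \<alpha>) * ennreal 2" by simp
    also have "\<dots> = ennreal (8 * s powr \<alpha>)" by (subst ennreal_mult[symmetric]) auto
    finally show ?thesis by (subst ennreal_plus) auto
  qed
  also have "\<dots> \<le> ennreal (8 * (s powr \<alpha> + \<bar>y\<bar> powr \<alpha>))" by (intro ennreal_leI) simp
  finally show ?thesis .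
qed

text \<open>Here \<open>\<tau>\<close> may be large. Since \<open>s\<^sup>2 \<ge> 1/2\<close>, the
  normal density is at most 1, so the interval \<open>\<bar>y + b\<bar> \<le> \<delta>\<close> has
  mass at most \<open>2 * \<delta>\<close> for every \<open>y\<close>; outside it the exponential is
  at most \<open>exp (- (\<tau> * \<delta> powr \<alpha>))\<close>. The free \<open>\<delta>\<close>
  balances the two.\<close>

lemma nn_integral_normal_exp_powr_flat:
  assumes \<alpha>: "0 < \<alpha>" and s: "s\<^sup>2 \<ge> 1/2" "s > 0" and \<tau>: "0 \<le> \<tau>" and \<delta>: "\<delta> > 0"
  shows "(\<integral>\<^sup>+b. ennreal (exp (- (\<tau> * \<bar>y + b\<bar> powr \<alpha>))) \<partial>normal_measure s)
    \<le> ennreal (2 * \<delta> + exp (- (\<tau> * \<delta> powr \<alpha>)))"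
proof -
  interpret prob_space "normal_measure s" using s by (intro prob_space_normal_density)
  define E where "E = {- y - \<delta>..- y + \<delta>}"
  have dens: "normal_density 0 s b \<le> 1" for b
  proof -
    have "1 \<le> pi * (2 * s\<^sup>2)" using s pi_gt3 mult_mono[of 1 pi 1 "2 * s\<^sup>2"] by simp
    then have "1 \<le> sqrt (2 * pi * s\<^sup>2)" by (simp add: mult_ac)
    then have "1 / sqrt (2 * pi * s\<^sup>2) \<le> 1" by simp
    moreover have "exp (- (b - 0)\<^sup>2 / (2 * s\<^sup>2)) \<le> 1" by simp
    ultimately have "1 / sqrt (2 * pi * s\<^sup>2) * exp (- (b - 0)\<^sup>2 / (2 * s\<^sup>2)) \<le> 1 * 1"
      by (intro mult_mono) auto
    then show ?thesis by (simp add: normal_density_def)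
  qed
  have pw: "exp (- (\<tau> * \<bar>y + b\<bar> powr \<alpha>)) \<le> indicator E b + exp (- (\<tau> * \<delta> powr \<alpha>))" for b
  proof (cases "b \<in> E")
    case True
    have "exp (- (\<tau> * \<bar>y + b\<bar> powr \<alpha>)) \<le> 1" using \<tau> by simp
    with True show ?thesis by (simp add: add_increasing2)
  next
    case False
    then have "\<delta> powr \<alpha> \<le> \<bar>y + b\<bar> powr \<alpha>" using \<alpha> \<delta> by (intro powr_mono2) (auto simp: E_def)
    with False show ?thesis using \<tau> by (simp add: mult_left_mono)
  qed
  have "(\<integral>\<^sup>+b. ennreal (exp (- (\<tau> * \<bar>y + b\<bar> powr \<alpha>))) \<partial>normal_measure s)
      \<le> (\<integral>\<^sup>+b. indicator E b + ennreal (exp (- (\<tau> * \<delta> powr \<alpha>))) \<partial>normal_measure s)"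
  proof (rule nn_integral_mono)
    fix b
    have "ennreal (exp (- (\<tau> * \<bar>y + b\<bar> powr \<alpha>))) \<le> ennreal (indicator E b + exp (- (\<tau> * \<delta> powr \<alpha>)))"
      using pw by (rule ennreal_leI)
    also have "\<dots> = indicator E b + ennreal (exp (- (\<tau> * \<delta> powr \<alpha>)))"
      by (auto simp: indicator_def ennreal_plus)
    finally show "ennreal (exp (- (\<tau> * \<bar>y + b\<bar> powr \<alpha>))) \<le> indicator E b + ennreal (exp (- (\<tau> * \<delta> powr \<alpha>)))" .
  qed
  also have "\<dots> = emeasure (normal_measure s) E + ennreal (exp (- (\<tau> * \<delta> powr \<alpha>)))"
    by (subst nn_integral_add) (auto simp: E_def emeasure_space_1[simplified])
  also have "emeasure (normal_measure s) E = (\<integral>\<^sup>+b. ennreal (normal_density 0 s b) * indicator E b \<partial>lborel)"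
    by (subst emeasure_density) (auto simp: E_def)
  also have "\<dots> \<le> (\<integral>\<^sup>+b. indicator E b \<partial>lborel)"
  proof (rule nn_integral_mono)
    fix b
    have "ennreal (normal_density 0 s b) \<le> 1" using dens[of b] by (simp add: ennreal_le_1)
    then show "ennreal (normal_density 0 s b) * indicator E b \<le> indicator E b"
      by (auto simp: indicator_def)
  qed
  also have "\<dots> = ennreal (2 * \<delta>)" using \<delta> by (simp add: E_def)
  finally show ?thesis using \<delta> by (simp add: ennreal_plus add_right_mono)
qed

section \<open>Passage from one coordinate to all coordinates\<close>

lemma nn_integral_gauss_component:
  assumes "s > 0" "i < d" "F \<in> borel_measurable borel"
  shows "(\<integral>\<^sup>+b. F (b i) \<partial>gauss d s) = (\<integral>\<^sup>+b. F b \<partial>normal_measure s)"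
proof -
  interpret product_prob_space "\<lambda>_. normal_measure s" "{..<d}"
    using assms by (intro product_prob_spaceI prob_space_normal_density)
  have "(\<integral>\<^sup>+b. F b \<partial>normal_measure s) = (\<integral>\<^sup>+b. F b \<partial>distr (gauss d s) (normal_measure s) (\<lambda>b. b i))"
    unfolding gauss_def using assms by (subst PiM_component) auto
  also have "\<dots> = (\<integral>\<^sup>+b. F (b i) \<partial>gauss d s)"
    unfolding gauss_def using assms
    by (subst nn_integral_distr) (auto intro!: measurable_component_singleton)
  finally show ?thesis by simp
qed

text \<open>The integral factorises over the coordinates. As the one-dimensional bound is a pure
  exponential without a factor in front, multiplying \<open>d\<close> of them keeps the rate and
  creates no constant that depends on \<open>d\<close>.\<close>

lemma nn_integral_gauss_exp_powr:
  assumes \<alpha>: "0 < \<alpha>" "\<alpha> \<le> 2" and s: "s > 0" and \<tau>: "0 \<le> \<tau>" "\<tau> * s powr \<alpha> \<le> 1/4"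
  shows "(\<integral>\<^sup>+b. ennreal (exp (- (\<tau> * (\<Sum>i<d. \<bar>y i + b i\<bar> powr \<alpha>)))) \<partial>gauss d s)
    \<le> ennreal (exp (- (gauss_rate * \<tau> * (\<Sum>i<d. s powr \<alpha> + \<bar>y i\<bar> powr \<alpha>))))"
proof -
  interpret product_sigma_finite "\<lambda>_. normal_measure s"
    using s by (auto simp: product_sigma_finite_def intro!: prob_space_imp_sigma_finite prob_space_normal_density)
  have "(\<integral>\<^sup>+b. ennreal (exp (- (\<tau> * (\<Sum>i<d. \<bar>y i + b i\<bar> powr \<alpha>)))) \<partial>gauss d s)
      = (\<integral>\<^sup>+b. (\<Prod>i<d. ennreal (exp (- (\<tau> * \<bar>y i + b i\<bar> powr \<alpha>)))) \<partial>gauss d s)"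
    by (simp add: sum_distrib_left sum_negf[symmetric] exp_sum prod_ennreal)
  also have "\<dots> = (\<Prod>i<d. \<integral>\<^sup>+b. ennreal (exp (- (\<tau> * \<bar>y i + b\<bar> powr \<alpha>))) \<partial>normal_measure s)"
    unfolding gauss_def by (rule product_nn_integral_prod) auto
  also have "\<dots> \<le> (\<Prod>i<d. ennreal (exp (- (gauss_rate * \<tau> * (s powr \<alpha> + \<bar>y i\<bar> powr \<alpha>)))))"
    using assms by (intro prod_mono_ennreal nn_integral_normal_exp_powr_scaled)
  also have "\<dots> = ennreal (exp (- (gauss_rate * \<tau> * (\<Sum>i<d. s powr \<alpha> + \<bar>y i\<bar> powr \<alpha>))))"
    by (simp only: sum_distrib_left sum_negf[symmetric] exp_sum[OF finite_lessThan] prod_ennreal[OF exp_ge_zero])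
  finally show ?thesis .
qed

lemma nn_integral_gauss_powr:
  assumes \<alpha>: "0 < \<alpha>" "\<alpha> \<le> 2" and s: "s > 0"
  shows "(\<integral>\<^sup>+b. ennreal (\<Sum>i<d. \<bar>y i + b i\<bar> powr \<alpha>) \<partial>gauss d s)
    \<le> ennreal (8 * (\<Sum>i<d. s powr \<alpha> + \<bar>y i\<bar> powr \<alpha>))"
proof -
  have "(\<integral>\<^sup>+b. ennreal (\<Sum>i<d. \<bar>y i + b i\<bar> powr \<alpha>) \<partial>gauss d s)
      = (\<integral>\<^sup>+b. (\<Sum>i<d. ennreal (\<bar>y i + b i\<bar> powr \<alpha>)) \<partial>gauss d s)"
    by simp
  also have "\<dots> = (\<Sum>i<d. \<integral>\<^sup>+b. ennreal (\<bar>y i + b i\<bar> powr \<alpha>) \<partial>gauss d s)"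
    by (rule nn_integral_sum)
      (auto simp: measurable_cong_sets[OF sets_gauss refl] intro!: measurable_compose[OF measurable_Rd_component])
  also have "\<dots> = (\<Sum>i<d. \<integral>\<^sup>+b. ennreal (\<bar>y i + b\<bar> powr \<alpha>) \<partial>normal_measure s)"
    by (intro sum.cong refl nn_integral_gauss_component[where F = "\<lambda>b. ennreal (\<bar>y _ + b\<bar> powr \<alpha>)"] s) auto
  also have "\<dots> \<le> (\<Sum>i<d. ennreal (8 * (s powr \<alpha> + \<bar>y i\<bar> powr \<alpha>)))"
    by (intro sum_mono nn_integral_normal_powr assms)
  also have "\<dots> = ennreal (8 * (\<Sum>i<d. s powr \<alpha> + \<bar>y i\<bar> powr \<alpha>))"
    by (subst sum_ennreal) (auto simp: sum_distrib_left)
  finally show ?thesis .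
qed

text \<open>All coordinates but the first are discarded, which only increases the
  exponential.\<close>

lemma nn_integral_gauss_exp_powr_flat:
  assumes \<alpha>: "0 < \<alpha>" and s: "s\<^sup>2 \<ge> 1/2" "s > 0" and \<tau>: "0 \<le> \<tau>" and \<delta>: "\<delta> > 0" and d: "d \<ge> 1"
  shows "(\<integral>\<^sup>+b. ennreal (exp (- (\<tau> * (\<Sum>i<d. \<bar>y i + b i\<bar> powr \<alpha>)))) \<partial>gauss d s)
    \<le> ennreal (2 * \<delta> + exp (- (\<tau> * \<delta> powr \<alpha>)))"
proof -
  have "(\<integral>\<^sup>+b. ennreal (exp (- (\<tau> * (\<Sum>i<d. \<bar>y i + b i\<bar> powr \<alpha>)))) \<partial>gauss d s)
      \<le> (\<integral>\<^sup>+b. ennreal (exp (- (\<tau> * \<bar>y 0 + b 0\<bar> powr \<alpha>))) \<partial>gauss d s)"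
  proof (intro nn_integral_mono ennreal_leI)
    fix b :: "nat \<Rightarrow> real"
    have "\<bar>y 0 + b 0\<bar> powr \<alpha> \<le> (\<Sum>i<d. \<bar>y i + b i\<bar> powr \<alpha>)"
      using d by (intro member_le_sum) auto
    then show "exp (- (\<tau> * (\<Sum>i<d. \<bar>y i + b i\<bar> powr \<alpha>))) \<le> exp (- (\<tau> * \<bar>y 0 + b 0\<bar> powr \<alpha>))"
      using \<tau> by (simp add: mult_left_mono)
  qed
  also have "\<dots> = (\<integral>\<^sup>+b. ennreal (exp (- (\<tau> * \<bar>y 0 + b\<bar> powr \<alpha>))) \<partial>normal_measure s)"
    using s d by (intro nn_integral_gauss_component[where F = "\<lambda>b. ennreal (exp (- (\<tau> * \<bar>y 0 + b\<bar> powr \<alpha>)))"]) auto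
  also have "\<dots> \<le> ennreal (2 * \<delta> + exp (- (\<tau> * \<delta> powr \<alpha>)))"
    using assms by (intro nn_integral_normal_exp_powr_flat)
  finally show ?thesis .
qed

section \<open>Decay of the Feynman--Kac weight\<close>

lemma sqrt_powr: "s \<ge> 0 \<Longrightarrow> sqrt s powr \<alpha> = s powr (\<alpha> / 2)"
  by (simp add: powr_half_sqrt[symmetric] powr_powr)

lemma (in wiener) distr_P_at:
  assumes s: "s > 0"
  shows "distr P (Rd d) (\<lambda>p. p s) = gauss d (sqrt s)"
proof -
  have "distr P (Rd d) (\<lambda>p. p s) = distr P (Rd d) (increment d 0 s)"
  proof (rule distr_cong_AE[OF refl refl])
    show "AE p in P. p s = increment d 0 s p"
      using wiener_measure_start[OF W0] AE_space
    proof eventually_elim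
      case (elim p)
      then have "p s \<in> extensional {..<d}" using s by (auto simp: space_P space_path_space space_Rd)
      then show ?case using elim(1)
        by (auto simp: increment_def intro!: extensionalityI[of _ "{..<d}"])
    qed
    show "(\<lambda>p. p s) \<in> measurable P (Rd d)" using s by (intro measurable_P_at) simp
    show "increment d 0 s \<in> measurable P (Rd d)"
      unfolding increment_eq_vminus[abs_def] using s by (intro measurable_vminus measurable_P_at) auto
  qed
  also have "\<dots> = gauss d (sqrt s)"
    using W0 s unfolding wiener_measure_def gauss_def by force
  finally show ?thesis .
qed

lemma (in wiener) nn_integral_P_at:
  assumes s: "s > 0" and F: "F \<in> borel_measurable (Rd d)"
  shows "(\<integral>\<^sup>+p. F (p s) \<partial>P) = (\<integral>\<^sup>+b. F b \<partial>gauss d (sqrt s))"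
  unfolding distr_P_at[OF s, symmetric] using s F
  by (subst nn_integral_distr) (auto intro: measurable_P_at)

section \<open>Potentials between two multiples of the sum of powers\<close>

locale power_potential = wiener +
  fixes V :: "(nat \<Rightarrow> real) \<Rightarrow> real" and \<alpha> m M :: real
  assumes V_meas [measurable]: "V \<in> borel_measurable (Rd d)" and d: "d \<ge> 1"
    and \<alpha>: "0 < \<alpha>" "\<alpha> \<le> 2" and m: "0 < m"
    and V_lower: "\<And>x. x \<in> space (Rd d) \<Longrightarrow> m * (\<Sum>i<d. \<bar>x i\<bar> powr \<alpha>) \<le> V x"
    and V_upper: "\<And>x. x \<in> space (Rd d) \<Longrightarrow> V x \<le> M * (\<Sum>i<d. \<bar>x i\<bar> powr \<alpha>)"
begin

lemma V_nonneg: "x \<in> space (Rd d) \<Longrightarrow> 0 \<le> V x"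
  by (rule order_trans[OF _ V_lower]) (use m in \<open>auto intro!: mult_nonneg_nonneg sum_nonneg\<close>)

lemma M_nonneg: "0 \<le> M"
proof -
  define x :: "nat \<Rightarrow> real" where "x = (\<lambda>i\<in>{..<d}. 1)"
  have "x \<in> space (Rd d)" by (simp add: x_def space_Rd)
  then have "m * (\<Sum>i<d. \<bar>x i\<bar> powr \<alpha>) \<le> M * (\<Sum>i<d. \<bar>x i\<bar> powr \<alpha>)"
    using V_lower V_upper order_trans by blast
  moreover have "(\<Sum>i<d. \<bar>x i\<bar> powr \<alpha>) = real d" by (simp add: x_def)
  ultimately show ?thesis using m d by simp
qed

text \<open>\<open>max 0\<close> extends the function to negative times, where paths carry no
  information, so that joint measurability holds on the whole line.\<close>

definition along :: "(nat \<Rightarrow> real) \<Rightarrow> (real \<Rightarrow> nat \<Rightarrow> real) \<Rightarrow> real \<Rightarrow> real" where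
  "along y p s = V (vplus d y (p (max 0 s)))"

lemma fk_weight_along: "fk_weight d V t y p = exp (- (LINT s:{0..t}|lborel. along y p s))"
proof -
  have "(LINT s:{0..t}|lborel. V (vplus d y (p s))) = (LINT s:{0..t}|lborel. along y p s)"
    by (rule set_lebesgue_integral_cong) (auto simp: along_def)
  then show ?thesis by (simp add: fk_weight_def)
qed

lemma along_nonneg: "0 \<le> along y p s"
  by (simp add: along_def V_nonneg)

lemma along_measurable:
  assumes "y \<in> space (Rd d)" "p \<in> space P"
  shows "along y p \<in> borel_measurable borel"
proof -
  have [measurable]: "(\<lambda>s::real. p) \<in> measurable borel (path_space d)" "(\<lambda>s::real. y) \<in> measurable borel (Rd d)"
    using assms by (auto simp: space_P)
  show ?thesis unfolding along_def[abs_def] by measurable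
qed

text \<open>\<open>V\<close> is merely measurable, so continuity of the path alone does not bound
  it. The bound comes from \<open>V_upper\<close> and the coordinates of the path, which stay
  bounded on \<open>{0..T}\<close>.\<close>

lemma along_bounded:
  assumes "y \<in> space (Rd d)" "p \<in> space P"
  shows "\<exists>B. \<forall>s\<in>{0..T}. along y p s \<le> B"
proof -
  have "\<exists>b. \<forall>s\<in>{0..T}. \<bar>y i + p s i\<bar> powr \<alpha> \<le> b" if "i < d" for i
  proof -
    have "continuous_on {0..T} (\<lambda>s. p s i)"
      using assms that by (auto simp: space_P space_path_space intro: continuous_on_subset)
    then have "compact ((\<lambda>s. p s i) ` {0..T})" by (intro compact_continuous_image) auto
    then obtain b where b: "\<And>s. s \<in> {0..T} \<Longrightarrow> \<bar>p s i\<bar> \<le> b"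
      by (metis bounded_real compact_imp_bounded imageI)
    have "\<bar>y i + p s i\<bar> powr \<alpha> \<le> (\<bar>y i\<bar> + b) powr \<alpha>" if "s \<in> {0..T}" for s
      using \<alpha> b[OF that] by (intro powr_mono2) auto
    then show ?thesis by blast
  qed
  then obtain b where b: "\<And>i s. i < d \<Longrightarrow> s \<in> {0..T} \<Longrightarrow> \<bar>y i + p s i\<bar> powr \<alpha> \<le> b i"
    by metis
  have "along y p s \<le> M * (\<Sum>i<d. b i)" if s: "s \<in> {0..T}" for s
  proof -
    have "along y p s \<le> M * (\<Sum>i<d. \<bar>vplus d y (p s) i\<bar> powr \<alpha>)"
      using s by (simp add: along_def max_absorb2 V_upper)
    also have "\<dots> \<le> M * (\<Sum>i<d. b i)"
      using b s M_nonneg by (intro mult_left_mono sum_mono) (auto simp: vplus_def)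
    finally show ?thesis .
  qed
  then show ?thesis by blast
qed

lemma nn_integral_fk_weight_V_le_1:
  assumes y: "y \<in> space (Rd d)"
  shows "(\<integral>\<^sup>+t. (\<integral>\<^sup>+p. ennreal (fk_weight d V t y p * along y p t) \<partial>P) * indicator {0<..} t \<partial>lborel) \<le> 1"
proof -
  interpret LP: pair_sigma_finite lborel P ..
  have [measurable]: "(\<lambda>q. along y (snd q) (fst q)) \<in> borel_measurable (lborel \<Otimes>\<^sub>M P)"
    "(\<lambda>q. fk_weight d V (fst q) y (snd q)) \<in> borel_measurable (lborel \<Otimes>\<^sub>M P)"
    using y unfolding along_def[abs_def] by measurable
  have "(\<integral>\<^sup>+t. (\<integral>\<^sup>+p. ennreal (fk_weight d V t y p * along y p t) \<partial>P) * indicator {0<..} t \<partial>lborel)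
      = (\<integral>\<^sup>+t. \<integral>\<^sup>+p. ennreal (fk_weight d V t y p * along y p t) * indicator {0<..} t \<partial>P \<partial>lborel)"
    by (intro nn_integral_cong) (auto simp: indicator_def)
  also have "\<dots> = (\<integral>\<^sup>+p. \<integral>\<^sup>+t. ennreal (fk_weight d V t y p * along y p t) * indicator {0<..} t \<partial>lborel \<partial>P)"
    by (rule LP.Fubini'[symmetric]) measurable
  also have "\<dots> \<le> (\<integral>\<^sup>+p. 1 \<partial>P)"
    unfolding fk_weight_along
    by (intro nn_integral_mono nn_integral_exp_primitive_le_1 along_nonneg along_measurable along_bounded y)
  also have "\<dots> = 1" by (simp add: emeasure_space_1)
  finally show ?thesis .
qed

text \<open>After Jensen's inequality in time, only the law of the motion at single times of
  \<open>[t/2,t]\<close> matters. The parameter \<open>\<tau>\<close> may stay below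
  \<open>t / 2 * m\<close>, because the exponential bound for short times needs a small
  parameter.\<close>

lemma nn_integral_fk_weight_le:
  assumes y: "y \<in> space (Rd d)" and t: "t > 0" and \<tau>: "\<tau> \<le> t / 2 * m"
    and K: "\<And>s. t / 2 \<le> s \<Longrightarrow> s \<le> t \<Longrightarrow>
      (\<integral>\<^sup>+b. ennreal (exp (- (\<tau> * (\<Sum>i<d. \<bar>y i + b i\<bar> powr \<alpha>)))) \<partial>gauss d (sqrt s)) \<le> K"
  shows "(\<integral>\<^sup>+p. ennreal (fk_weight d V t y p) \<partial>P) \<le> K"
proof -
  interpret PL: pair_sigma_finite P lborel ..
  have [measurable]: "(\<lambda>q. along y (fst q) (snd q)) \<in> borel_measurable (P \<Otimes>\<^sub>M lborel)"
    using y unfolding along_def[abs_def] by measurable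
  have "(\<integral>\<^sup>+p. ennreal (fk_weight d V t y p) \<partial>P)
      \<le> (\<integral>\<^sup>+p. \<integral>\<^sup>+s. ennreal (2 / t * exp (- (t / 2 * along y p s))) * indicator {t/2..t} s \<partial>lborel \<partial>P)"
    unfolding fk_weight_along
    by (intro nn_integral_mono exp_primitive_le_average along_nonneg along_measurable along_bounded y t)
  also have "\<dots> = (\<integral>\<^sup>+s. \<integral>\<^sup>+p. ennreal (2 / t * exp (- (t / 2 * along y p s))) * indicator {t/2..t} s \<partial>P \<partial>lborel)"
    by (rule PL.Fubini'[symmetric]) measurable
  also have "\<dots> \<le> (\<integral>\<^sup>+s. ennreal (2 / t) * K * indicator {t/2..t} s \<partial>lborel)"
  proof (rule nn_integral_mono)
    fix s
    show "(\<integral>\<^sup>+p. ennreal (2 / t * exp (- (t / 2 * along y p s))) * indicator {t/2..t} s \<partial>P)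
      \<le> ennreal (2 / t) * K * indicator {t/2..t} s"
    proof (cases "s \<in> {t/2..t}")
      case True
      then have s: "s > 0" "t / 2 \<le> s" "s \<le> t" using t by auto
      have [measurable]: "(\<lambda>b. \<Sum>i<d. \<bar>y i + b i\<bar> powr \<alpha>) \<in> borel_measurable (Rd d)"
        by (intro borel_measurable_sum measurable_compose[OF measurable_Rd_component]) auto
      have "(\<integral>\<^sup>+p. ennreal (2 / t * exp (- (t / 2 * along y p s))) * indicator {t/2..t} s \<partial>P)
          \<le> (\<integral>\<^sup>+p. ennreal (2 / t) * ennreal (exp (- (\<tau> * (\<Sum>i<d. \<bar>y i + p s i\<bar> powr \<alpha>)))) \<partial>P)"
      proof (rule nn_integral_mono)
        fix p
        have "\<tau> * (\<Sum>i<d. \<bar>y i + p s i\<bar> powr \<alpha>) \<le> (t / 2 * m) * (\<Sum>i<d. \<bar>y i + p s i\<bar> powr \<alpha>)"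
          by (intro mult_right_mono \<tau> sum_nonneg) auto
        also have "(\<Sum>i<d. \<bar>y i + p s i\<bar> powr \<alpha>) = (\<Sum>i<d. \<bar>vplus d y (p s) i\<bar> powr \<alpha>)"
          by (simp add: vplus_def)
        also have "t / 2 * m * \<dots> \<le> t / 2 * along y p s"
          using V_lower[of "vplus d y (p s)"] t s by (simp add: along_def max_absorb2 mult.assoc)
        finally have "exp (- (t / 2 * along y p s)) \<le> exp (- (\<tau> * (\<Sum>i<d. \<bar>y i + p s i\<bar> powr \<alpha>)))"
          by (simp add: vplus_def)
        then show "ennreal (2 / t * exp (- (t / 2 * along y p s))) * indicator {t/2..t} s
            \<le> ennreal (2 / t) * ennreal (exp (- (\<tau> * (\<Sum>i<d. \<bar>y i + p s i\<bar> powr \<alpha>))))"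
          using True t by (auto simp: ennreal_mult[symmetric] intro!: ennreal_leI divide_right_mono)
      qed
      also have "\<dots> = ennreal (2 / t) * (\<integral>\<^sup>+p. ennreal (exp (- (\<tau> * (\<Sum>i<d. \<bar>y i + p s i\<bar> powr \<alpha>)))) \<partial>P)"
        by (rule nn_integral_cmult)
          (rule measurable_compose[OF measurable_P_at, where g = "\<lambda>b. ennreal (exp (- (\<tau> * (\<Sum>i<d. \<bar>y i + b i\<bar> powr \<alpha>))))"],
            use s in auto)
      also have "(\<integral>\<^sup>+p. ennreal (exp (- (\<tau> * (\<Sum>i<d. \<bar>y i + p s i\<bar> powr \<alpha>)))) \<partial>P)
          = (\<integral>\<^sup>+b. ennreal (exp (- (\<tau> * (\<Sum>i<d. \<bar>y i + b i\<bar> powr \<alpha>)))) \<partial>gauss d (sqrt s))"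
        using s by (intro nn_integral_P_at) auto
      also have "ennreal (2 / t) * \<dots> \<le> ennreal (2 / t) * K"
        by (intro mult_left_mono K s) auto
      finally show ?thesis using True by simp
    qed simp
  qed
  also have "\<dots> = ennreal (2 / t) * K * ennreal (t - t / 2)"
    using t by (subst nn_integral_cmult) auto
  also have "\<dots> = K * (ennreal (2 / t) * ennreal (t - t / 2))" by (simp add: mult_ac)
  also have "ennreal (2 / t) * ennreal (t - t / 2) = 1"
    using t by (subst ennreal_mult[symmetric]) auto
  finally show ?thesis by simp
qed

text \<open>The function \<open>Q\<close> of the overview: a coordinate started at
  \<open>y i\<close> has spread of order \<open>sqrt t\<close> at time \<open>t\<close>, so this is
  the order of magnitude of the sum of the powers there.\<close>

definition scale :: "(nat \<Rightarrow> real) \<Rightarrow> real \<Rightarrow> real" where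
  "scale y t = (\<Sum>i<d. t powr (\<alpha> / 2) + \<bar>y i\<bar> powr \<alpha>)"

lemma scale_pos: "t > 0 \<Longrightarrow> scale y t > 0"
  unfolding scale_def using d by (intro sum_pos) (auto simp: lessThan_empty_iff intro!: add_pos_nonneg)

lemma scale_eq: "scale y t = (\<Sum>i<d. \<bar>y i\<bar> powr \<alpha>) + real d * t powr (\<alpha> / 2)"
  by (simp add: scale_def sum.distrib)

text \<open>With \<open>\<tau> = t * min m (1/2) / 2\<close>, the minimum keeps
  \<open>\<tau> * sqrt s powr \<alpha>\<close> at most 1/4 for \<open>s \<le> t \<le> 1\<close>. The
  4 is the 2 in \<open>\<tau>\<close> times the 2 lost in
  \<open>sqrt s powr \<alpha> \<ge> t powr (\<alpha> / 2) / 2\<close> for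
  \<open>s \<ge> t / 2\<close>, an estimate that rests on \<open>\<alpha> \<le> 2\<close>.\<close>

definition rate :: real where "rate = gauss_rate * min m (1/2) / 4"

lemma nn_integral_fk_weight_short:
  assumes y: "y \<in> space (Rd d)" and t: "0 < t" "t \<le> 1"
  shows "(\<integral>\<^sup>+p. ennreal (fk_weight d V t y p) \<partial>P) \<le> ennreal (exp (- (rate * t * scale y t)))"
proof (rule nn_integral_fk_weight_le[OF y t(1)])
  show "t * min m (1/2) / 2 \<le> t / 2 * m" using t by simp
  fix s assume s: "t / 2 \<le> s" "s \<le> t"
  have s0: "s > 0" using s t by simp
  have le1: "sqrt s powr \<alpha> \<le> 1 powr \<alpha>" using \<alpha> s s0 t by (intro powr_mono2) auto
  have "(t * min m (1/2) / 2) * sqrt s powr \<alpha> \<le> (1/4) * 1"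
  proof (rule mult_mono)
    have "t * min m (1/2) \<le> 1 * (1/2)" using t m by (intro mult_mono) auto
    then show "t * min m (1/2) / 2 \<le> 1/4" by simp
  qed (use le1 in auto)
  with \<alpha> s0 t m have "(\<integral>\<^sup>+b. ennreal (exp (- (t * min m (1/2) / 2 * (\<Sum>i<d. \<bar>y i + b i\<bar> powr \<alpha>)))) \<partial>gauss d (sqrt s))
      \<le> ennreal (exp (- (gauss_rate * (t * min m (1/2) / 2) * (\<Sum>i<d. sqrt s powr \<alpha> + \<bar>y i\<bar> powr \<alpha>))))"
    by (intro nn_integral_gauss_exp_powr) auto
  also have "\<dots> \<le> ennreal (exp (- (rate * t * scale y t)))"
  proof -
    have "(1/2) * t powr (\<alpha> / 2) \<le> sqrt s powr \<alpha>"
    proof -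
      have "(1/2) powr 1 \<le> (1/2::real) powr (\<alpha> / 2)" using \<alpha> by (intro powr_mono') auto
      then have "(1/2) * t powr (\<alpha> / 2) \<le> (1/2) powr (\<alpha> / 2) * t powr (\<alpha> / 2)"
        by (intro mult_right_mono) auto
      also have "\<dots> = (t / 2) powr (\<alpha> / 2)" using t by (simp add: powr_divide)
      also have "\<dots> \<le> s powr (\<alpha> / 2)" using \<alpha> s t by (intro powr_mono2) auto
      finally show ?thesis using s0 by (simp add: sqrt_powr)
    qed
    then have "(1/2) * (t powr (\<alpha> / 2) + \<bar>y i\<bar> powr \<alpha>) \<le> sqrt s powr \<alpha> + \<bar>y i\<bar> powr \<alpha>" for i
      using powr_ge_zero[of "\<bar>y i\<bar>" \<alpha>] unfolding distrib_left by (intro add_mono) simp_all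
    then have "(1/2) * scale y t \<le> (\<Sum>i<d. sqrt s powr \<alpha> + \<bar>y i\<bar> powr \<alpha>)"
      unfolding scale_def sum_distrib_left by (intro sum_mono)
    then have "gauss_rate * (t * min m (1/2) / 2) * ((1/2) * scale y t)
        \<le> gauss_rate * (t * min m (1/2) / 2) * (\<Sum>i<d. sqrt s powr \<alpha> + \<bar>y i\<bar> powr \<alpha>)"
      using gauss_rate_pos t m by (intro mult_left_mono) auto
    then show ?thesis by (intro ennreal_leI) (simp add: rate_def mult_ac)
  qed
  finally show "(\<integral>\<^sup>+b. ennreal (exp (- (t * min m (1/2) / 2 * (\<Sum>i<d. \<bar>y i + b i\<bar> powr \<alpha>)))) \<partial>gauss d (sqrt s))
    \<le> ennreal (exp (- (rate * t * scale y t)))" .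
qed

lemma nn_integral_fk_weight_long:
  assumes y: "y \<in> space (Rd d)" and t: "1 \<le> t"
  shows "(\<integral>\<^sup>+p. ennreal (fk_weight d V t y p) \<partial>P) \<le> ennreal ((2 + 2 / m) * t powr (- 1/4))"
proof (rule nn_integral_fk_weight_le[OF y _ order_refl])
  show "t > 0" using t by simp
  fix s assume s: "t / 2 \<le> s" "s \<le> t"
  \<comment> \<open>Chosen so that \<open>t / 2 * m * \<delta> powr \<alpha>\<close> is of order
    \<open>t powr (1/2)\<close>. By \<open>\<alpha> \<le> 2\<close> this still gives
    \<open>\<delta> \<le> t powr (- 1/4)\<close>, which fixes the rate of decay.\<close>
  define \<delta> where "\<delta> = t powr (- 1 / (2 * \<alpha>))"
  have \<delta>\<alpha>: "\<delta> powr \<alpha> = t powr (- 1/2)" using \<alpha> by (simp add: \<delta>_def powr_powr)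
  have "\<delta> \<le> t powr (- 1/4)" unfolding \<delta>_def using t \<alpha> by (intro powr_mono) (auto simp: field_simps)
  moreover have "exp (- (t / 2 * m * \<delta> powr \<alpha>)) \<le> 2 / m * t powr (- 1/4)"
  proof -
    define x where "x = t / 2 * m * \<delta> powr \<alpha>"
    have x: "x = m / 2 * t powr (1/2)"
    proof -
      have "t * t powr (- 1/2) = t powr 1 * t powr (- 1/2)" using t by simp
      also have "\<dots> = t powr (1 + - 1/2)" by (simp only: powr_add)
      also have "\<dots> = t powr (1/2)" by simp
      finally show ?thesis by (simp add: x_def \<delta>\<alpha>)
    qed
    have x0: "x > 0" using t m by (simp add: x)
    have "x \<le> exp x" using exp_ge_add_one_self[of x] by linarith
    then have "exp (- x) \<le> 1 / x" using x0 by (simp add: exp_minus field_simps)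
    also have "1 / x = 2 / m * t powr (- (1/2))" by (simp add: x powr_minus_divide)
    also have "\<dots> \<le> 2 / m * t powr (- 1/4)" using t m by (intro mult_left_mono powr_mono) auto
    finally show ?thesis by (simp add: x_def)
  qed
  ultimately have le: "2 * \<delta> + exp (- (t / 2 * m * \<delta> powr \<alpha>)) \<le> (2 + 2 / m) * t powr (- 1/4)"
    by (simp add: algebra_simps)
  have "(\<integral>\<^sup>+b. ennreal (exp (- (t / 2 * m * (\<Sum>i<d. \<bar>y i + b i\<bar> powr \<alpha>)))) \<partial>gauss d (sqrt s))
      \<le> ennreal (2 * \<delta> + exp (- (t / 2 * m * \<delta> powr \<alpha>)))"
    using s t m d \<alpha> by (intro nn_integral_gauss_exp_powr_flat) (auto simp: \<delta>_def)
  also have "\<dots> \<le> ennreal ((2 + 2 / m) * t powr (- 1/4))" using le by (rule ennreal_leI)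
  finally show "(\<integral>\<^sup>+b. ennreal (exp (- (t / 2 * m * (\<Sum>i<d. \<bar>y i + b i\<bar> powr \<alpha>)))) \<partial>gauss d (sqrt s))
    \<le> ennreal ((2 + 2 / m) * t powr (- 1/4))" .
qed

lemma nn_integral_V_le:
  assumes y: "y \<in> space (Rd d)" and t: "0 < t"
  shows "(\<integral>\<^sup>+p. ennreal (along y p t) \<partial>P) \<le> ennreal (8 * M * scale y t)"
proof -
  have meas: "(\<lambda>b. ennreal (\<Sum>i<d. \<bar>y i + b i\<bar> powr \<alpha>)) \<in> borel_measurable (Rd d)"
    by (intro measurable_compose[OF _ measurable_ennreal] borel_measurable_sum measurable_compose[OF measurable_Rd_component]) auto
  have "(\<integral>\<^sup>+p. ennreal (along y p t) \<partial>P) \<le> (\<integral>\<^sup>+p. ennreal M * ennreal (\<Sum>i<d. \<bar>y i + p t i\<bar> powr \<alpha>) \<partial>P)"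
  proof (rule nn_integral_mono)
    fix p
    have "along y p t \<le> M * (\<Sum>i<d. \<bar>y i + p t i\<bar> powr \<alpha>)"
    proof -
      have "along y p t \<le> M * (\<Sum>i<d. \<bar>vplus d y (p t) i\<bar> powr \<alpha>)"
        using V_upper[of "vplus d y (p t)"] t by (simp add: along_def max_absorb2)
      then show ?thesis by (simp add: vplus_def)
    qed
    then show "ennreal (along y p t) \<le> ennreal M * ennreal (\<Sum>i<d. \<bar>y i + p t i\<bar> powr \<alpha>)"
      using M_nonneg by (subst ennreal_mult[symmetric]) (auto intro!: ennreal_leI sum_nonneg)
  qed
  also have "\<dots> = ennreal M * (\<integral>\<^sup>+p. ennreal (\<Sum>i<d. \<bar>y i + p t i\<bar> powr \<alpha>) \<partial>P)"
    using t by (intro nn_integral_cmult measurable_compose[OF measurable_P_at meas]) auto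
  also have "(\<integral>\<^sup>+p. ennreal (\<Sum>i<d. \<bar>y i + p t i\<bar> powr \<alpha>) \<partial>P)
      = (\<integral>\<^sup>+b. ennreal (\<Sum>i<d. \<bar>y i + b i\<bar> powr \<alpha>) \<partial>gauss d (sqrt t))"
    by (rule nn_integral_P_at[OF t meas])
  also have "ennreal M * \<dots> \<le> ennreal M * ennreal (8 * scale y t)"
    using nn_integral_gauss_powr[OF \<alpha>, of "sqrt t" d y] t
    by (intro mult_left_mono) (auto simp: sqrt_powr scale_def)
  also have "\<dots> = ennreal (8 * M * scale y t)"
    using M_nonneg scale_pos[OF t, of y] by (subst ennreal_mult[symmetric]) (auto simp: mult_ac)
  finally show ?thesis .
qed

end

section \<open>The time integral\<close>

text \<open>The exponential is weakened to a multiple of \<open>1 / (1 + u)\<^sup>2\<close>, the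
  derivative of \<open>u / (1 + u)\<close>, so that the time integral can be compared with an
  explicit primitive.\<close>

lemma exp_neg_le_inverse_square:
  fixes c u :: real
  assumes c: "c > 0" and u: "u \<ge> 0"
  shows "exp (- (c * u)) \<le> (1 + 2 / c)\<^sup>2 / (1 + u)\<^sup>2"
proof -
  have "1 + u \<le> (1 + 2 / c) * exp (c * u / 2)"
  proof -
    have "1 + u \<le> (1 + 2 / c) * (1 + c * u / 2)" using c u by (simp add: field_simps)
    also have "\<dots> \<le> (1 + 2 / c) * exp (c * u / 2)"
      using c exp_ge_add_one_self[of "c * u / 2"] by (intro mult_left_mono) auto
    finally show ?thesis .
  qed
  then have "(1 + u)\<^sup>2 \<le> ((1 + 2 / c) * exp (c * u / 2))\<^sup>2" using u by (intro power_mono) auto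
  also have "\<dots> = (1 + 2 / c)\<^sup>2 * exp (c * u)"
    by (simp add: power_mult_distrib flip: exp_double)
  finally show ?thesis using u by (simp add: exp_minus field_simps)
qed

text \<open>For integrands that may be singular at 0, where the fundamental theorem of calculus is
  available only on \<open>{\<epsilon>..b}\<close>.\<close>

lemma nn_integral_Ioc_le:
  fixes F :: "real \<Rightarrow> ennreal"
  assumes [measurable]: "F \<in> borel_measurable borel"
    and le: "\<And>\<epsilon>. \<epsilon> > 0 \<Longrightarrow> (\<integral>\<^sup>+t. F t * indicator {\<epsilon>..b} t \<partial>lborel) \<le> K"
  shows "(\<integral>\<^sup>+t. F t * indicator {0<..b} t \<partial>lborel) \<le> K"
proof -
  have "(\<integral>\<^sup>+t. F t * indicator {0<..b} t \<partial>lborel) = (\<integral>\<^sup>+t. (SUP n. F t * indicator {1 / real (Suc n)..b} t) \<partial>lborel)"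
  proof (intro nn_integral_cong antisym)
    fix t
    show "F t * indicator {0<..b} t \<le> (SUP n. F t * indicator {1 / real (Suc n)..b} t)"
    proof (cases "t > 0")
      case True
      then obtain n where n: "inverse (real (Suc n)) < t" using reals_Archimedean by blast
      have "F t * indicator {0<..b} t \<le> F t * indicator {1 / real (Suc n)..b} t"
        using n by (auto simp: indicator_def inverse_eq_divide)
      also have "\<dots> \<le> (SUP n. F t * indicator {1 / real (Suc n)..b} t)" by (rule SUP_upper) simp
      finally show ?thesis .
    qed simp
    show "(SUP n. F t * indicator {1 / real (Suc n)..b} t) \<le> F t * indicator {0<..b} t"
    proof (rule SUP_least)
      fix n
      have "1 / real (Suc n) > 0" by simp
      then have "t \<in> {0<..b}" if "t \<in> {1 / real (Suc n)..b}"
        using that unfolding atLeastAtMost_iff greaterThanAtMost_iff by linarith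
      then show "F t * indicator {1 / real (Suc n)..b} t \<le> F t * indicator {0<..b} t"
        by (cases "t \<in> {1 / real (Suc n)..b}") simp_all
    qed
  qed
  also have "\<dots> = (SUP n. \<integral>\<^sup>+t. F t * indicator {1 / real (Suc n)..b} t \<partial>lborel)"
  proof (rule nn_integral_monotone_convergence_SUP)
    have "1 / real (Suc n) \<le> 1 / real (Suc k)" if "k \<le> n" for k n
      using that by (intro divide_left_mono) auto
    then show "incseq (\<lambda>n t. F t * indicator {1 / real (Suc n)..b} t)"
      by (auto simp: incseq_def le_fun_def indicator_def simp del: of_nat_Suc intro: order_trans)
  qed simp
  also have "\<dots> \<le> K" by (intro SUP_least le) simp
  finally show ?thesis .
qed

text \<open>
  With \<open>u = t Q\<close> and \<open>Q = S + D t powr \<beta>\<close> nondecreasing, the integrand is at most the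
  derivative of \<open>(u / (1 + u)) powr a / a\<close>.
\<close>

lemma nn_integral_scale_le:
  fixes S D \<beta> a :: real
  assumes S: "S \<ge> 0" and D: "D > 0" and \<beta>: "\<beta> > 0" and a: "0 < a" "a \<le> 1"
  defines "Q \<equiv> \<lambda>t. S + D * t powr \<beta>"
  shows "(\<integral>\<^sup>+t. ennreal (t powr (a - 1) * Q t powr a / (1 + t * Q t)\<^sup>2) * indicator {0<..1} t \<partial>lborel) \<le> ennreal (1 / a)"
proof (rule nn_integral_Ioc_le)
  show "(\<lambda>t. ennreal (t powr (a - 1) * Q t powr a / (1 + t * Q t)\<^sup>2)) \<in> borel_measurable borel"
    unfolding Q_def by measurable
  fix \<epsilon> :: real assume \<epsilon>: "\<epsilon> > 0"
  define u where "u = (\<lambda>t. t * Q t)"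
  define u' where "u' = (\<lambda>t. S + D * (1 + \<beta>) * t powr \<beta>)"
  define g where "g = (\<lambda>t. u t / (1 + u t))"
  define F where "F = (\<lambda>t. g t powr a / a)"
  define f where "f = (\<lambda>t. g t powr (a - 1) * (u' t / (1 + u t)\<^sup>2))"
  have Q: "Q t > 0" if "t > 0" for t using that S D by (simp add: Q_def add_nonneg_pos)
  have u: "u t > 0" if "t > 0" for t using Q[OF that] that by (simp add: u_def)
  have g: "g t > 0" if "t > 0" for t using u[OF that] by (simp add: g_def)
  have du: "DERIV u t :> u' t" if t: "t > 0" for t
  proof -
    have "DERIV u t :> 1 * Q t + (D * (\<beta> * t powr (\<beta> - 1))) * t"
      unfolding u_def Q_def using t by (auto intro!: derivative_eq_intros simp: Q_def)
    moreover have "t powr (\<beta> - 1) * t = t powr \<beta>" using t by (simp add: powr_mult_base powr_diff)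
    ultimately show ?thesis by (simp add: u'_def Q_def algebra_simps)
  qed
  have dg: "DERIV g t :> u' t / (1 + u t)\<^sup>2" if t: "t > 0" for t
    unfolding g_def using u[OF t] du[OF t]
    by (auto intro!: derivative_eq_intros simp: power2_eq_square field_simps)
  have dF: "DERIV F t :> f t" if t: "t > 0" for t
  proof -
    have "DERIV (\<lambda>t. g t powr a) t :> a * g t powr (a - 1) * (u' t / (1 + u t)\<^sup>2)"
      using DERIV_fun_powr[OF dg[OF t] g[OF t], of a] by simp
    from DERIV_cdivide[OF this, of a] show ?thesis using a by (simp add: F_def f_def)
  qed
  have f_nonneg: "f t \<ge> 0" if "t > 0" for t
  proof -
    have "u' t \<ge> 0" unfolding u'_def using S D \<beta> by (intro add_nonneg_nonneg mult_nonneg_nonneg) auto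
    then show ?thesis by (simp add: f_def)
  qed
  have le: "t powr (a - 1) * Q t powr a / (1 + t * Q t)\<^sup>2 \<le> f t" if t: "t > 0" for t
  proof -
    \<comment> \<open>In terms of \<open>u\<close> the integrand is
      \<open>u powr (a - 1) * Q / (1 + u)\<^sup>2\<close>. Since \<open>a - 1 \<le> 0\<close>,
      putting the smaller \<open>g\<close> in place of the base \<open>u\<close> increases the
      power, and \<open>Q \<le> u'\<close> because \<open>u'\<close> is \<open>Q\<close> plus
      \<open>t\<close> times the nonnegative derivative of \<open>Q\<close>.\<close>
    have "Q t powr a = Q t powr (a - 1) * Q t" using Q[OF t] by (simp add: powr_diff)
    then have "t powr (a - 1) * Q t powr a / (1 + t * Q t)\<^sup>2 = u t powr (a - 1) * (Q t / (1 + u t)\<^sup>2)"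
      using t Q[OF t] by (simp add: u_def powr_mult)
    also have "\<dots> \<le> g t powr (a - 1) * (u' t / (1 + u t)\<^sup>2)"
    proof (intro mult_mono)
      have "g t \<le> u t" using u[OF t] by (simp add: g_def field_simps)
      then show "u t powr (a - 1) \<le> g t powr (a - 1)" using g[OF t] a by (intro powr_mono2') auto
      show "Q t / (1 + u t)\<^sup>2 \<le> u' t / (1 + u t)\<^sup>2"
      proof (rule divide_right_mono)
        have "D * 1 * t powr \<beta> \<le> D * (1 + \<beta>) * t powr \<beta>"
          using D \<beta> by (intro mult_right_mono mult_left_mono) auto
        then show "Q t \<le> u' t" by (simp add: Q_def u'_def)
      qed simp
      show "0 \<le> Q t / (1 + u t)\<^sup>2" using Q[OF t] by simp
    qed auto
    finally show ?thesis by (simp add: f_def)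
  qed
  show "(\<integral>\<^sup>+t. ennreal (t powr (a - 1) * Q t powr a / (1 + t * Q t)\<^sup>2) * indicator {\<epsilon>..1} t \<partial>lborel) \<le> ennreal (1 / a)"
  proof (cases "\<epsilon> \<le> 1")
    case True
    have "(\<integral>\<^sup>+t. ennreal (t powr (a - 1) * Q t powr a / (1 + t * Q t)\<^sup>2) * indicator {\<epsilon>..1} t \<partial>lborel)
        \<le> (\<integral>\<^sup>+t. ennreal (f t) * indicator {\<epsilon>..1} t \<partial>lborel)"
      using le \<epsilon> by (intro nn_integral_mono) (auto simp: indicator_def intro!: ennreal_leI)
    also have "\<dots> = ennreal (F 1 - F \<epsilon>)"
    proof (rule nn_integral_FTC_Icc[OF _ _ _ True])
      show "f \<in> borel_measurable borel" unfolding f_def g_def u_def u'_def Q_def by measurable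
    qed (use \<epsilon> dF f_nonneg in auto)
    also have "\<dots> \<le> ennreal (1 / a)"
    proof (rule ennreal_leI)
      have "g 1 \<le> 1" using u[of 1] by (simp add: g_def)
      then have "g 1 powr a \<le> 1 powr a" using a g[of 1] by (intro powr_mono2) auto
      then have "F 1 \<le> 1 / a" using a by (simp add: F_def divide_right_mono)
      moreover have "F \<epsilon> \<ge> 0" using a by (simp add: F_def)
      ultimately show "F 1 - F \<epsilon> \<le> 1 / a" by simp
    qed
    finally show ?thesis .
  qed simp
qed

lemma nn_integral_powr_tail:
  "(\<integral>\<^sup>+t. ennreal (t powr (- 5/4)) * indicator {1..} t \<partial>lborel) = 4"
proof -
  have "(\<integral>\<^sup>+t. ennreal (t powr (- 5/4)) * indicator {1..} t \<partial>lborel) = ennreal (0 - (- 4 * 1 powr (- 1/4)))"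
  proof (rule nn_integral_FTC_atLeast[where F = "\<lambda>t. - 4 * t powr (- 1/4)"])
    show "DERIV (\<lambda>t. - 4 * t powr (- 1/4)) t :> t powr (- 5/4)" if "1 \<le> t" for t :: real
      using that by (auto intro!: derivative_eq_intros)
    have "((\<lambda>t::real. t powr (- 1/4)) \<longlongrightarrow> 0) at_top"
      using tendsto_neg_powr[OF _ filterlim_ident, of "-1/4"] by simp
    from tendsto_mult[OF tendsto_const this, of "- 4"]
    show "((\<lambda>t::real. - 4 * t powr (- 1/4)) \<longlongrightarrow> 0) at_top"
      by simp
  qed auto
  then show ?thesis by simp
qed

text \<open>For \<open>X \<le> l\<close> the first summand suffices, for \<open>X > l\<close> the
  second, because \<open>a - 1 \<le> 0\<close>.\<close>

lemma powr_le_weighted: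
  fixes a X l :: real
  assumes a: "0 < a" "a \<le> 1" and X: "X \<ge> 0" and l: "l > 0"
  shows "X powr a \<le> l powr a + l powr (a - 1) * X"
proof (cases "X \<le> l")
  case True
  then have "X powr a \<le> l powr a" using a X by (intro powr_mono2) auto
  then show ?thesis using X by (simp add: add_increasing2)
next
  case False
  then have "X powr a = X powr (a - 1) * X" using l by (simp add: powr_diff)
  also have "\<dots> \<le> l powr (a - 1) * X" using False l a X by (intro mult_right_mono powr_mono2') auto
  finally show ?thesis by (simp add: add_increasing)
qed

text \<open>No integrability is assumed: the Bochner integral of a non-integrable function is 0 by
  convention.\<close>

lemma norm_integral_le_nn_integral:
  fixes f :: "'a \<Rightarrow> 'b::{banach, second_countable_topology}"
  shows "ennreal (norm (LINT x|M. f x)) \<le> (\<integral>\<^sup>+x. ennreal (norm (f x)) \<partial>M)"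
  by (cases "integrable M f") (auto simp: integral_norm_bound_ennreal not_integrable_integral_eq)

section \<open>The short-time and long-time regimes combined\<close>

context power_potential
begin

text \<open>The first two summands come from \<open>t \<le> 1\<close>: the decay of the weight and
  the region where \<open>t * scale y t \<le> 1\<close>. The third is the long-time decay times the
  integral 4 of \<open>t powr (- 5/4)\<close> over \<open>{1..}\<close>, and the last is the total
  integral of \<open>mean_V\<close>.\<close>

definition bound_const :: real where
  "bound_const = (1 + 2 / rate)\<^sup>2 + 32 * M + 4 * (2 + 2 / m) + 1"

lemma rate_pos: "rate > 0"
  using gauss_rate_pos m by (simp add: rate_def)

lemma bound_const_pos: "bound_const > 0"
  unfolding bound_const_def using M_nonneg m by (intro add_nonneg_pos add_nonneg_nonneg) auto

context
  fixes y :: "nat \<Rightarrow> real"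
  assumes y: "y \<in> space (Rd d)"
begin

text \<open>Kept as a function of \<open>t\<close> because it is controlled in two ways: pointwise
  by \<open>scale\<close>, and by 1 when integrated over all positive times.\<close>

definition mean_V :: "real \<Rightarrow> ennreal" where
  "mean_V t = (\<integral>\<^sup>+p. ennreal (fk_weight d V t y p * along y p t) \<partial>P)"

lemma measurable_along2:
  "(\<lambda>q. along y (snd q) (fst q)) \<in> borel_measurable (lborel \<Otimes>\<^sub>M P)"
  "(\<lambda>q. fk_weight d V (fst q) y (snd q)) \<in> borel_measurable (lborel \<Otimes>\<^sub>M P)"
  using y unfolding along_def[abs_def] by measurable

lemma measurable_along1:
  "(\<lambda>p. along y p t) \<in> borel_measurable P"
  "(\<lambda>p. fk_weight d V t y p) \<in> borel_measurable P"
  using y unfolding along_def[abs_def] by measurable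

lemma mean_V_measurable: "mean_V \<in> borel_measurable borel"
proof -
  note [measurable] = measurable_along2
  have "(\<lambda>t. \<integral>\<^sup>+p. ennreal (fk_weight d V t y p * along y p t) \<partial>P) \<in> borel_measurable lborel"
    by measurable
  then show ?thesis by (simp add: mean_V_def[abs_def])
qed

lemma mean_V_le: "0 < t \<Longrightarrow> mean_V t \<le> ennreal (8 * M * scale y t)"
proof -
  assume t: "0 < t"
  have "mean_V t \<le> (\<integral>\<^sup>+p. ennreal (along y p t) \<partial>P)"
    unfolding mean_V_def
  proof (intro nn_integral_mono ennreal_leI)
    fix p
    have "0 \<le> (LINT s:{0..t}|lborel. along y p s)"
      unfolding set_lebesgue_integral_def using along_nonneg by (intro integral_nonneg_AE) auto
    then have "fk_weight d V t y p \<le> 1" by (simp add: fk_weight_along)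
    then show "fk_weight d V t y p * along y p t \<le> along y p t"
      using along_nonneg by (intro mult_left_le_one_le) auto
  qed
  also have "\<dots> \<le> ennreal (8 * M * scale y t)" by (rule nn_integral_V_le[OF y t])
  finally show ?thesis .
qed

context
  fixes a :: real
  assumes a: "0 < a" "a \<le> 1"
begin

lemma nn_integral_fk_weight_powr_le:
  assumes l: "l > 0"
  shows "(\<integral>\<^sup>+p. ennreal (fk_weight d V t y p * along y p t powr a) \<partial>P)
    \<le> ennreal (l powr a) * (\<integral>\<^sup>+p. ennreal (fk_weight d V t y p) \<partial>P) + ennreal (l powr (a - 1)) * mean_V t"
proof -
  note [measurable] = measurable_along1
  have "(\<integral>\<^sup>+p. ennreal (fk_weight d V t y p * along y p t powr a) \<partial>P)
      \<le> (\<integral>\<^sup>+p. ennreal (l powr a) * ennreal (fk_weight d V t y p)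
          + ennreal (l powr (a - 1)) * ennreal (fk_weight d V t y p * along y p t) \<partial>P)"
  proof (rule nn_integral_mono)
    fix p
    have "fk_weight d V t y p * along y p t powr a
        \<le> fk_weight d V t y p * (l powr a + l powr (a - 1) * along y p t)"
      by (intro mult_left_mono powr_le_weighted a l along_nonneg) simp
    then have "ennreal (fk_weight d V t y p * along y p t powr a)
        \<le> ennreal (l powr a * fk_weight d V t y p + l powr (a - 1) * (fk_weight d V t y p * along y p t))"
      by (intro ennreal_leI) (simp add: algebra_simps)
    also have "\<dots> = ennreal (l powr a) * ennreal (fk_weight d V t y p)
          + ennreal (l powr (a - 1)) * ennreal (fk_weight d V t y p * along y p t)"
      using along_nonneg[of y p t] by (subst ennreal_plus) (auto simp: ennreal_mult)
    finally show "ennreal (fk_weight d V t y p * along y p t powr a)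
        \<le> ennreal (l powr a) * ennreal (fk_weight d V t y p)
          + ennreal (l powr (a - 1)) * ennreal (fk_weight d V t y p * along y p t)" .
  qed
  also have "\<dots> = ennreal (l powr a) * (\<integral>\<^sup>+p. ennreal (fk_weight d V t y p) \<partial>P) + ennreal (l powr (a - 1)) * mean_V t"
    unfolding mean_V_def by (subst nn_integral_add) (auto simp: nn_integral_cmult)
  finally show ?thesis .
qed

definition short_weight :: "real \<Rightarrow> real" where
  "short_weight t = t powr (a - 1) * scale y t powr a / (1 + t * scale y t)\<^sup>2"

text \<open>With \<open>l = Q\<close> the coefficient of \<open>mean_V\<close> is
  \<open>(t * Q) powr (a - 1)\<close>, which may be large for small \<open>t * Q\<close>. For
  \<open>t * Q \<le> 1\<close> the pointwise bound \<open>8 * M * Q\<close> is used, and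
  \<open>1 \<le> 4 / (1 + t * Q)\<^sup>2\<close> brings it into the form of
  \<open>short_weight\<close>, whence the 32. For \<open>t * Q > 1\<close> the coefficient is at
  most 1 and \<open>mean_V\<close> is left to be integrated.\<close>

lemma integrand_short_le:
  assumes t: "0 < t" "t \<le> 1"
  shows "ennreal (t powr (a - 1)) * (\<integral>\<^sup>+p. ennreal (fk_weight d V t y p * along y p t powr a) \<partial>P)
    \<le> ennreal ((1 + 2 / rate)\<^sup>2 + 32 * M) * ennreal (short_weight t) + mean_V t"
proof -
  define Q where "Q = scale y t"
  have Q: "Q > 0" using scale_pos[OF t(1)] by (simp add: Q_def)
  define c where "c = (1 + 2 / rate)\<^sup>2"
  have c: "c \<ge> 0" by (simp add: c_def)
  define w where "w = short_weight t"
  have w: "w \<ge> 0" by (simp add: w_def short_weight_def)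
  have Qa: "Q powr (a - 1) * Q = Q powr a" using Q by (simp add: powr_diff)
  have 1: "ennreal (t powr (a - 1)) * (ennreal (Q powr a) * (\<integral>\<^sup>+p. ennreal (fk_weight d V t y p) \<partial>P)) \<le> ennreal (c * w)"
  proof -
    have "ennreal (t powr (a - 1)) * (ennreal (Q powr a) * (\<integral>\<^sup>+p. ennreal (fk_weight d V t y p) \<partial>P))
        \<le> ennreal (t powr (a - 1)) * (ennreal (Q powr a) * ennreal (exp (- (rate * t * Q))))"
      unfolding Q_def by (intro mult_left_mono nn_integral_fk_weight_short y t) auto
    also have "\<dots> = ennreal (t powr (a - 1) * (Q powr a * exp (- (rate * (t * Q)))))"
      by (simp add: ennreal_mult mult.assoc)
    also have "\<dots> \<le> ennreal (t powr (a - 1) * (Q powr a * (c / (1 + t * Q)\<^sup>2)))"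
      unfolding c_def using rate_pos t Q
      by (intro ennreal_leI mult_left_mono exp_neg_le_inverse_square) auto
    also have "\<dots> = ennreal (c * w)" by (simp add: w_def short_weight_def Q_def mult_ac)
    finally show ?thesis .
  qed
  have 2: "ennreal (t powr (a - 1)) * (ennreal (Q powr (a - 1)) * mean_V t) \<le> ennreal (32 * M * w) + mean_V t"
  proof (cases "t * Q \<le> 1")
    case True
    have "(1 + t * Q)\<^sup>2 \<le> 2\<^sup>2" using True t Q by (intro power_mono) auto
    then have q: "1 \<le> 4 / (1 + t * Q)\<^sup>2"
    proof -
      have "t * Q > 0" using t Q by simp
      then have "(1 + t * Q)\<^sup>2 > 0" by (intro zero_less_power) linarith
      with \<open>(1 + t * Q)\<^sup>2 \<le> 2\<^sup>2\<close> show ?thesis by simp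
    qed
    have "ennreal (t powr (a - 1)) * (ennreal (Q powr (a - 1)) * mean_V t)
        \<le> ennreal (t powr (a - 1)) * (ennreal (Q powr (a - 1)) * ennreal (8 * M * Q))"
      unfolding Q_def by (intro mult_left_mono mean_V_le t) auto
    also have "\<dots> = ennreal (8 * M * (t powr (a - 1) * Q powr a) * 1)"
      using M_nonneg Q by (simp add: ennreal_mult[symmetric] Qa[symmetric] mult_ac)
    also have "\<dots> \<le> ennreal (8 * M * (t powr (a - 1) * Q powr a) * (4 / (1 + t * Q)\<^sup>2))"
      using M_nonneg q by (intro ennreal_leI mult_left_mono) auto
    also have "\<dots> = ennreal (32 * M * w)" by (simp add: w_def short_weight_def Q_def mult.assoc)
    finally show ?thesis by (rule order_trans) simp
  next
    case False
    then have "(t * Q) powr (a - 1) \<le> 1 powr (a - 1)" using a by (intro powr_mono2') auto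
    then have "ennreal (t powr (a - 1)) * ennreal (Q powr (a - 1)) \<le> 1"
      using t Q by (simp add: ennreal_mult[symmetric] powr_mult[symmetric] ennreal_le_1)
    then have "ennreal (t powr (a - 1)) * ennreal (Q powr (a - 1)) * mean_V t \<le> 1 * mean_V t"
      by (rule mult_right_mono) simp
    then show ?thesis by (simp add: mult.assoc add_increasing)
  qed
  have "ennreal (t powr (a - 1)) * (\<integral>\<^sup>+p. ennreal (fk_weight d V t y p * along y p t powr a) \<partial>P)
      \<le> ennreal (t powr (a - 1)) *
        (ennreal (Q powr a) * (\<integral>\<^sup>+p. ennreal (fk_weight d V t y p) \<partial>P) + ennreal (Q powr (a - 1)) * mean_V t)"
    by (intro mult_left_mono nn_integral_fk_weight_powr_le Q) simp
  also have "\<dots> \<le> ennreal (c * w) + (ennreal (32 * M * w) + mean_V t)"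
    unfolding distrib_left by (intro add_mono 1 2)
  also have "\<dots> = ennreal ((c + 32 * M) * w) + mean_V t"
    using c w M_nonneg by (simp add: distrib_right ennreal_plus add.assoc)
  finally show ?thesis
    using c w M_nonneg by (simp add: ennreal_mult c_def w_def)
qed

text \<open>The weight \<open>l = 1 / t\<close> makes the coefficient of \<open>mean_V\<close>
  exactly 1 and leaves \<open>t powr (- 1)\<close> in front of the decay
  \<open>t powr (- 1/4)\<close>.\<close>

lemma integrand_long_le:
  assumes t: "1 \<le> t"
  shows "ennreal (t powr (a - 1)) * (\<integral>\<^sup>+p. ennreal (fk_weight d V t y p * along y p t powr a) \<partial>P)
    \<le> ennreal (2 + 2 / m) * ennreal (t powr (- 5/4)) + mean_V t"
proof -
  have l: "1 / t > 0" using t by simp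
  have p1: "t powr (a - 1) * (1 / t) powr a = t powr (- 1)"
    using t by (simp add: powr_divide powr_diff powr_minus_divide)
  have p2: "t powr (a - 1) * (1 / t) powr (a - 1) = 1"
    using t by (simp add: powr_divide)
  have "ennreal (t powr (a - 1)) * (\<integral>\<^sup>+p. ennreal (fk_weight d V t y p * along y p t powr a) \<partial>P)
      \<le> ennreal (t powr (a - 1)) *
        (ennreal ((1 / t) powr a) * (\<integral>\<^sup>+p. ennreal (fk_weight d V t y p) \<partial>P) + ennreal ((1 / t) powr (a - 1)) * mean_V t)"
    by (intro mult_left_mono nn_integral_fk_weight_powr_le l) simp
  also have "\<dots> = ennreal (t powr (- 1)) * (\<integral>\<^sup>+p. ennreal (fk_weight d V t y p) \<partial>P) + mean_V t"
    by (simp only: distrib_left mult.assoc[symmetric] ennreal_mult[symmetric] powr_ge_zero p1 p2 ennreal_1 mult_1)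
  also have "\<dots> \<le> ennreal (t powr (- 1)) * ennreal ((2 + 2 / m) * t powr (- 1/4)) + mean_V t"
    by (intro add_right_mono mult_left_mono nn_integral_fk_weight_long y t) simp
  also have "ennreal (t powr (- 1)) * ennreal ((2 + 2 / m) * t powr (- 1/4)) = ennreal (2 + 2 / m) * ennreal (t powr (- 5/4))"
  proof -
    have "t powr (- 1) * t powr (- 1/4) = t powr (- 1 + - 1/4)" by (simp only: powr_add)
    also have "\<dots> = t powr (- 5/4)" by simp
    finally have "(2 + 2 / m) * (t powr (- 1) * t powr (- 1/4)) = (2 + 2 / m) * t powr (- 5/4)"
      by (rule arg_cong)
    then have "t powr (- 1) * ((2 + 2 / m) * t powr (- 1/4)) = (2 + 2 / m) * t powr (- 5/4)"
      by (simp only: mult.left_commute)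
    note eq = this
    have "ennreal (t powr (- 1)) * ennreal ((2 + 2 / m) * t powr (- 1/4))
        = ennreal (t powr (- 1) * ((2 + 2 / m) * t powr (- 1/4)))"
      using m by (intro ennreal_mult[symmetric]) auto
    also have "\<dots> = ennreal (2 + 2 / m) * ennreal (t powr (- 5/4))"
      unfolding eq using m by (intro ennreal_mult) auto
    finally show ?thesis .
  qed
  finally show ?thesis .
qed

lemma nn_integral_time_le:
  "(\<integral>\<^sup>+t. ennreal (t powr (a - 1)) * (\<integral>\<^sup>+p. ennreal (fk_weight d V t y p * along y p t powr a) \<partial>P)
      * indicator {0<..} t \<partial>lborel) \<le> ennreal (bound_const / a)"
proof -
  define c where "c = (1 + 2 / rate)\<^sup>2 + 32 * M"
  have c: "c \<ge> 0" using M_nonneg by (simp add: c_def)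
  note [measurable] = mean_V_measurable
  have [measurable]: "short_weight \<in> borel_measurable borel"
    unfolding short_weight_def[abs_def] scale_def by measurable
  have "(\<integral>\<^sup>+t. ennreal (t powr (a - 1)) * (\<integral>\<^sup>+p. ennreal (fk_weight d V t y p * along y p t powr a) \<partial>P)
      * indicator {0<..} t \<partial>lborel)
    \<le> (\<integral>\<^sup>+t. ennreal c * (ennreal (short_weight t) * indicator {0<..1} t)
        + (ennreal (2 + 2 / m) * (ennreal (t powr (- 5/4)) * indicator {1..} t) + mean_V t * indicator {0<..} t) \<partial>lborel)"
  proof (rule nn_integral_mono)
    fix t :: real
    consider "t \<le> 0" | "0 < t" "t \<le> 1" | "1 < t" by linarith
    then show "ennreal (t powr (a - 1)) * (\<integral>\<^sup>+p. ennreal (fk_weight d V t y p * along y p t powr a) \<partial>P) * indicator {0<..} t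
      \<le> ennreal c * (ennreal (short_weight t) * indicator {0<..1} t)
        + (ennreal (2 + 2 / m) * (ennreal (t powr (- 5/4)) * indicator {1..} t) + mean_V t * indicator {0<..} t)"
    proof cases
      case 2
      \<comment> \<open>The indicators of the two regimes overlap at \<open>t = 1\<close>, where the
        long-time term is merely an additional nonnegative summand.\<close>
      have "ennreal (t powr (a - 1)) * (\<integral>\<^sup>+p. ennreal (fk_weight d V t y p * along y p t powr a) \<partial>P)
          \<le> ennreal c * ennreal (short_weight t)
            + (ennreal (2 + 2 / m) * (ennreal (t powr (- 5/4)) * indicator {1..} t) + mean_V t)"
        unfolding c_def
        by (rule order_trans[OF integrand_short_le[OF 2]]) (intro add_left_mono add_increasing order_refl, simp)
      then show ?thesis using 2 by simp
    next
      case 3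
      then show ?thesis using integrand_long_le[of t] by simp
    qed simp
  qed
  also have "\<dots> = ennreal c * (\<integral>\<^sup>+t. ennreal (short_weight t) * indicator {0<..1} t \<partial>lborel)
      + (ennreal (2 + 2 / m) * (\<integral>\<^sup>+t. ennreal (t powr (- 5/4)) * indicator {1..} t \<partial>lborel)
      + (\<integral>\<^sup>+t. mean_V t * indicator {0<..} t \<partial>lborel))"
    by (simp add: nn_integral_add nn_integral_cmult)
  also have "\<dots> \<le> ennreal c * ennreal (1 / a) + (ennreal (2 + 2 / m) * 4 + 1)"
  proof (intro add_mono mult_left_mono)
    show "(\<integral>\<^sup>+t. ennreal (short_weight t) * indicator {0<..1} t \<partial>lborel) \<le> ennreal (1 / a)"
      unfolding short_weight_def scale_eq
      using d \<alpha> a by (intro nn_integral_scale_le sum_nonneg) auto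
    show "(\<integral>\<^sup>+t. mean_V t * indicator {0<..} t \<partial>lborel) \<le> 1"
      unfolding mean_V_def by (rule nn_integral_fk_weight_V_le_1[OF y])
    show "(\<integral>\<^sup>+t. ennreal (t powr (- 5/4)) * indicator {1..} t \<partial>lborel) \<le> 4"
      by (simp only: nn_integral_powr_tail)
  qed auto
  also have "\<dots> = ennreal (c / a + (4 * (2 + 2 / m) + 1))"
  proof -
    have "ennreal (2 + 2 / m) * 4 = ennreal (2 + 2 / m) * ennreal 4" by simp
    also have "\<dots> = ennreal (4 * (2 + 2 / m))" using m by (subst ennreal_mult[symmetric]) (auto simp: mult_ac)
    finally have "ennreal (2 + 2 / m) * 4 + 1 = ennreal (4 * (2 + 2 / m) + 1)"
      using m by (simp add: ennreal_plus)
    moreover have "ennreal c * ennreal (1 / a) = ennreal (c / a)"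
      using c a by (subst ennreal_mult[symmetric]) auto
    ultimately show ?thesis using c a m by (simp add: ennreal_plus)
  qed
  also have "\<dots> \<le> ennreal (bound_const / a)"
  proof (rule ennreal_leI)
    \<comment> \<open>Since \<open>a \<le> 1\<close>, the summands without \<open>1 / a\<close> may
      be divided by \<open>a\<close> as well.\<close>
    have "4 * (2 + 2 / m) + 1 \<le> (4 * (2 + 2 / m) + 1) / a"
      using a m by (subst pos_le_divide_eq) (auto intro!: mult_left_le)
    then show "c / a + (4 * (2 + 2 / m) + 1) \<le> bound_const / a"
      by (simp add: bound_const_def c_def add_divide_distrib)
  qed
  finally show ?thesis .
qed

end

end

end

section \<open>The Riesz transform\<close>

context power_potential
begin

text \<open>\<open>V x powr a\<close> sits at the starting point, where nothing averages it.
  Symmetry moves it to the endpoint and \<open>h\<close> to the start; then the bound on the time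
  integral applies for each starting point \<open>y\<close> separately.\<close>

lemma riesz_nn_bound:
  assumes a: "0 < a" "a \<le> 1" and h [measurable]: "h \<in> borel_measurable (Rd d)"
  shows "(\<integral>\<^sup>+x. \<integral>\<^sup>+t. (\<integral>\<^sup>+p. ennreal (V x powr a * t powr (a - 1))
        * (ennreal (fk_weight d V t x p) * h (vplus d x (p (max 0 t)))) \<partial>P) * indicator {0<..} t \<partial>lborel \<partial>Rd d)
    \<le> ennreal (bound_const / a) * (\<integral>\<^sup>+y. h y \<partial>Rd d)"
proof -
  interpret RL: pair_sigma_finite "Rd d" lborel ..
  define \<Phi> where "\<Phi> = (\<lambda>y t. ennreal (t powr (a - 1)) * (\<integral>\<^sup>+p. ennreal (fk_weight d V t y p * along y p t powr a) \<partial>P))"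
  have \<Phi>_meas [measurable]: "(\<lambda>q. \<Phi> (fst q) (snd q)) \<in> borel_measurable (Rd d \<Otimes>\<^sub>M lborel)"
    unfolding \<Phi>_def along_def by measurable
  have swap: "(\<integral>\<^sup>+x. \<integral>\<^sup>+p. ennreal (V x powr a * t powr (a - 1))
        * (ennreal (fk_weight d V t x p) * h (vplus d x (p (max 0 t)))) \<partial>P \<partial>Rd d) = (\<integral>\<^sup>+y. h y * \<Phi> y t \<partial>Rd d)"
    if t: "t > 0" for t
  proof -
    have pt [measurable]: "(\<lambda>p. p t) \<in> measurable P (Rd d)" using t by (intro measurable_P_at) simp
    have pt' [measurable]: "(\<lambda>q. snd q t) \<in> measurable (Rd d \<Otimes>\<^sub>M P) (Rd d)"
      by (rule measurable_compose[OF measurable_snd pt])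
    have "(\<integral>\<^sup>+x. \<integral>\<^sup>+p. ennreal (V x powr a * t powr (a - 1))
        * (ennreal (fk_weight d V t x p) * h (vplus d x (p (max 0 t)))) \<partial>P \<partial>Rd d)
      = (\<integral>\<^sup>+x. \<integral>\<^sup>+p. ennreal (V x powr a * t powr (a - 1))
        * (ennreal (fk_weight d V t x p) * h (vplus d x (p t))) \<partial>P \<partial>Rd d)"
      using t by (simp add: max_absorb2)
    also have "\<dots> = (\<integral>\<^sup>+y. \<integral>\<^sup>+p. h y
        * (ennreal (fk_weight d V t y p) * ennreal (V (vplus d y (p t)) powr a * t powr (a - 1))) \<partial>P \<partial>Rd d)"
      by (rule feynman_kac_symmetric[OF V_meas t]) measurable
    also have "\<dots> = (\<integral>\<^sup>+y. h y * \<Phi> y t \<partial>Rd d)"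
    proof (rule nn_integral_cong)
      fix y assume y [measurable]: "y \<in> space (Rd d)"
      have "(\<integral>\<^sup>+p. h y * (ennreal (fk_weight d V t y p) * ennreal (V (vplus d y (p t)) powr a * t powr (a - 1))) \<partial>P)
          = (\<integral>\<^sup>+p. h y * (ennreal (t powr (a - 1)) * ennreal (fk_weight d V t y p * along y p t powr a)) \<partial>P)"
        using t by (intro nn_integral_cong) (simp add: along_def max_absorb2 ennreal_mult mult_ac)
      also have "\<dots> = h y * \<Phi> y t"
      proof -
        note [measurable] = measurable_along1[OF y]
        have "(\<lambda>p. ennreal (fk_weight d V t y p * along y p t powr a)) \<in> borel_measurable P" by measurable
        then show ?thesis unfolding \<Phi>_def by (simp add: nn_integral_cmult)
      qed
      finally show "(\<integral>\<^sup>+p. h y * (ennreal (fk_weight d V t y p) * ennreal (V (vplus d y (p t)) powr a * t powr (a - 1))) \<partial>P)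
          = h y * \<Phi> y t" .
    qed
    finally show ?thesis .
  qed
  have "(\<integral>\<^sup>+x. \<integral>\<^sup>+t. (\<integral>\<^sup>+p. ennreal (V x powr a * t powr (a - 1))
        * (ennreal (fk_weight d V t x p) * h (vplus d x (p (max 0 t)))) \<partial>P) * indicator {0<..} t \<partial>lborel \<partial>Rd d)
      = (\<integral>\<^sup>+t. \<integral>\<^sup>+x. (\<integral>\<^sup>+p. ennreal (V x powr a * t powr (a - 1))
        * (ennreal (fk_weight d V t x p) * h (vplus d x (p (max 0 t)))) \<partial>P) * indicator {0<..} t \<partial>Rd d \<partial>lborel)"
    by (rule RL.Fubini'[symmetric]) measurable
  also have "\<dots> = (\<integral>\<^sup>+t. \<integral>\<^sup>+y. h y * (\<Phi> y t * indicator {0<..} t) \<partial>Rd d \<partial>lborel)"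
  proof (rule nn_integral_cong)
    fix t :: real
    show "(\<integral>\<^sup>+x. (\<integral>\<^sup>+p. ennreal (V x powr a * t powr (a - 1))
        * (ennreal (fk_weight d V t x p) * h (vplus d x (p (max 0 t)))) \<partial>P) * indicator {0<..} t \<partial>Rd d)
      = (\<integral>\<^sup>+y. h y * (\<Phi> y t * indicator {0<..} t) \<partial>Rd d)"
      using swap[of t] by (cases "t > 0") simp_all
  qed
  also have "\<dots> = (\<integral>\<^sup>+y. \<integral>\<^sup>+t. h y * (\<Phi> y t * indicator {0<..} t) \<partial>lborel \<partial>Rd d)"
    by (rule RL.Fubini') measurable
  also have "\<dots> \<le> (\<integral>\<^sup>+y. ennreal (bound_const / a) * h y \<partial>Rd d)"
  proof (rule nn_integral_mono)
    fix y assume y [measurable]: "y \<in> space (Rd d)"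
    have [measurable]: "(\<lambda>t. \<Phi> y t) \<in> borel_measurable lborel"
      using measurable_compose[OF measurable_Pair1'[OF y] \<Phi>_meas] by simp
    have "(\<integral>\<^sup>+t. h y * (\<Phi> y t * indicator {0<..} t) \<partial>lborel) = h y * (\<integral>\<^sup>+t. \<Phi> y t * indicator {0<..} t \<partial>lborel)"
      by (rule nn_integral_cmult) measurable
    also have "\<dots> \<le> h y * ennreal (bound_const / a)"
      unfolding \<Phi>_def by (intro mult_left_mono nn_integral_time_le y a) simp
    finally show "(\<integral>\<^sup>+t. h y * (\<Phi> y t * indicator {0<..} t) \<partial>lborel) \<le> ennreal (bound_const / a) * h y"
      by (simp add: mult.commute)
  qed
  also have "\<dots> = ennreal (bound_const / a) * (\<integral>\<^sup>+y. h y \<partial>Rd d)"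
    by (rule nn_integral_cmult) simp
  finally show ?thesis .
qed

text \<open>By \<open>V_lower\<close> the potential can vanish only at the origin, a null set for
  \<open>d \<ge> 1\<close>. Positivity permits division by \<open>V x powr a\<close> when the
  convergence of the integral over \<open>t\<close> is deduced.\<close>

lemma AE_V_pos: "AE x in Rd d. 0 < V x"
proof (rule AE_I')
  interpret product_sigma_finite "\<lambda>_. lborel :: real measure"
    by (simp add: product_sigma_finite_def lborel.sigma_finite_measure_axioms)
  have "emeasure (Rd d) (\<Pi>\<^sub>E i\<in>{..<d}. {0}) = (\<Prod>i<d. emeasure lborel {0::real})"
    unfolding Rd_def by (rule emeasure_PiM) auto
  also have "\<dots> = 0" using d by (simp add: prod_zero_iff lessThan_empty_iff)
  finally show "(\<Pi>\<^sub>E i\<in>{..<d}. {0}) \<in> null_sets (Rd d)"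
  proof (rule null_setsI)
    show "(\<Pi>\<^sub>E i\<in>{..<d}. {0}) \<in> sets (Rd d)"
      unfolding Rd_def by (rule sets_PiM_I_finite) auto
  qed
  show "{x \<in> space (Rd d). \<not> 0 < V x} \<subseteq> (\<Pi>\<^sub>E i\<in>{..<d}. {0})"
  proof
    fix x assume "x \<in> {x \<in> space (Rd d). \<not> 0 < V x}"
    then have x: "x \<in> space (Rd d)" "V x \<le> 0" by auto
    then have "m * (\<Sum>i<d. \<bar>x i\<bar> powr \<alpha>) \<le> 0" using V_lower by force
    then have "(\<Sum>i<d. \<bar>x i\<bar> powr \<alpha>) \<le> 0" using m by (simp add: mult_le_0_iff)
    then have "(\<Sum>i<d. \<bar>x i\<bar> powr \<alpha>) = 0" by (intro antisym sum_nonneg) auto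
    then have "\<forall>i<d. x i = 0" by (subst (asm) sum_nonneg_eq_0_iff) auto
    then show "x \<in> (\<Pi>\<^sub>E i\<in>{..<d}. {0})" using x(1) by (auto simp: space_Rd intro!: extensionalityI[of _ "{..<d}"])
  qed
qed

context
  fixes W :: "(nat \<Rightarrow> real) \<Rightarrow> (real \<Rightarrow> nat \<Rightarrow> real) measure" and f :: "(nat \<Rightarrow> real) \<Rightarrow> complex" and a :: real
  assumes W: "\<And>x. x \<in> space (Rd d) \<Longrightarrow> wiener_measure d x (W x)"
    and f: "integrable (Rd d) f" and a: "0 < a" "a \<le> 1"
begin

lemma f_measurable [measurable]: "f \<in> borel_measurable (Rd d)"
  using f by simp

text \<open>The Feynman-Kac integral taken over \<open>P\<close>, hence jointly measurable in
  \<open>x\<close> and \<open>t\<close>.\<close>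

definition semigroup :: "(nat \<Rightarrow> real) \<Rightarrow> real \<Rightarrow> complex" where
  "semigroup x t = (LINT p|P. fk_weight d V t x p *\<^sub>R f (vplus d x (p (max 0 t))))"

lemma measurable_semigroup [measurable]:
  "(\<lambda>q. semigroup (fst q) (snd q)) \<in> borel_measurable (Rd d \<Otimes>\<^sub>M lborel)"
  unfolding semigroup_def by measurable

lemma riesz_integrand_eq:
  "x \<in> space (Rd d) \<Longrightarrow> t > 0 \<Longrightarrow> riesz_integrand W V a f x t = t powr (a - 1) *\<^sub>R semigroup x t"
  using W by (simp add: riesz_integrand_def feynman_kac_eq semigroup_def max_absorb2)

text \<open>The Riesz transform with absolute values inside all integrals and without the factor
  \<open>1 / Gamma a\<close>. That its integral is finite gives both the convergence in
  \<open>t\<close> and the norm bound.\<close>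

definition majorant :: "(nat \<Rightarrow> real) \<Rightarrow> ennreal" where
  "majorant x = (\<integral>\<^sup>+t. (\<integral>\<^sup>+p. ennreal (V x powr a * t powr (a - 1))
        * (ennreal (fk_weight d V t x p) * ennreal (norm (f (vplus d x (p (max 0 t)))))) \<partial>P) * indicator {0<..} t \<partial>lborel)"

lemma measurable_majorant [measurable]: "majorant \<in> borel_measurable (Rd d)"
  unfolding majorant_def[abs_def] by measurable

lemma nn_integral_riesz_le_majorant:
  assumes x: "x \<in> space (Rd d)"
  shows "ennreal (V x powr a) * (\<integral>\<^sup>+t. ennreal (norm (indicator {0<..} t *\<^sub>R riesz_integrand W V a f x t)) \<partial>lborel) \<le> majorant x"
proof -
  have [measurable]: "(\<lambda>t. semigroup x t) \<in> borel_measurable lborel"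
    using measurable_compose[OF measurable_Pair1'[OF x] measurable_semigroup] by simp
  have eq: "indicator {0<..} t *\<^sub>R riesz_integrand W V a f x t = indicator {0<..} t *\<^sub>R (t powr (a - 1) *\<^sub>R semigroup x t)" for t
    using riesz_integrand_eq[OF x] by (auto simp: indicator_def)
  have "ennreal (V x powr a) * (\<integral>\<^sup>+t. ennreal (norm (indicator {0<..} t *\<^sub>R riesz_integrand W V a f x t)) \<partial>lborel)
      = (\<integral>\<^sup>+t. ennreal (V x powr a) * ennreal (norm (indicator {0<..} t *\<^sub>R (t powr (a - 1) *\<^sub>R semigroup x t))) \<partial>lborel)"
    unfolding eq by (rule nn_integral_cmult[symmetric]) measurable
  also have "\<dots> \<le> majorant x"
    unfolding majorant_def
  proof (rule nn_integral_mono)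
    fix t :: real
    show "ennreal (V x powr a) * ennreal (norm (indicator {0<..} t *\<^sub>R (t powr (a - 1) *\<^sub>R semigroup x t)))
      \<le> (\<integral>\<^sup>+p. ennreal (V x powr a * t powr (a - 1))
        * (ennreal (fk_weight d V t x p) * ennreal (norm (f (vplus d x (p (max 0 t)))))) \<partial>P) * indicator {0<..} t"
    proof (cases "t > 0")
      case True
      have [measurable]: "(\<lambda>p. p (max 0 t)) \<in> measurable P (Rd d)" by (intro measurable_P_at) simp
      have [measurable]: "(\<lambda>p. fk_weight d V t x p) \<in> borel_measurable P"
        using x by measurable
      have "ennreal (V x powr a) * ennreal (norm (indicator {0<..} t *\<^sub>R (t powr (a - 1) *\<^sub>R semigroup x t)))
          = ennreal (V x powr a * t powr (a - 1)) * ennreal (norm (semigroup x t))"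
        using True by (simp add: ennreal_mult mult_ac)
      also have "\<dots> \<le> ennreal (V x powr a * t powr (a - 1)) * (\<integral>\<^sup>+p. ennreal (norm (fk_weight d V t x p *\<^sub>R f (vplus d x (p (max 0 t))))) \<partial>P)"
        unfolding semigroup_def by (intro mult_left_mono norm_integral_le_nn_integral) simp
      also have "\<dots> = (\<integral>\<^sup>+p. ennreal (V x powr a * t powr (a - 1)) * ennreal (norm (fk_weight d V t x p *\<^sub>R f (vplus d x (p (max 0 t))))) \<partial>P)"
        using x by (intro nn_integral_cmult[symmetric]) measurable
      finally show ?thesis using True by (simp add: ennreal_mult)
    qed simp
  qed
  finally show ?thesis .
qed

lemma riesz_transform_bound:
  shows "AE x in Rd d. set_integrable lborel {0<..} (riesz_integrand W V a f x)" (is ?ae)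
    and "integrable (Rd d) (riesz_transform W V a f)" (is ?int)
    and "(LINT x|Rd d. norm (riesz_transform W V a f x)) \<le> bound_const / Gamma (1 + a) * (LINT x|Rd d. norm (f x))" (is ?le)
proof -
  have \<Gamma>: "Gamma a > 0" "Gamma (1 + a) = a * Gamma a" "Gamma (1 + a) > 0"
  proof -
    have "a \<notin> \<int>\<^sub>\<le>\<^sub>0" using a by (auto elim!: nonpos_Ints_cases)
    then show "Gamma (1 + a) = a * Gamma a" using Gamma_plus1[of a] by (simp add: add.commute)
  qed (use a in \<open>auto intro: Gamma_real_pos\<close>)
  have nf: "(\<integral>\<^sup>+y. ennreal (norm (f y)) \<partial>Rd d) = ennreal (LINT x|Rd d. norm (f x))"
    using f by (intro nn_integral_eq_integral) auto
  have maj: "(\<integral>\<^sup>+x. majorant x \<partial>Rd d) \<le> ennreal (bound_const / a) * ennreal (LINT x|Rd d. norm (f x))"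
    unfolding majorant_def nf[symmetric] by (rule riesz_nn_bound[OF a]) measurable
  have "(\<integral>\<^sup>+x. majorant x \<partial>Rd d) \<noteq> \<infinity>"
    using le_less_trans[OF maj, of \<infinity>] by (auto simp: ennreal_mult_less_top)
  then have "AE x in Rd d. majorant x \<noteq> \<infinity>" by (intro nn_integral_PInf_AE) measurable
  with AE_V_pos AE_space show ?ae
  proof eventually_elim
    case (elim x)
    have [measurable]: "(\<lambda>t. semigroup x t) \<in> borel_measurable lborel"
      using measurable_compose[OF measurable_Pair1'[OF elim(2)] measurable_semigroup] by simp
    have eq: "(\<lambda>t. indicator {0<..} t *\<^sub>R riesz_integrand W V a f x t)
        = (\<lambda>t. indicator {0<..} t *\<^sub>R (t powr (a - 1) *\<^sub>R semigroup x t))"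
      using riesz_integrand_eq[OF elim(2)] by (auto simp: indicator_def)
    have "ennreal (V x powr a) * (\<integral>\<^sup>+t. ennreal (norm (indicator {0<..} t *\<^sub>R riesz_integrand W V a f x t)) \<partial>lborel) < \<infinity>"
      using nn_integral_riesz_le_majorant[OF elim(2)] elim(3) by (simp add: less_top le_less_trans top.not_eq_extremum)
    \<comment> \<open>The factor \<open>V x powr a\<close> is positive, so finiteness of the product
      gives finiteness of the integral.\<close>
    then have "(\<integral>\<^sup>+t. ennreal (norm (indicator {0<..} t *\<^sub>R riesz_integrand W V a f x t)) \<partial>lborel) < \<infinity>"
      using elim(1) by (auto simp: ennreal_mult_less_top)
    moreover have "(\<lambda>t. indicator {0<..} t *\<^sub>R riesz_integrand W V a f x t) \<in> borel_measurable lborel"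
      unfolding eq by measurable
    ultimately show ?case
      unfolding set_integrable_def by (intro integrableI_bounded) auto
  qed
  have meas: "riesz_transform W V a f \<in> borel_measurable (Rd d)"
  proof -
    have "(\<lambda>x. (V x powr a / Gamma a) *\<^sub>R (LINT t|lborel. indicator {0<..} t *\<^sub>R (t powr (a - 1) *\<^sub>R semigroup x t)))
        \<in> borel_measurable (Rd d)"
      by measurable
    moreover have "riesz_transform W V a f x
        = (V x powr a / Gamma a) *\<^sub>R (LINT t|lborel. indicator {0<..} t *\<^sub>R (t powr (a - 1) *\<^sub>R semigroup x t))"
      if "x \<in> space (Rd d)" for x
    proof -
      have "(\<lambda>t. indicator {0<..} t *\<^sub>R riesz_integrand W V a f x t)
          = (\<lambda>t. indicator {0<..} t *\<^sub>R (t powr (a - 1) *\<^sub>R semigroup x t))"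
        using riesz_integrand_eq[OF that] by (auto simp: indicator_def)
      then show ?thesis unfolding riesz_transform_def set_lebesgue_integral_def by simp
    qed
    ultimately show ?thesis by (subst measurable_cong) auto
  qed
  have "(\<integral>\<^sup>+x. ennreal (norm (riesz_transform W V a f x)) \<partial>Rd d) \<le> (\<integral>\<^sup>+x. ennreal (1 / Gamma a) * majorant x \<partial>Rd d)"
  proof (rule nn_integral_mono)
    fix x assume x: "x \<in> space (Rd d)"
    have "ennreal (norm (riesz_transform W V a f x))
        = ennreal (1 / Gamma a) * (ennreal (V x powr a) * ennreal (norm (LINT t|lborel. indicator {0<..} t *\<^sub>R riesz_integrand W V a f x t)))"
      using \<Gamma> by (simp add: riesz_transform_def set_lebesgue_integral_def ennreal_mult[symmetric])
    also have "\<dots> \<le> ennreal (1 / Gamma a) * (ennreal (V x powr a) *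
        (\<integral>\<^sup>+t. ennreal (norm (indicator {0<..} t *\<^sub>R riesz_integrand W V a f x t)) \<partial>lborel))"
      by (intro mult_left_mono norm_integral_le_nn_integral) auto
    also have "\<dots> \<le> ennreal (1 / Gamma a) * majorant x"
      by (intro mult_left_mono nn_integral_riesz_le_majorant x) simp
    finally show "ennreal (norm (riesz_transform W V a f x)) \<le> ennreal (1 / Gamma a) * majorant x" .
  qed
  also have "\<dots> = ennreal (1 / Gamma a) * (\<integral>\<^sup>+x. majorant x \<partial>Rd d)"
    by (rule nn_integral_cmult) measurable
  also have "\<dots> \<le> ennreal (1 / Gamma a) * (ennreal (bound_const / a) * ennreal (LINT x|Rd d. norm (f x)))"
    by (intro mult_left_mono maj) simp
  \<comment> \<open>The \<open>1 / a\<close> of the time integral meets \<open>1 / Gamma a\<close>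
    and yields \<open>1 / Gamma (1 + a)\<close>.\<close>
  also have "\<dots> = ennreal (bound_const / Gamma (1 + a) * (LINT x|Rd d. norm (f x)))"
    using \<Gamma> a bound_const_pos by (simp add: ennreal_mult[symmetric] mult_ac)
  finally have le: "(\<integral>\<^sup>+x. ennreal (norm (riesz_transform W V a f x)) \<partial>Rd d)
      \<le> ennreal (bound_const / Gamma (1 + a) * (LINT x|Rd d. norm (f x)))" .
  then have "(\<integral>\<^sup>+x. ennreal (norm (riesz_transform W V a f x)) \<partial>Rd d) < \<infinity>"
    by (rule le_less_trans) simp
  with meas show ?int by (intro integrableI_bounded) auto
  then have "ennreal (LINT x|Rd d. norm (riesz_transform W V a f x))
      \<le> ennreal (bound_const / Gamma (1 + a) * (LINT x|Rd d. norm (f x)))"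
    using le by (subst nn_integral_eq_integral[symmetric]) auto
  then show ?le
    using \<Gamma> bound_const_pos by (subst (asm) ennreal_le_iff) (auto intro!: mult_nonneg_nonneg integral_nonneg_AE)
qed

end

end

section \<open>Separable potentials and uniformity of the constant\<close>

lemma separable_potential_power_potential:
  assumes V: "separable_potential d \<alpha> m M V" and P: "wiener_measure d (\<lambda>i\<in>{..<d}. 0) P"
    and "1 \<le> d" "0 < \<alpha>" "\<alpha> \<le> 2" "0 < m"
  shows "power_potential d P V \<alpha> m M"
proof -
  from V obtain Vi :: "nat \<Rightarrow> (nat \<Rightarrow> real) \<Rightarrow> real" where
    sum: "\<And>x. x \<in> space (Rd d) \<Longrightarrow> V x = (\<Sum>i<d. Vi i x)"
    and meas: "\<And>i. i < d \<Longrightarrow> Vi i \<in> borel_measurable (Rd d)"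
    and lower: "\<And>i x. i < d \<Longrightarrow> x \<in> space (Rd d) \<Longrightarrow> m * \<bar>x i\<bar> powr \<alpha> \<le> Vi i x"
    and upper: "\<And>i x. i < d \<Longrightarrow> x \<in> space (Rd d) \<Longrightarrow> Vi i x \<le> M * \<bar>x i\<bar> powr \<alpha>"
    unfolding separable_potential_def by blast
  show ?thesis
  proof
    show "V \<in> borel_measurable (Rd d)"
      using sum meas by (subst measurable_cong[where g = "\<lambda>x. \<Sum>i<d. Vi i x"]) auto
  qed (use assms sum lower upper in \<open>auto simp: sum_distrib_left intro!: sum_mono\<close>)
qed

text \<open>On the compact interval \<open>[1,2]\<close> the function \<open>Gamma\<close> is
  continuous and positive. This keeps \<open>bound_const / Gamma (1 + a)\<close> bounded as
  \<open>a\<close> tends to 0.\<close>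

lemma Gamma_lower_bound:
  obtains c :: real where "c > 0" "\<And>a. 0 < a \<Longrightarrow> a \<le> 1 \<Longrightarrow> c \<le> Gamma (1 + a)"
proof -
  have "continuous_on {1..2::real} Gamma"
    by (intro continuous_on_Gamma continuous_on_id) (auto elim!: nonpos_Ints_cases)
  then obtain x where x: "x \<in> {1..2::real}" "\<And>y. y \<in> {1..2} \<Longrightarrow> Gamma x \<le> Gamma y"
    using continuous_attains_inf[of "{1..2::real}" Gamma] by auto
  show ?thesis
    by (rule that[of "Gamma x"]) (use x in \<open>auto intro: Gamma_real_pos\<close>)
qed

theorem theorem1p2:
  fixes \<alpha> m M :: real
  assumes "0 < \<alpha>" and "\<alpha> \<le> 2" and "0 < m" and "m \<le> M"
  shows "\<exists>C>0. \<forall>(a::real) (d::nat) (V :: (nat \<Rightarrow> real) \<Rightarrow> real)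
           (W :: (nat \<Rightarrow> real) \<Rightarrow> (real \<Rightarrow> nat \<Rightarrow> real) measure)
           (f :: (nat \<Rightarrow> real) \<Rightarrow> complex).
           0 < a \<longrightarrow> a \<le> 1 \<longrightarrow> 1 \<le> d \<longrightarrow> separable_potential d \<alpha> m M V \<longrightarrow>
           (\<forall>x\<in>space (Rd d). wiener_measure d x (W x)) \<longrightarrow>
           integrable (Rd d) f \<longrightarrow>
             (AE x in Rd d. set_integrable lborel {0<..} (riesz_integrand W V a f x)) \<and>
             integrable (Rd d) (riesz_transform W V a f) \<and>
             (LINT x|Rd d. norm (riesz_transform W V a f x)) \<le> C * (LINT x|Rd d. norm (f x))"
proof -
  obtain c :: real where c: "c > 0" "\<And>a. 0 < a \<Longrightarrow> a \<le> 1 \<Longrightarrow> c \<le> Gamma (1 + a)"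
    using Gamma_lower_bound by blast
  \<comment> \<open>Fixed before \<open>d\<close>, \<open>V\<close> and \<open>W\<close> are chosen:
    outside the locale the constant has only the parameters \<open>m\<close> and
    \<open>M\<close>.\<close>
  define B where "B = power_potential.bound_const m M"
  show ?thesis
  \<comment> \<open>The maximum with 1 makes positivity evident while \<open>bound_const_pos\<close>
    is still confined to the locale.\<close>
  proof (intro exI[of _ "max 1 (B / c)"] conjI allI impI)
    fix a :: real and d :: nat and V :: "(nat \<Rightarrow> real) \<Rightarrow> real"
      and W :: "(nat \<Rightarrow> real) \<Rightarrow> (real \<Rightarrow> nat \<Rightarrow> real) measure" and f :: "(nat \<Rightarrow> real) \<Rightarrow> complex"
    assume a: "0 < a" "a \<le> 1" and d: "1 \<le> d" and V: "separable_potential d \<alpha> m M V"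
      and W: "\<forall>x\<in>space (Rd d). wiener_measure d x (W x)" and f: "integrable (Rd d) f"
    \<comment> \<open>The member of the given family at the origin serves as
      \<open>P\<close>.\<close>
    define z :: "nat \<Rightarrow> real" where "z = (\<lambda>i\<in>{..<d}. 0)"
    interpret power_potential d "W z" V \<alpha> m M
      using W assms d by (intro separable_potential_power_potential[OF V]) (auto simp: z_def space_Rd)
    have W': "\<And>x. x \<in> space (Rd d) \<Longrightarrow> wiener_measure d x (W x)" using W by blast
    show "AE x in Rd d. set_integrable lborel {0<..} (riesz_integrand W V a f x)"
      "integrable (Rd d) (riesz_transform W V a f)"
      by (rule riesz_transform_bound[OF W' f a]; assumption)+
    have "(LINT x|Rd d. norm (riesz_transform W V a f x)) \<le> bound_const / Gamma (1 + a) * (LINT x|Rd d. norm (f x))"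
      by (rule riesz_transform_bound[OF W' f a])
    also have "\<dots> \<le> max 1 (B / c) * (LINT x|Rd d. norm (f x))"
    proof (rule mult_right_mono)
      have "bound_const / Gamma (1 + a) \<le> bound_const / c"
        using bound_const_pos c(1) c(2)[OF a] by (intro divide_left_mono) (auto intro: mult_pos_pos)
      then show "bound_const / Gamma (1 + a) \<le> max 1 (B / c)" by (simp add: B_def)
    qed (simp add: integral_nonneg_AE)
    finally show "(LINT x|Rd d. norm (riesz_transform W V a f x)) \<le> max 1 (B / c) * (LINT x|Rd d. norm (f x))" .
  qed simp
qed

end
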